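(* Tall tame easels are not critical. That is, if $(\mathcal G,z,x,\psi)$ is an easel that is tall and tame, then the canvas $(\mathcal G,z)$ is not $\psi$-critical.
   Context: Graphs are finite, loopless, and may have parallel edges. A $\mathbb{Z}_3$-boundary of a graph $G$ is a map $\beta:V(G)\to\mathbb{Z}_3$ with $\sum_{v\in V(C)}\beta(v)=0$ for every component $C$ of $G$; $\mathcal G=(G,\beta)$ is a $\mathbb{Z}_3$-bordered graph. A nowhere-zero flow in $(G,\beta)$ is an orientation of $G$ with $\deg^+(v)-\deg^-(v)\equiv\beta(v)\pmod 3$ for every $v$. For a vertex $v$, $|\tau(v)|$ equals $0$ if $\deg(v)$ is even and $\beta(v)=0$; $2$ if $\deg(v)$ is even and $\beta(v)\neq 0$; $3$ if $\deg(v)$ is odd and $\beta(v)=0$; $1$ if $\deg(v)$ is odd and $\beta(v)\neq0$. For a partition $\mathcal P$ of $V(G)$, $\mathcal G/\mathcal P$ is obtained by identifying each part into one vertex, deleting loops, and giving each new vertex the sum of $\beta$ over its part; $\mathcal P$ is non-trivial if some part has at least two vertices. A canvas $(\mathcal G,z)$ is a $\mathbb{Z}_3$-bordered graph with a distinguished vertex $z$ (the tip). A tip preflow is an orientation $\psi$ of the edges incident with $z$ with (counting in $\psi$) $\deg^+(z)-\deg^-(z)\equiv\beta(z)\pmod 3$; it extends to a nowhere-zero flow if some nowhere-zero flow agrees with $\psi$ on the edges at $z$. A partition is tip-respecting if $\{z\}$ is a part; then $(\mathcal G/\mathcal P,z)$ is a canvas with the same tip preflows. The canvas is $\psi$-critical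 if $\psi$ does not extend to a nowhere-zero flow in $\mathcal G$ but extends to one in $\mathcal G/\mathcal P$ for every non-trivial tip-respecting partition $\mathcal P$. An easel is a tuple $(\mathcal G,z,x,\psi)$ where $(\mathcal G,z)$ is a canvas, $x\neq z$ is a vertex and $\psi$ is a tip preflow. It is tame if $\deg(v)\ge 4+|\tau(v)|$ for all $v\notin\{x,z\}$; tall if $\deg(z)\le\deg(x)+2$ and, in case $\deg(z)=\deg(x)+2$, there is an edge incident with $z$ but not $x$ that $\psi$ directs towards $z$ and another such edge that $\psi$ directs away from $z$; critical if $(\mathcal G,z)$ is $\psi$-critical. *)

theory Defs
  imports Main "HOL-Library.Numeral_Type" "HOL-Library.Disjoint_Sets"
begin

text \<open>
  Graphs are undirected and may have parallel edges; an edge is identified by its name, and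
  \<open>ends\<close> gives its two end-vertices. The field \<open>boundary\<close> takes values in the type \<open>3\<close>, the ring of
  integers modulo 3.
\<close>

record ('v, 'e) mgraph =
  verts :: "'v set"
  edges :: "'e set"
  ends :: "'e \<Rightarrow> 'v set"

record ('v, 'e) bgraph = "('v, 'e) mgraph" +
  boundary :: "'v \<Rightarrow> 3"

definition graph :: "('v, 'e, 'm) mgraph_scheme \<Rightarrow> bool" where
  "graph G \<longleftrightarrow> finite (verts G) \<and> finite (edges G) \<and>
     (\<forall>e\<in>edges G. ends G e \<subseteq> verts G \<and> card (ends G e) = 2)"

definition incident :: "('v, 'e, 'm) mgraph_scheme \<Rightarrow> 'v \<Rightarrow> 'e set" where
  "incident G v = {e \<in> edges G. v \<in> ends G e}"

definition deg :: "('v, 'e, 'm) mgraph_scheme \<Rightarrow> 'v \<Rightarrow> nat" where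
  "deg G v = card (incident G v)"

definition adj :: "('v, 'e, 'm) mgraph_scheme \<Rightarrow> ('v \<times> 'v) set" where
  "adj G = {(u, v). \<exists>e\<in>edges G. ends G e = {u, v}}"

definition components :: "('v, 'e, 'm) mgraph_scheme \<Rightarrow> 'v set set" where
  "components G = (\<lambda>v. {u \<in> verts G. (v, u) \<in> (adj G)\<^sup>*}) ` verts G"

definition bordered_graph :: "('v, 'e) bgraph \<Rightarrow> bool" where
  "bordered_graph G \<longleftrightarrow> graph G \<and> (\<forall>C\<in>components G. (\<Sum>v\<in>C. boundary G v) = 0)"

text \<open>An orientation is given by the map sending each edge to its head.\<close>

definition orientation_of :: "('v, 'e, 'm) mgraph_scheme \<Rightarrow> 'e set \<Rightarrow> ('e \<Rightarrow> 'v) \<Rightarrow> bool" where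
  "orientation_of G F D \<longleftrightarrow> (\<forall>e\<in>F. D e \<in> ends G e)"

definition outdeg :: "('v, 'e, 'm) mgraph_scheme \<Rightarrow> ('e \<Rightarrow> 'v) \<Rightarrow> 'v \<Rightarrow> nat" where
  "outdeg G D v = card {e \<in> incident G v. D e \<noteq> v}"

definition indeg :: "('v, 'e, 'm) mgraph_scheme \<Rightarrow> ('e \<Rightarrow> 'v) \<Rightarrow> 'v \<Rightarrow> nat" where
  "indeg G D v = card {e \<in> incident G v. D e = v}"

definition nowhere_zero_flow :: "('v, 'e) bgraph \<Rightarrow> ('e \<Rightarrow> 'v) \<Rightarrow> bool" where
  "nowhere_zero_flow G D \<longleftrightarrow> orientation_of G (edges G) D \<and>
     (\<forall>v\<in>verts G. of_nat (outdeg G D v) - of_nat (indeg G D v) = boundary G v)"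

definition abs_tau :: "('v, 'e) bgraph \<Rightarrow> 'v \<Rightarrow> nat" where
  "abs_tau G v =
     (if even (deg G v) then (if boundary G v = 0 then 0 else 2)
      else (if boundary G v = 0 then 3 else 1))"

definition part_of :: "'v set set \<Rightarrow> 'v \<Rightarrow> 'v set" where
  "part_of P v = (THE X. X \<in> P \<and> v \<in> X)"

text \<open>
  The vertices of the quotient graph are the parts themselves; edges keep their names, and those
  with both ends in one part are deleted.
\<close>

definition quotient_graph :: "('v, 'e) bgraph \<Rightarrow> 'v set set \<Rightarrow> ('v set, 'e) bgraph" where
  "quotient_graph G P =
     \<lparr> verts = P,
       edges = {e \<in> edges G. \<not> (\<exists>X\<in>P. ends G e \<subseteq> X)},
       ends = (\<lambda>e. part_of P ` ends G e),
       boundary = (\<lambda>X. \<Sum>v\<in>X. boundary G v) \<rparr>"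

definition quotient_orientation :: "'v set set \<Rightarrow> ('e \<Rightarrow> 'v) \<Rightarrow> 'e \<Rightarrow> 'v set" where
  "quotient_orientation P D = (\<lambda>e. part_of P (D e))"

definition nontrivial_partition :: "'v set set \<Rightarrow> bool" where
  "nontrivial_partition P \<longleftrightarrow> (\<exists>X\<in>P. card X \<ge> 2)"

definition canvas :: "('v, 'e) bgraph \<Rightarrow> 'v \<Rightarrow> bool" where
  "canvas G z \<longleftrightarrow> bordered_graph G \<and> z \<in> verts G"

text \<open>Only the values of \<open>\<psi>\<close> on the edges at the tip are ever used.\<close>

definition tip_preflow :: "('v, 'e) bgraph \<Rightarrow> 'v \<Rightarrow> ('e \<Rightarrow> 'v) \<Rightarrow> bool" where
  "tip_preflow G z \<psi> \<longleftrightarrow> orientation_of G (incident G z) \<psi> \<and>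
     of_nat (outdeg G \<psi> z) - of_nat (indeg G \<psi> z) = boundary G z"

definition extends_to_flow :: "('v, 'e) bgraph \<Rightarrow> 'v \<Rightarrow> ('e \<Rightarrow> 'v) \<Rightarrow> bool" where
  "extends_to_flow G z \<psi> \<longleftrightarrow>
     (\<exists>D. nowhere_zero_flow G D \<and> (\<forall>e\<in>incident G z. D e = \<psi> e))"

definition tip_respecting :: "'v \<Rightarrow> 'v set set \<Rightarrow> bool" where
  "tip_respecting z P \<longleftrightarrow> {z} \<in> P"

text \<open>In the quotient by a tip-respecting partition, the tip \<open>z\<close> becomes the vertex \<open>{z}\<close>.\<close>

definition critical_canvas :: "('v, 'e) bgraph \<Rightarrow> 'v \<Rightarrow> ('e \<Rightarrow> 'v) \<Rightarrow> bool" where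
  "critical_canvas G z \<psi> \<longleftrightarrow> \<not> extends_to_flow G z \<psi> \<and>
     (\<forall>P. partition_on (verts G) P \<and> tip_respecting z P \<and> nontrivial_partition P \<longrightarrow>
        extends_to_flow (quotient_graph G P) {z} (quotient_orientation P \<psi>))"

definition easel :: "('v, 'e) bgraph \<Rightarrow> 'v \<Rightarrow> 'v \<Rightarrow> ('e \<Rightarrow> 'v) \<Rightarrow> bool" where
  "easel G z x \<psi> \<longleftrightarrow> canvas G z \<and> x \<in> verts G \<and> x \<noteq> z \<and> tip_preflow G z \<psi>"

definition tame :: "('v, 'e) bgraph \<Rightarrow> 'v \<Rightarrow> 'v \<Rightarrow> bool" where
  "tame G z x \<longleftrightarrow> (\<forall>v \<in> verts G - {x, z}. deg G v \<ge> 4 + abs_tau G v)"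

definition tall :: "('v, 'e) bgraph \<Rightarrow> 'v \<Rightarrow> 'v \<Rightarrow> ('e \<Rightarrow> 'v) \<Rightarrow> bool" where
  "tall G z x \<psi> \<longleftrightarrow> deg G z \<le> deg G x + 2 \<and>
     (deg G z = deg G x + 2 \<longrightarrow>
        (\<exists>e \<in> incident G z - incident G x. \<psi> e = z) \<and>
        (\<exists>e \<in> incident G z - incident G x. \<psi> e \<noteq> z))"

end

theory Submission
  imports Defs
begin

text \<open>
  The proof refutes a smallest critical tall tame easel. Let \<open>B\<close> be a set of vertices without the tip.
  A flow of \<open>G/B\<close> orients the cut of \<open>B\<close>; contracting everything outside \<open>B\<close> into the tip gives a
  smaller canvas in which this orientation does not extend, and no critical quotient of it is both
  tall and tame. This bounds cuts from below: \<open>d(B) \<ge> 4 + |\<tau>(B)|\<close> if \<open>x \<notin> B\<close>, even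
  \<open>d(B) \<ge> 6 + |\<tau>(B)|\<close> if moreover \<open>|B| \<ge> 2\<close>, and \<open>d(X) \<ge> d(x) + 2\<close> if \<open>X\<close> contains \<open>x\<close> properly
  and misses a vertex besides \<open>z\<close>.

  With these bounds an edge \<open>uv\<close> may be oriented from \<open>u\<close> to \<open>v\<close> and deleted as soon as both ends
  stay tame, and an edge \<open>zx\<close> may always be deleted. A vertex of degree 4 with zero boundary can be
  removed by lifting its edges in two pairs: if two pairings fail, they produce two tight sets around
  \<open>x\<close> whose uncrossing violates the bounds. Hence every vertex other than \<open>x, z\<close> tolerates the
  deletion of an edge in exactly one direction, vertices of different signs are not adjacent, and
  counting the cuts of the two classes together with \<open>x\<close> leaves only one sign. Then all edges at \<open>z\<close>
  point the same way, \<open>d(z) = d(x) + 1\<close>, and \<open>d(B) \<ge> 8\<close> for \<open>|B| \<ge> 2\<close>. Now a neighbour of \<open>z\<close> can be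
  turned into a sink (or source) and removed, after lifting one pair of its edges if its degree is 6.
\<close>

subsection \<open>Graphs with a reference direction\<close>

text \<open>All cut bounds share one source: a part \<open>U\<close> that is not tall satisfies d(B)
  \<ge> d(U) + 2, and in case of equality the cut edges of B outside the cut of U do not show both
  directions. This gain of 2 pays for deleting an edge or lifting a pair. The obstacle is the border
  case d(z) = d(x) + 2, where tallness also asks for both directions at the tip. A lifting can
  destroy a direction although all degrees remain large enough, so for a vertex of degree 4 it has
  to be traced which tip edges cross the tight sets. The final degrees 5 and 6 come from arithmetic
  mod 3. A vertex that tolerates only the sign c has degree 5 and boundary c, or degree 6 and
  boundary -c. A sink for the sign c with d edges has net flow -dc; this fits degree 5, while at
  degree 6 it fits only after a lifting has left four edges. Partitions appear in the induction
  hypothesis because contracting the complement of a set in a critical canvas need not produce a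
  critical one.\<close>

text \<open>
  Every edge has a reference direction, so orientations are functions with values 1 and -1. Loops are
  allowed, so contraction only relabels ends. The values of \<open>pre\<close> matter on the edges at the tip only.
\<close>

record ('v, 'e) rgraph =
  vt :: "'v set"
  ed :: "'e set"
  src :: "'e \<Rightarrow> 'v"
  tgt :: "'e \<Rightarrow> 'v"
  bd :: "'v \<Rightarrow> int"
  pre :: "'e \<Rightarrow> int"

text \<open>A signed incidence: additive over disjoint sets and zero on loops, so net flows of sets
  reduce to those of single vertices.\<close>

definition chi :: "('v, 'e) rgraph \<Rightarrow> 'e \<Rightarrow> 'v set \<Rightarrow> int" where
  "chi J e S = of_bool (src J e \<in> S) - of_bool (tgt J e \<in> S)"

definition ecut :: "('v, 'e) rgraph \<Rightarrow> 'v set \<Rightarrow> 'e set" where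
  "ecut J S = {e \<in> ed J. chi J e S \<noteq> 0}"

definition dg :: "('v, 'e) rgraph \<Rightarrow> 'v set \<Rightarrow> nat" where
  "dg J S = card (ecut J S)"

definition net :: "('v, 'e) rgraph \<Rightarrow> ('e \<Rightarrow> int) \<Rightarrow> 'v set \<Rightarrow> int" where
  "net J f S = (\<Sum>e\<in>ed J. f e * chi J e S)"

definition bsum :: "('v, 'e) rgraph \<Rightarrow> 'v set \<Rightarrow> int" where
  "bsum J S = sum (bd J) S"

text \<open>The boundary has to vanish in total only, not on each component: deleting an oriented
  edge preserves the total but may unbalance a component. Loops are exempt from the condition on
  ends, so a loop may stay behind at a vertex that is removed.\<close>

definition valid :: "('v, 'e) rgraph \<Rightarrow> 'v \<Rightarrow> bool" where
  "valid J z \<longleftrightarrow> finite (vt J) \<and> finite (ed J) \<and> z \<in> vt J \<and>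
     (\<forall>e\<in>ed J. src J e \<noteq> tgt J e \<longrightarrow> src J e \<in> vt J \<and> tgt J e \<in> vt J) \<and>
     (\<forall>e\<in>ed J. pre J e \<in> {1, -1}) \<and>
     net J (pre J) {z} mod 3 = bd J z mod 3 \<and> bsum J (vt J) mod 3 = 0"

definition rflow :: "('v, 'e) rgraph \<Rightarrow> 'v \<Rightarrow> ('e \<Rightarrow> int) \<Rightarrow> bool" where
  "rflow J z f \<longleftrightarrow> (\<forall>e\<in>ed J. f e \<in> {1, -1}) \<and> (\<forall>e\<in>ecut J {z}. f e = pre J e) \<and>
     (\<forall>v\<in>vt J. net J f {v} mod 3 = bd J v mod 3)"

definition ext :: "('v, 'e) rgraph \<Rightarrow> 'v \<Rightarrow> bool" where
  "ext J z \<longleftrightarrow> (\<exists>f. rflow J z f)"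

text \<open>Equivalent to \<open>d \<ge> 4 + |\<tau>|\<close>: that bound is 4 or 6 for even \<open>d\<close>, and 5 or 7 for odd \<open>d\<close>.\<close>

definition tame_deg :: "nat \<Rightarrow> int \<Rightarrow> bool" where
  "tame_deg d b \<longleftrightarrow> 6 \<le> d \<or> (d = 4 \<and> b mod 3 = 0) \<or> (d = 5 \<and> b mod 3 \<noteq> 0)"

text \<open>The product \<open>pre J e * chi J e {z}\<close> is 1 on an edge that the preflow
  directs away from \<open>z\<close> and -1 on one directed towards \<open>z\<close>, whatever its
  reference direction is.\<close>

definition tallp :: "('v, 'e) rgraph \<Rightarrow> 'v \<Rightarrow> 'v set \<Rightarrow> bool" where
  "tallp J z U \<longleftrightarrow> dg J {z} \<le> dg J U + 2 \<and>
     (dg J {z} = dg J U + 2 \<longrightarrow>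
        (\<exists>e\<in>ecut J {z} - ecut J U. pre J e * chi J e {z} = 1) \<and>
        (\<exists>e\<in>ecut J {z} - ecut J U. pre J e * chi J e {z} = - 1))"

text \<open>
  The theorem in a form that survives contractions: take for \<open>Q\<close> the parts of a critical quotient.
\<close>

definition splits :: "('v, 'e) rgraph \<Rightarrow> 'v \<Rightarrow> bool" where
  "splits J z \<longleftrightarrow> (valid J z \<longrightarrow> \<not> ext J z \<longrightarrow>
     (\<exists>Q. partition_on (vt J - {z}) Q \<and>
        (\<forall>U\<in>Q. (\<forall>W\<in>Q - {U}. tame_deg (dg J W) (bsum J W)) \<longrightarrow> \<not> tallp J z U)))"

section \<open>Cuts, net flows and boundary sums\<close>

lemma chi_empty [simp]: "chi J e {} = 0"
  by (simp add: chi_def)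

lemma chi_cases: "chi J e S = 0 \<or> chi J e S = 1 \<or> chi J e S = -1"
  by (auto simp: chi_def)

lemma chi_Un: "A \<inter> B = {} \<Longrightarrow> chi J e (A \<union> B) = chi J e A + chi J e B"
  by (auto simp: chi_def)

lemma chi_sum: "finite S \<Longrightarrow> chi J e S = (\<Sum>v\<in>S. chi J e {v})"
proof (induction S rule: finite_induct)
  case (insert x F)
  then show ?case using chi_Un[of "{x}" F J e] by simp
qed simp

lemma net_Un: "A \<inter> B = {} \<Longrightarrow> net J f (A \<union> B) = net J f A + net J f B"
  by (simp add: net_def chi_Un algebra_simps sum.distrib)

lemma net_sum: "finite S \<Longrightarrow> net J f S = (\<Sum>v\<in>S. net J f {v})"
proof (induction S rule: finite_induct)
  case empty
  then show ?case by (simp add: net_def)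
next
  case (insert x F)
  then show ?case using net_Un[of "{x}" F J f] by simp
qed

lemma sum_mod_cong:
  fixes f g :: "'a \<Rightarrow> int"
  assumes "\<And>x. x \<in> S \<Longrightarrow> f x mod 3 = g x mod 3"
  shows "sum f S mod 3 = sum g S mod 3"
  using assms
proof (induction S rule: infinite_finite_induct)
  case (insert x F)
  then have "f x mod 3 = g x mod 3" "sum f F mod 3 = sum g F mod 3" by auto
  then show ?case using insert by (simp add: mod_add_eq) (metis mod_add_cong)
qed auto

lemma net_eq_bt:
  assumes "finite S" "\<And>v. v \<in> S \<Longrightarrow> net J f {v} mod 3 = bd J v mod 3"
  shows "net J f S mod 3 = bsum J S mod 3"
  unfolding net_sum[OF assms(1)] bsum_def using assms(2) by (rule sum_mod_cong)

lemma bsum_Un: "finite A \<Longrightarrow> finite B \<Longrightarrow> A \<inter> B = {} \<Longrightarrow> bsum J (A \<union> B) = bsum J A + bsum J B"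
  by (simp add: bsum_def sum.union_disjoint)

lemma bsum_single [simp]: "bsum J {v} = bd J v"
  by (simp add: bsum_def)

lemma finite_ecut [simp]: "finite (ed J) \<Longrightarrow> finite (ecut J S)"
  by (simp add: ecut_def)

lemma ecut_iff: "e \<in> ecut J S \<longleftrightarrow> e \<in> ed J \<and> (src J e \<in> S) \<noteq> (tgt J e \<in> S)"
  by (auto simp: ecut_def chi_def)

lemma ecut_ends: "e \<in> ecut J S \<Longrightarrow> e \<in> ed J \<and> src J e \<noteq> tgt J e"
  by (auto simp: ecut_iff)

lemma ecut_sub: "ecut J S \<subseteq> ed J"
  by (auto simp: ecut_def)

lemma ecut_Un:
  assumes "A \<inter> B = {}"
  shows "ecut J (A \<union> B) = (ecut J A \<union> ecut J B) - (ecut J A \<inter> ecut J B)"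
  using assms by (auto simp: ecut_def chi_def split: if_splits)

lemma dg_Un:
  assumes "finite (ed J)" "A \<inter> B = {}"
  shows "dg J (A \<union> B) + 2 * card (ecut J A \<inter> ecut J B) = dg J A + dg J B"
proof -
  let ?I = "ecut J A \<inter> ecut J B" and ?U = "ecut J A \<union> ecut J B"
  have "card (?U - ?I) = card ?U - card ?I"
    using assms(1) by (intro card_Diff_subset) auto
  moreover have "card ?I \<le> card ?U" using assms(1) by (intro card_mono) auto
  moreover have "card (ecut J A) + card (ecut J B) = card ?U + card ?I"
    using assms(1) by (intro card_Un_Int) auto
  ultimately show ?thesis unfolding dg_def ecut_Un[OF assms(2)] by linarith
qed

lemma dg_sum: "finite (ed J) \<Longrightarrow> dg J S = (\<Sum>e\<in>ed J. of_bool (chi J e S \<noteq> 0))"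
  by (simp add: dg_def ecut_def sum.If_cases of_bool_def Collect_conj_eq)

lemma dg_submodular:
  assumes "finite (ed J)"
  shows "dg J (A \<inter> B) + dg J (A \<union> B) \<le> dg J A + dg J B"
  unfolding dg_sum[OF assms] sum.distrib[symmetric]
  by (rule sum_mono) (auto simp: chi_def)

lemma chi_compl:
  assumes "valid J z" "e \<in> ed J" "S \<subseteq> vt J"
  shows "chi J e (vt J - S) = - chi J e S"
  using assms by (auto simp: chi_def valid_def)

lemma ecut_compl: "valid J z \<Longrightarrow> S \<subseteq> vt J \<Longrightarrow> ecut J (vt J - S) = ecut J S"
  using chi_compl by (fastforce simp: ecut_def)

lemma dg_compl: "valid J z \<Longrightarrow> S \<subseteq> vt J \<Longrightarrow> dg J (vt J - S) = dg J S"
  by (simp add: dg_def ecut_compl)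

lemma chi_all: "valid J z \<Longrightarrow> e \<in> ed J \<Longrightarrow> chi J e (vt J) = 0"
  by (auto simp: chi_def valid_def)

lemma net_compl:
  assumes "valid J z" "S \<subseteq> vt J"
  shows "net J f (vt J - S) = - net J f S"
  unfolding net_def sum_negf[symmetric] by (rule sum.cong) (auto simp: chi_compl[OF assms(1) _ assms(2)])

lemma bsum_compl:
  assumes "valid J z" "S \<subseteq> vt J"
  shows "bsum J (vt J - S) mod 3 = (- bsum J S) mod 3"
proof -
  have "bsum J (vt J) = bsum J (vt J - S) + bsum J S"
    using assms by (simp add: bsum_def valid_def sum.subset_diff)
  moreover have "bsum J (vt J) mod 3 = 0" using assms(1) by (simp add: valid_def)
  ultimately show ?thesis by presburger
qed

subsection \<open>Deleting oriented edges\<close>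

definition del_edges :: "('v, 'e) rgraph \<Rightarrow> 'e set \<Rightarrow> ('e \<Rightarrow> int) \<Rightarrow> ('v, 'e) rgraph" where
  "del_edges J F p = J\<lparr>ed := ed J - F, bd := (\<lambda>v. bd J v - (\<Sum>e\<in>F. p e * chi J e {v}))\<rparr>"

lemma del_edges_simps [simp]:
  "vt (del_edges J F p) = vt J" "ed (del_edges J F p) = ed J - F" "src (del_edges J F p) = src J"
  "tgt (del_edges J F p) = tgt J" "pre (del_edges J F p) = pre J" "chi (del_edges J F p) = chi J"
  "bd (del_edges J F p) v = bd J v - (\<Sum>e\<in>F. p e * chi J e {v})"
  "ecut (del_edges J F p) S = ecut J S - F"
  by (auto simp: del_edges_def chi_def fun_eq_iff ecut_def)

lemma del_edges_dg: "finite (ed J) \<Longrightarrow> F \<subseteq> ed J \<Longrightarrow> dg (del_edges J F p) S + card (F \<inter> ecut J S) = dg J S"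
  unfolding dg_def del_edges_simps by (metis Int_commute card_Diff_subset_Int card_mono finite_Int
      finite_ecut inf_le1 le_add_diff_inverse2)

lemma del_edges_bt: "finite S \<Longrightarrow> finite F \<Longrightarrow> bsum (del_edges J F p) S = bsum J S - (\<Sum>e\<in>F. p e * chi J e S)"
proof -
  assume S: "finite S" "finite F"
  have "(\<Sum>v\<in>S. \<Sum>e\<in>F. p e * chi J e {v}) = (\<Sum>e\<in>F. \<Sum>v\<in>S. p e * chi J e {v})"
    by (rule sum.swap)
  also have "\<dots> = (\<Sum>e\<in>F. p e * chi J e S)"
    by (simp add: chi_sum[OF S(1)] sum_distrib_left)
  finally show ?thesis by (simp add: bsum_def sum_subtractf)
qed

lemma del_edges_net:
  assumes "finite (ed J)" "F \<subseteq> ed J"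
  shows "net (del_edges J F p) f S = net J f S - (\<Sum>e\<in>F. f e * chi J e S)"
  unfolding net_def del_edges_simps using sum.subset_diff[OF assms(2,1), of "\<lambda>e. f e * chi J e S"] by simp

lemma del_edges_valid:
  assumes "valid J z" "F \<subseteq> ed J" "\<And>e. e \<in> F \<inter> ecut J {z} \<Longrightarrow> p e = pre J e"
  shows "valid (del_edges J F p) z"
proof -
  have f: "finite (ed J)" "finite (vt J)" using assms(1) by (auto simp: valid_def)
  have F: "finite F" using assms(2) f(1) finite_subset by blast
  have nz: "net J (pre J) {z} mod 3 = bd J z mod 3" using assms(1) by (simp add: valid_def)
  have "(\<Sum>e\<in>F. p e * chi J e {z}) = (\<Sum>e\<in>F. pre J e * chi J e {z})"
    using assms(2,3) by (intro sum.cong) (auto simp: ecut_def)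
  then have 1: "net (del_edges J F p) (pre J) {z} mod 3 = bd (del_edges J F p) z mod 3"
    unfolding del_edges_net[OF f(1) assms(2)] del_edges_simps using nz by (intro mod_diff_cong) simp_all
  have "(\<Sum>e\<in>F. p e * chi J e (vt J)) = 0"
    using assms(1,2) by (intro sum.neutral) (auto simp: chi_all)
  then have "bsum (del_edges J F p) (vt J) mod 3 = 0"
    using assms(1) del_edges_bt[OF f(2) F, of J p] by (simp add: valid_def)
  then show ?thesis using assms(1) 1 by (auto simp: valid_def)
qed

lemma del_edges_ext:
  assumes "valid J z" "F \<subseteq> ed J" "\<And>e. e \<in> F \<inter> ecut J {z} \<Longrightarrow> p e = pre J e"
    "\<And>e. e \<in> F \<Longrightarrow> p e \<in> {1, -1}" "ext (del_edges J F p) z"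
  shows "ext J z"
proof -
  have f: "finite (ed J)" using assms(1) by (auto simp: valid_def)
  obtain f' where f': "rflow (del_edges J F p) z f'" using assms(5) by (auto simp: ext_def)
  define g where "g e = (if e \<in> F then p e else f' e)" for e
  have n: "net J g S = net (del_edges J F p) f' S + (\<Sum>e\<in>F. p e * chi J e S)" for S
  proof -
    have "net J g S = (\<Sum>e\<in>ed J - F. g e * chi J e S) + (\<Sum>e\<in>F. g e * chi J e S)"
      unfolding net_def by (rule sum.subset_diff[OF assms(2) f])
    also have "(\<Sum>e\<in>F. g e * chi J e S) = (\<Sum>e\<in>F. p e * chi J e S)"
      by (rule sum.cong) (auto simp: g_def)
    also have "(\<Sum>e\<in>ed J - F. g e * chi J e S) = net (del_edges J F p) f' S"
      unfolding net_def del_edges_simps by (rule sum.cong) (auto simp: g_def)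
    finally show ?thesis .
  qed
  have "rflow J z g"
    unfolding rflow_def
  proof (intro conjI ballI)
    fix e assume "e \<in> ed J"
    then show "g e \<in> {1, -1}" using f' assms(4) by (auto simp: g_def rflow_def)
  next
    fix e assume "e \<in> ecut J {z}"
    then show "g e = pre J e" using f' assms(3) by (auto simp: g_def rflow_def)
  next
    fix v assume "v \<in> vt J"
    then have "net (del_edges J F p) f' {v} mod 3 = (bd J v - (\<Sum>e\<in>F. p e * chi J e {v})) mod 3"
      using f' by (auto simp: rflow_def)
    then show "net J g {v} mod 3 = bd J v mod 3"
      unfolding n by presburger
  qed
  then show ?thesis by (auto simp: ext_def)
qed

subsection \<open>Removing an isolated vertex\<close>

definition del_vert :: "('v, 'e) rgraph \<Rightarrow> 'v \<Rightarrow> ('v, 'e) rgraph" where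
  "del_vert J y = J\<lparr>vt := vt J - {y}\<rparr>"

lemma del_vert_simps [simp]:
  "vt (del_vert J y) = vt J - {y}" "ed (del_vert J y) = ed J" "src (del_vert J y) = src J"
  "tgt (del_vert J y) = tgt J" "pre (del_vert J y) = pre J" "bd (del_vert J y) = bd J"
  "chi (del_vert J y) = chi J" "ecut (del_vert J y) = ecut J" "dg (del_vert J y) = dg J"
  "net (del_vert J y) = net J" "bsum (del_vert J y) = bsum J"
  by (auto simp: del_vert_def chi_def fun_eq_iff ecut_def dg_def net_def bsum_def)

lemma del_vert_valid:
  assumes "valid J z" "y \<in> vt J" "y \<noteq> z" "ecut J {y} = {}" "bd J y mod 3 = 0"
  shows "valid (del_vert J y) z"
proof -
  have "bsum J (vt J) = bd J y + bsum J (vt J - {y})"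
    using assms(1,2) by (simp add: bsum_def valid_def sum.remove)
  moreover have "bsum J (vt J) mod 3 = 0" using assms(1) by (simp add: valid_def)
  ultimately have "bsum J (vt J - {y}) mod 3 = 0" using assms(5) by presburger
  moreover have "src J e \<noteq> y \<and> tgt J e \<noteq> y" if "e \<in> ed J" "src J e \<noteq> tgt J e" for e
    using assms(4) that by (auto simp: ecut_def chi_def split: if_splits)
  ultimately show ?thesis using assms(1,3) by (auto simp: valid_def)
qed

lemma del_vert_ext:
  assumes "ecut J {y} = {}" "bd J y mod 3 = 0" "ext (del_vert J y) z"
  shows "ext J z"
proof -
  have "net J f {y} = 0" for f
    unfolding net_def using assms(1) by (intro sum.neutral) (auto simp: ecut_def)
  then show ?thesis using assms(2,3) unfolding ext_def rflow_def
    by (metis DiffI mod_0 del_vert_simps singletonD)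
qed

subsection \<open>Lifting\<close>

definition oth :: "('v, 'e) rgraph \<Rightarrow> 'e \<Rightarrow> 'v \<Rightarrow> 'v" where
  "oth J e y = (if src J e = y then tgt J e else src J e)"

text \<open>The new edge inherits the name and the reference direction of \<open>e1\<close>: the end
  \<open>y\<close> of \<open>e1\<close> is replaced by the far end of \<open>e2\<close>. It
  therefore also inherits the preflow value of \<open>e1\<close>.\<close>

definition lift :: "('v, 'e) rgraph \<Rightarrow> 'v \<Rightarrow> 'e \<Rightarrow> 'e \<Rightarrow> ('v, 'e) rgraph" where
  "lift J y e1 e2 = J\<lparr>ed := ed J - {e2},
     src := (src J)(e1 := (if src J e1 = y then oth J e2 y else src J e1)),
     tgt := (tgt J)(e1 := (if src J e1 = y then tgt J e1 else oth J e2 y))\<rparr>"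

text \<open>Since the name \<open>e2\<close> disappears, a preflow value on it would be lost. So
  \<open>e2\<close> may be a tip edge only if \<open>e1\<close> is one too and the preflow passes
  straight through \<open>y\<close>; the lifted edge is then a loop at \<open>z\<close>.\<close>

definition liftable :: "('v, 'e) rgraph \<Rightarrow> 'v \<Rightarrow> 'v \<Rightarrow> 'e \<Rightarrow> 'e \<Rightarrow> bool" where
  "liftable J z y e1 e2 \<longleftrightarrow> e1 \<noteq> e2 \<and> e1 \<in> ecut J {y} \<and> e2 \<in> ecut J {y} \<and> y \<noteq> z \<and>
     (e2 \<in> ecut J {z} \<longrightarrow> e1 \<in> ecut J {z} \<and> pre J e2 * chi J e2 {y} = - (pre J e1 * chi J e1 {y}))"

lemma lift_simps [simp]:
  "vt (lift J y e1 e2) = vt J" "ed (lift J y e1 e2) = ed J - {e2}"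
  "pre (lift J y e1 e2) = pre J" "bd (lift J y e1 e2) = bd J" "bsum (lift J y e1 e2) = bsum J"
  by (auto simp: lift_def bsum_def fun_eq_iff)

lemma lift_chi_other: "e \<noteq> e1 \<Longrightarrow> chi (lift J y e1 e2) e S = chi J e S"
  by (auto simp: lift_def chi_def)

text \<open>The product of the two signs at \<open>y\<close> is -1 if the reference directions run
  through \<open>y\<close> in sequence, and then the incidences add up. It is 1 if both edges leave
  or both enter \<open>y\<close>, and then \<open>e2\<close> is traversed backwards.\<close>

lemma lift_chi:
  assumes "e1 \<in> ecut J {y}" "e2 \<in> ecut J {y}"
  shows "chi (lift J y e1 e2) e1 S = chi J e1 S - chi J e1 {y} * chi J e2 {y} * chi J e2 S"
proof -
  have "src J e1 = y \<and> tgt J e1 \<noteq> y \<or> src J e1 \<noteq> y \<and> tgt J e1 = y"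
    "src J e2 = y \<and> tgt J e2 \<noteq> y \<or> src J e2 \<noteq> y \<and> tgt J e2 = y"
    using assms by (auto simp: ecut_iff)
  then show ?thesis by (elim disjE conjE) (simp_all add: lift_def chi_def oth_def)
qed

text \<open>When both edges cross \<open>S\<close>, both far ends lie on the side of
  \<open>S\<close> opposite to \<open>y\<close>, so the lifted edge no longer crosses
  \<open>S\<close>.\<close>

lemma ecut_pair_chi:
  assumes "e1 \<in> ecut J {y}" "e2 \<in> ecut J {y}" "e1 \<in> ecut J S" "e2 \<in> ecut J S"
  shows "chi J e1 S = chi J e1 {y} * chi J e2 {y} * chi J e2 S"
proof -
  have "src J e1 = y \<and> tgt J e1 \<noteq> y \<or> src J e1 \<noteq> y \<and> tgt J e1 = y"
    "src J e2 = y \<and> tgt J e2 \<noteq> y \<or> src J e2 \<noteq> y \<and> tgt J e2 = y"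
    "(src J e1 \<in> S) \<noteq> (tgt J e1 \<in> S)" "(src J e2 \<in> S) \<noteq> (tgt J e2 \<in> S)"
    using assms by (auto simp: ecut_iff)
  then show ?thesis by (elim disjE conjE) (auto simp add: chi_def)
qed

lemma lift_ecut:
  assumes "liftable J z y e1 e2"
  shows "ecut (lift J y e1 e2) S = (if e1 \<in> ecut J S \<longleftrightarrow> e2 \<in> ecut J S then ecut J S - {e1, e2}
     else insert e1 (ecut J S - {e2}))"
proof -
  have c: "e1 \<in> ecut J {y}" "e2 \<in> ecut J {y}" "e1 \<noteq> e2" "e1 \<in> ed J" "e2 \<in> ed J"
    using assms by (auto simp: liftable_def ecut_def)
  have n: "chi J e1 {y} \<noteq> 0" "chi J e2 {y} \<noteq> 0" using c by (auto simp: ecut_def)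
  have "e1 \<in> ecut (lift J y e1 e2) S \<longleftrightarrow> \<not> (e1 \<in> ecut J S \<longleftrightarrow> e2 \<in> ecut J S)"
  proof (cases "e1 \<in> ecut J S \<and> e2 \<in> ecut J S")
    case True
    then show ?thesis using ecut_pair_chi[OF c(1,2)] by (auto simp: ecut_def lift_chi[OF c(1,2)])
  next
    case False
    then show ?thesis using c n by (auto simp: ecut_def lift_chi[OF c(1,2)])
  qed
  moreover have "e \<in> ecut (lift J y e1 e2) S \<longleftrightarrow> e \<in> ecut J S \<and> e \<noteq> e2" if "e \<noteq> e1" for e
    using that by (auto simp: ecut_def lift_chi_other)
  ultimately have "e \<in> ecut (lift J y e1 e2) S \<longleftrightarrow> e \<in> (if e1 \<in> ecut J S \<longleftrightarrow> e2 \<in> ecut J S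
      then ecut J S - {e1, e2} else insert e1 (ecut J S - {e2}))" for e
    using c(3) by (cases "e = e1") auto
  then show ?thesis by blast
qed

lemma lift_dg:
  assumes "liftable J z y e1 e2" "finite (ed J)"
  shows "dg (lift J y e1 e2) S + 2 * of_bool (e1 \<in> ecut J S \<and> e2 \<in> ecut J S) = dg J S"
proof -
  have ne: "e1 \<noteq> e2" using assms by (auto simp: liftable_def)
  have f: "finite (ecut J S)" using assms by simp
  consider "e1 \<in> ecut J S" "e2 \<in> ecut J S" | "e1 \<in> ecut J S" "e2 \<notin> ecut J S"
    | "e1 \<notin> ecut J S" "e2 \<in> ecut J S" | "e1 \<notin> ecut J S" "e2 \<notin> ecut J S" by blast
  then show ?thesis
  proof cases
    case 1
    then have "card (ecut J S - {e1, e2}) = card (ecut J S) - card {e1, e2}"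
      by (intro card_Diff_subset) auto
    moreover have "card {e1, e2} \<le> card (ecut J S)" using 1 f by (intro card_mono) auto
    ultimately show ?thesis using 1 ne by (simp add: dg_def lift_ecut[OF assms(1)])
  next
    case 2
    then have "insert e1 (ecut J S - {e2}) = ecut J S" by auto
    then show ?thesis using 2 by (simp add: dg_def lift_ecut[OF assms(1)])
  next
    case 3
    then have "card (insert e1 (ecut J S - {e2})) = card (ecut J S)"
      using f card.remove[OF f 3(2)] by simp
    then show ?thesis using 3 by (simp add: dg_def lift_ecut[OF assms(1)])
  next
    case 4
    then have "ecut J S - {e1, e2} = ecut J S" by auto
    then show ?thesis using 4 by (simp add: dg_def lift_ecut[OF assms(1)])
  qed
qed

lemma lift_net:
  assumes "liftable J z y e1 e2" "finite (ed J)"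
    "g e2 = - (chi J e1 {y} * chi J e2 {y} * g e1)"
  shows "net (lift J y e1 e2) g S = net J g S"
proof -
  have c: "e1 \<in> ecut J {y}" "e2 \<in> ecut J {y}" "e1 \<noteq> e2" "e1 \<in> ed J" "e2 \<in> ed J"
    using assms by (auto simp: liftable_def ecut_def)
  let ?J = "lift J y e1 e2"
  have "net J g S = g e2 * chi J e2 S + (g e1 * chi J e1 S + (\<Sum>e\<in>ed J - {e2} - {e1}. g e * chi J e S))"
    unfolding net_def using c assms(2) by (subst sum.remove[of _ e2], simp, simp, subst sum.remove[of _ e1]) simp_all
  moreover have "net ?J g S = g e1 * chi ?J e1 S + (\<Sum>e\<in>ed J - {e2} - {e1}. g e * chi ?J e S)"
    unfolding net_def lift_simps using c assms(2) by (subst sum.remove[of _ e1]) simp_all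
  moreover have "(\<Sum>e\<in>ed J - {e2} - {e1}. g e * chi ?J e S) = (\<Sum>e\<in>ed J - {e2} - {e1}. g e * chi J e S)"
    by (rule sum.cong) (auto simp: lift_chi_other)
  ultimately show ?thesis
    unfolding lift_chi[OF c(1,2)] assms(3) by (simp add: algebra_simps)
qed

lemma lift_ends:
  assumes "liftable J z y e1 e2" "valid J z" "e \<in> ed J" "src (lift J y e1 e2) e \<noteq> tgt (lift J y e1 e2) e"
  shows "src (lift J y e1 e2) e \<in> vt J \<and> tgt (lift J y e1 e2) e \<in> vt J"
proof -
  have v: "src J e' \<in> vt J \<and> tgt J e' \<in> vt J" if "e' \<in> ed J" "src J e' \<noteq> tgt J e'" for e'
    using assms(2) that by (simp add: valid_def)
  have c0: "e1 \<in> ecut J {y}" "e2 \<in> ecut J {y}" using assms(1) by (simp_all add: liftable_def)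
  have c: "e1 \<in> ed J" "e2 \<in> ed J" "src J e1 \<noteq> tgt J e1" "src J e2 \<noteq> tgt J e2"
    using ecut_ends[OF c0(1)] ecut_ends[OF c0(2)] by simp_all
  show ?thesis
    using v[OF c(1,3)] v[OF c(2,4)] v[OF assms(3)] assms(4)
    by (cases "e = e1") (simp_all add: lift_def oth_def)
qed

lemma lift_valid:
  assumes "liftable J z y e1 e2" "valid J z"
  shows "valid (lift J y e1 e2) z"
proof -
  have f: "finite (ed J)" using assms(2) by (simp add: valid_def)
  have c: "e1 \<in> ecut J {y}" "e2 \<in> ecut J {y}" "e1 \<noteq> e2" "e1 \<in> ed J" "e2 \<in> ed J"
    using assms by (auto simp: liftable_def ecut_def)
  define g where "g = (pre J)(e2 := - (chi J e1 {y} * chi J e2 {y} * pre J e1))"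
  have "g e * chi J e {z} = pre J e * chi J e {z}" for e
  proof (cases "e = e2 \<and> e2 \<in> ecut J {z}")
    case True
    then have "pre J e2 * chi J e2 {y} = - (pre J e1 * chi J e1 {y})"
      using assms by (auto simp: liftable_def)
    then have "g e2 = pre J e2" using c(2) chi_cases[of J e2 "{y}"] by (auto simp: g_def ecut_def)
    then show ?thesis using True by simp
  next
    case False
    then show ?thesis using c by (auto simp: g_def ecut_def)
  qed
  then have "net J g {z} = net J (pre J) {z}" unfolding net_def by (intro sum.cong) auto
  moreover have "net (lift J y e1 e2) g {z} = net J g {z}"
    using c by (intro lift_net[OF assms(1) f]) (auto simp: g_def)
  moreover have "net (lift J y e1 e2) g {z} = net (lift J y e1 e2) (pre J) {z}"
    unfolding net_def by (rule sum.cong) (auto simp: g_def)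
  ultimately show ?thesis using assms(2) lift_ends[OF assms] by (auto simp: valid_def)
qed

text \<open>The edge \<open>e1\<close> carries the value of the lifted edge and \<open>e2\<close>
  passes it on through \<open>y\<close>. The equation at \<open>y\<close> is recorded because it
  yields one edge of each direction at a contracted set.\<close>

lemma lift_rflow:
  assumes "liftable J z y e1 e2" "valid J z" "rflow (lift J y e1 e2) z h"
  shows "\<exists>g. rflow J z g \<and> g e2 * chi J e2 {y} = - (g e1 * chi J e1 {y})"
proof -
  have f: "finite (ed J)" using assms(2) by (simp add: valid_def)
  have c: "e1 \<in> ecut J {y}" "e2 \<in> ecut J {y}" "e1 \<noteq> e2" "e1 \<in> ed J" "e2 \<in> ed J"
    using assms by (auto simp: liftable_def ecut_def)
  have c1: "chi J e1 {y} \<in> {1, -1}" "chi J e2 {y} \<in> {1, -1}"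
    using c chi_cases[of J e1 "{y}"] chi_cases[of J e2 "{y}"] by (auto simp: ecut_def)
  let ?J = "lift J y e1 e2"
  \<comment> \<open>If both edges join \<open>y\<close> to \<open>z\<close>, the lifted edge is a
    loop on which \<open>h\<close> is unconstrained; the preflow value has to be taken instead. In
    all other cases \<open>a\<close> agrees with \<open>h e1\<close>.\<close>
  define a where "a = (if e1 \<in> ecut J {z} then pre J e1 else h e1)"
  define g where "g = h(e1 := a, e2 := - (chi J e1 {y} * chi J e2 {y} * a))"
  have a1: "a \<in> {1, -1}" using assms(2,3) c by (auto simp: a_def valid_def rflow_def)
  have loop: "a = h e1 \<or> (\<forall>S. chi ?J e1 S = 0)"
  proof (cases "e1 \<in> ecut ?J {z} \<or> e1 \<notin> ecut J {z}")
    case True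
    then show ?thesis using assms(3) by (auto simp: a_def rflow_def)
  next
    case False
    then have 2: "e1 \<in> ecut J {z}" "e2 \<in> ecut J {z}" by (auto simp: lift_ecut[OF assms(1)] split: if_splits)
    have "chi ?J e1 S = 0" for S
    proof -
      have "y \<noteq> z" using assms by (simp add: liftable_def)
      then have "src J e1 = y \<and> tgt J e1 = z \<or> src J e1 = z \<and> tgt J e1 = y"
        "src J e2 = y \<and> tgt J e2 = z \<or> src J e2 = z \<and> tgt J e2 = y"
        using 2 c by (auto simp: ecut_iff)
      then show ?thesis by (elim disjE conjE) (simp_all add: lift_def oth_def chi_def)
    qed
    then show ?thesis by simp
  qed
  have n: "net J g S = net ?J h S" for S
  proof -
    have "net J g S = net ?J g S"
      using c by (intro lift_net[OF assms(1) f, symmetric]) (auto simp: g_def)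
    also have "\<dots> = net ?J h S"
      unfolding net_def using loop c(3) by (intro sum.cong) (auto simp: g_def)
    finally show ?thesis .
  qed
  have "rflow J z g"
    unfolding rflow_def
  proof (intro conjI ballI)
    fix e assume "e \<in> ed J"
    then show "g e \<in> {1, -1}" using assms(3) a1 c1 by (auto simp: g_def rflow_def)
  next
    fix e assume e: "e \<in> ecut J {z}"
    consider "e = e1" | "e = e2" | "e \<noteq> e1" "e \<noteq> e2" by blast
    then show "g e = pre J e"
    proof cases
      case 1
      then show ?thesis using e c by (simp add: g_def a_def)
    next
      case 2
      then have "e1 \<in> ecut J {z}" "pre J e2 * chi J e2 {y} = - (pre J e1 * chi J e1 {y})"
        using e assms(1) by (auto simp: liftable_def)
      then show ?thesis using 2 c1 by (auto simp: g_def a_def)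
    next
      case 3
      then have "e \<in> ecut ?J {z}" using e by (auto simp: lift_ecut[OF assms(1)])
      then show ?thesis using 3 assms(3) by (auto simp: g_def rflow_def)
    qed
  next
    fix v assume "v \<in> vt J"
    then show "net J g {v} mod 3 = bd J v mod 3" using assms(3) by (simp add: n rflow_def)
  qed
  moreover have "g e2 * chi J e2 {y} = - (g e1 * chi J e1 {y})"
    using c c1 by (auto simp: g_def)
  ultimately show ?thesis by blast
qed

lemma lift_ext: "liftable J z y e1 e2 \<Longrightarrow> valid J z \<Longrightarrow> ext (lift J y e1 e2) z \<Longrightarrow> ext J z"
  unfolding ext_def by (metis lift_rflow)

subsection \<open>Contraction\<close>

definition contract :: "('v, 'e) rgraph \<Rightarrow> 'v set \<Rightarrow> 'v \<Rightarrow> ('v, 'e) rgraph" where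
  "contract J S r = J\<lparr>vt := insert r (vt J - S),
     src := (\<lambda>e. if src J e \<in> S then r else src J e),
     tgt := (\<lambda>e. if tgt J e \<in> S then r else tgt J e),
     bd := (bd J)(r := bsum J S)\<rparr>"

text \<open>The preimage of \<open>U\<close> under the contraction that sends \<open>S\<close> to
  \<open>r\<close>.\<close>

definition uncontract :: "'v set \<Rightarrow> 'v \<Rightarrow> 'v set \<Rightarrow> 'v set" where
  "uncontract S r U = (if r \<in> U then U \<union> S else U - S)"

lemma contract_simps [simp]:
  "vt (contract J S r) = insert r (vt J - S)" "ed (contract J S r) = ed J" "pre (contract J S r) = pre J"
  "bd (contract J S r) = (bd J)(r := bsum J S)"
  by (auto simp: contract_def)

lemma contract_chi: "r \<in> S \<Longrightarrow> chi (contract J S r) e U = chi J e (uncontract S r U)"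
  by (auto simp: contract_def chi_def uncontract_def)

lemma contract_ecut: "r \<in> S \<Longrightarrow> ecut (contract J S r) U = ecut J (uncontract S r U)"
  by (simp add: ecut_def contract_chi)

lemma contract_dg: "r \<in> S \<Longrightarrow> dg (contract J S r) U = dg J (uncontract S r U)"
  by (simp add: dg_def contract_ecut)

lemma contract_net: "r \<in> S \<Longrightarrow> net (contract J S r) f U = net J f (uncontract S r U)"
  by (simp add: net_def contract_chi)

lemma contract_bt:
  assumes "r \<in> S" "finite (vt J)" "S \<subseteq> vt J" "U \<subseteq> insert r (vt J - S)"
  shows "bsum (contract J S r) U = bsum J (uncontract S r U)"
proof (cases "r \<in> U")
  case True
  have fin: "finite S" "finite U"
    using assms(2-4) finite_subset[of S "vt J"] finite_subset[of U "insert r (vt J - S)"] by simp_all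
  have "bsum (contract J S r) U = bsum J S + bsum J (U - {r})"
    using True fin by (simp add: bsum_def sum.remove[of U r])
  also have "\<dots> = bsum J (S \<union> (U - {r}))"
    using fin assms by (intro bsum_Un[symmetric]) auto
  also have "S \<union> (U - {r}) = uncontract S r U" using True assms(1) by (auto simp: uncontract_def)
  finally show ?thesis .
next
  case False
  then have "uncontract S r U = U" using assms(4) by (auto simp: uncontract_def)
  then show ?thesis using False by (auto simp: bsum_def intro!: sum.cong)
qed

lemma contract_valid:
  assumes "valid J z" "r \<in> S" "S \<subseteq> vt J" "z \<notin> S"
  shows "valid (contract J S r) z"
proof -
  have u: "uncontract S r (insert r (vt J - S)) = vt J" "uncontract S r {z} = {z}"
    using assms by (auto simp: uncontract_def)
  have "finite (vt J)" using assms by (simp add: valid_def)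
  then have "bsum (contract J S r) (insert r (vt J - S)) = bsum J (vt J)"
    using contract_bt[OF assms(2) _ assms(3), of "insert r (vt J - S)"] u by simp
  moreover have "net (contract J S r) (pre J) {z} = net J (pre J) {z}" by (simp add: contract_net assms u)
  ultimately show ?thesis using assms by (auto simp: valid_def contract_def)
qed

lemma pre_upd [simp]:
  "chi (J\<lparr>pre := f\<rparr>) = chi J" "ecut (J\<lparr>pre := f\<rparr>) = ecut J" "dg (J\<lparr>pre := f\<rparr>) = dg J"
  "net (J\<lparr>pre := f\<rparr>) = net J" "bsum (J\<lparr>pre := f\<rparr>) = bsum J"
  by (auto simp: chi_def ecut_def dg_def net_def bsum_def fun_eq_iff)

text \<open>These are the flows of the contraction of \<open>B\<close>, written in \<open>J\<close>
  itself and hence without a representative of \<open>B\<close>.\<close>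

definition flow_off :: "('v, 'e) rgraph \<Rightarrow> 'v \<Rightarrow> 'v set \<Rightarrow> ('e \<Rightarrow> int) \<Rightarrow> bool" where
  "flow_off J z B f \<longleftrightarrow> (\<forall>e\<in>ed J. f e \<in> {1, -1}) \<and> (\<forall>e\<in>ecut J {z}. f e = pre J e) \<and>
     (\<forall>v\<in>vt J - B. net J f {v} mod 3 = bd J v mod 3) \<and> net J f B mod 3 = bsum J B mod 3"

lemma contract_rflow:
  assumes "r \<in> B" "B \<subseteq> vt J" "z \<notin> B"
  shows "rflow (contract J B r) z f \<longleftrightarrow> flow_off J z B f"
proof -
  have u: "uncontract B r {z} = {z}" "uncontract B r {r} = B" using assms by (auto simp: uncontract_def)
  have v: "uncontract B r {v} = {v}" "v \<noteq> r" if "v \<in> vt J - B" for v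
    using that assms by (auto simp: uncontract_def)
  show ?thesis
    unfolding rflow_def flow_off_def contract_simps contract_net[OF assms(1)] contract_ecut[OF assms(1)]
    using v by (auto simp: u)
qed

lemma ecut_one: "e \<in> ecut J B \<Longrightarrow> U \<subseteq> B \<Longrightarrow> W \<subseteq> B \<Longrightarrow> U \<inter> W = {} \<Longrightarrow> e \<in> ecut J U \<Longrightarrow> e \<notin> ecut J W"
  by (auto simp: ecut_iff)

text \<open>Joining two disjoint sets lowers the sum of their degrees by twice the number of edges
  between them.\<close>

lemma even_sum_dg:
  assumes "finite (ed J)" "finite Q" "disjoint Q"
  shows "even ((\<Sum>U\<in>Q. dg J U) + dg J (\<Union>Q))"
  using assms(2,3)
proof (induction Q rule: finite_induct)
  case empty
  then show ?case by (simp add: dg_def ecut_def)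
next
  case (insert U Q)
  have d: "U \<inter> \<Union>Q = {}" using insert by (auto simp: disjoint_def)
  have "even ((\<Sum>U\<in>Q. dg J U) + dg J (\<Union>Q))" using insert by (simp add: pairwise_insert disjoint_def)
  then show ?case using dg_Un[OF assms(1) d] insert(1,2)
    by simp presburger
qed

lemma bsum_partition:
  assumes "finite B" "partition_on B Q"
  shows "bsum J B = (\<Sum>U\<in>Q. bsum J U)"
proof -
  have "\<forall>U\<in>Q. finite U"
    using assms by (metis Union_upper finite_subset partition_onD1)
  moreover have "\<forall>A\<in>Q. \<forall>B\<in>Q. A \<noteq> B \<longrightarrow> A \<inter> B = {}"
    using partition_onD2[OF assms(2)] by (auto simp: disjoint_def)
  ultimately have "sum (bd J) (\<Union>Q) = sum (sum (bd J)) Q"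
    using sum.Union_disjoint[of Q "bd J"] by simp
  then show ?thesis using partition_onD1[OF assms(2)] by (simp add: bsum_def[abs_def])
qed

subsection \<open>Bounds on cuts in a minimal counterexample\<close>

text \<open>This is \<open>tallp\<close> for the graph in which everything outside \<open>B\<close>
  becomes the tip and \<open>f\<close> the preflow. The signs at that tip are the negatives of those
  at \<open>B\<close>, which merely exchanges the two existence conditions.\<close>

definition tall_in :: "('v, 'e) rgraph \<Rightarrow> ('e \<Rightarrow> int) \<Rightarrow> 'v set \<Rightarrow> 'v set \<Rightarrow> bool" where
  "tall_in J f B U \<longleftrightarrow> dg J B \<le> dg J U + 2 \<and>
     (dg J B = dg J U + 2 \<longrightarrow>
        (\<exists>e\<in>ecut J B - ecut J U. f e * chi J e B = 1) \<and>
        (\<exists>e\<in>ecut J B - ecut J U. f e * chi J e B = - 1))"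

lemma mod3_shift: "(s :: int) mod 3 = (b - n + t) mod 3 \<Longrightarrow> (s + (n - t)) mod 3 = b mod 3"
  using mod_add_cong[of s 3 "b - n + t" "n - t" "n - t"] by simp

lemma mod3_cancel: "((a :: int) + c) mod 3 = (b + d) mod 3 \<Longrightarrow> a mod 3 = b mod 3 \<Longrightarrow> c mod 3 = d mod 3"
  using mod_diff_cong[of "a + c" 3 "b + d" a b] by simp

text \<open>Pigeonhole: a part with d(B) = d(U) + 2 that is not tall has \<open>e\<close> or
  \<open>e'\<close> in its cut, since otherwise these two edges would witness both directions. The
  parts are disjoint, so each of the two edges serves only one part.\<close>

lemma three_parts:
  assumes Q: "partition_on B Q" and "e \<in> ecut J B" "f e * chi J e B = 1"
    and "e' \<in> ecut J B" "f e' * chi J e' B = -1"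
    and S: "S \<subseteq> Q" "3 \<le> card S"
    and nt: "\<And>U. U \<in> S \<Longrightarrow> dg J B = dg J U + 2 \<and> \<not> tall_in J f B U"
  shows False
proof -
  have "\<exists>T. T \<subseteq> S \<and> card T = 3" using S(2) by (metis obtain_subset_with_card_n)
  then obtain T where T: "T \<subseteq> S" "card T = 3" by blast
  then obtain A B' C where "T = {A, B', C}" "A \<noteq> B'" "A \<noteq> C" "B' \<noteq> C"
    by (auto simp: card_3_iff)
  then have d: "A \<in> S" "B' \<in> S" "C \<in> S" "A \<noteq> B'" "A \<noteq> C" "B' \<noteq> C" using T by auto
  have sub: "U \<subseteq> B" if "U \<in> S" for U using that S Q by (auto simp: partition_on_def)
  have dj: "U \<inter> W = {}" if "U \<in> S" "W \<in> S" "U \<noteq> W" for U W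
    using that S partition_onD2[OF Q] by (auto simp: disjoint_def)
  have *: "e \<in> ecut J U \<or> e' \<in> ecut J U" if "U \<in> S" for U
    using nt[OF that] assms(2-5) by (auto simp: tall_in_def)
  have "\<not> (e \<in> ecut J U \<and> e \<in> ecut J W)" "\<not> (e' \<in> ecut J U \<and> e' \<in> ecut J W)"
    if "U \<in> S" "W \<in> S" "U \<noteq> W" for U W
    using ecut_one[of _ J B U W] assms(2,4) sub dj that by blast+
  then show False using d *[OF d(1)] *[OF d(2)] *[OF d(3)] by blast
qed

lemma contract_ends:
  assumes "valid J z" "S \<subseteq> vt J" "e \<in> ed J" "src (contract J S r) e \<noteq> tgt (contract J S r) e"
  shows "src (contract J S r) e \<in> insert r (vt J - S) \<and> tgt (contract J S r) e \<in> insert r (vt J - S)"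
  using assms by (auto simp: contract_def valid_def)

text \<open>If all edges of the cut pointed the same way, the net flow would be the degree up to
  sign, hence not divisible by 3.\<close>

lemma net_nonuniform:
  assumes "finite (ed J)" "\<And>e. e \<in> ed J \<Longrightarrow> f e \<in> {1, -1 :: int}" "\<not> 3 dvd dg J B" "net J f B mod 3 = 0"
    and c: "c = 1 \<or> c = - (1 :: int)"
  shows "\<exists>e\<in>ecut J B. f e * chi J e B = c"
proof (rule ccontr)
  assume n: "\<not> ?thesis"
  have "f e * chi J e B = - c" if "e \<in> ecut J B" for e
  proof -
    have "f e \<in> {1, -1}" "chi J e B \<in> {1, -1}"
      using that assms(2) chi_cases[of J e B] by (auto simp: ecut_def)
    then have "f e * chi J e B \<in> {1, -1}" by auto
    then show ?thesis using n c that by auto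
  qed
  then have "(\<Sum>e\<in>ecut J B. f e * chi J e B) = - c * int (dg J B)" by (simp add: dg_def)
  moreover have "net J f B = (\<Sum>e\<in>ecut J B. f e * chi J e B)"
    unfolding net_def using assms(1) by (intro sum.mono_neutral_right) (auto simp: ecut_def)
  ultimately have "3 dvd - c * int (dg J B)" using assms(4) by (simp add: dvd_eq_mod_eq_0)
  then have "3 dvd int (dg J B)" using c by auto
  then show False using assms(3) by presburger
qed

text \<open>The hypothesis \<open>IH\<close> ranges over graphs with the same types of vertices and
  edges. This is why a contraction keeps a member of the contracted set as its vertex and a lifting
  reuses an edge name.\<close>

locale critical =
  fixes J :: "('v, 'e) rgraph" and z x :: 'v
  assumes val: "valid J z" and nonext: "\<not> ext J z"
    and crit: "\<And>B. B \<subseteq> vt J - {z} \<Longrightarrow> 2 \<le> card B \<Longrightarrow> \<exists>f. flow_off J z B f"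
    and x: "x \<in> vt J" "x \<noteq> z"
    and tame: "\<And>v. v \<in> vt J - {x, z} \<Longrightarrow> tame_deg (dg J {v}) (bd J v)"
    and tall: "tallp J z {x}"
    and IH: "\<And>(J' :: ('v, 'e) rgraph) z'.
      card (vt J') + card (ed J') < card (vt J) + card (ed J) \<Longrightarrow> splits J' z'"
begin

lemma fin [simp]: "finite (vt J)" "finite (ed J)" and zV: "z \<in> vt J"
  using val by (auto simp: valid_def)

lemma fin_sub: "S \<subseteq> vt J - A \<Longrightarrow> finite S"
  using finite_subset[of S "vt J"] by auto

text \<open>Contracting at least two vertices into the tip keeps the number of edges and lowers that
  of vertices, so \<open>IH\<close> applies. The contracted graph has no flow, because it could be
  glued with \<open>f\<close> along the cut of \<open>B\<close>.\<close>

lemma contract_complement: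
  assumes B: "B \<subseteq> vt J - {z}" and c: "2 \<le> card (vt J - B)" and f: "flow_off J z B f"
  obtains Q where "partition_on B Q"
    "\<And>U. U \<in> Q \<Longrightarrow> (\<And>W. W \<in> Q \<Longrightarrow> W \<noteq> U \<Longrightarrow> tame_deg (dg J W) (bsum J W)) \<Longrightarrow> \<not> tall_in J f B U"
proof -
  let ?S = "vt J - B"
  let ?J = "(contract J ?S z)\<lparr>pre := f\<rparr>"
  have zS: "z \<in> ?S" using B zV by auto
  have vJ: "vt ?J = insert z B" using B by auto
  have uz: "uncontract ?S z {z} = ?S" "uncontract ?S z (insert z B) = vt J"
    using zS B by (auto simp: uncontract_def)
  have uU: "uncontract ?S z U = U" if "U \<subseteq> B" for U using that zS by (auto simp: uncontract_def)
  have chiz: "chi ?J e {z} = - chi J e B" if "e \<in> ed J" for e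
    using chi_compl[OF val that] B by (auto simp: contract_chi[OF zS] uz)
  have cutz: "ecut ?J {z} = ecut J B"
    using ecut_compl[OF val, of B] B by (auto simp: contract_ecut[OF zS] uz)
  have fsg: "\<And>e. e \<in> ed J \<Longrightarrow> f e \<in> {1, -1}" using f by (auto simp: flow_off_def)
  have "net J f ?S mod 3 = bsum J ?S mod 3"
    using f by (intro net_eq_bt) (auto simp: flow_off_def)
  moreover have "bsum ?J (insert z B) = bsum J (vt J)"
    using contract_bt[OF zS, of J "insert z B"] B uz by auto
  moreover have "net ?J f {z} = net J f ?S" by (simp add: contract_net[OF zS] uz)
  moreover have "finite B" using B fin_sub by blast
  moreover have "src ?J e \<in> insert z B \<and> tgt ?J e \<in> insert z B"
    if "e \<in> ed J" "src ?J e \<noteq> tgt ?J e" for e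
    using contract_ends[OF val _ that(1), of ?S z] that(2) B by auto
  ultimately have "valid ?J z"
    using val fsg unfolding valid_def vJ by simp
  moreover have "\<not> ext ?J z"
  proof
    assume "ext ?J z"
    then obtain h where h: "rflow ?J z h" by (auto simp: ext_def)
    \<comment> \<open>Edges that touch \<open>B\<close> take the value of \<open>h\<close>, all
      others that of \<open>f\<close>. Both agree on the cut, so a vertex outside \<open>B\<close>
      sees only \<open>f\<close> and a vertex in \<open>B\<close> sees only
      \<open>h\<close>.\<close>
    define g where "g e = (if src J e \<in> B \<or> tgt J e \<in> B then h e else f e)" for e
    have hf: "h e = f e" if "e \<in> ecut J B" for e
      using h that unfolding rflow_def cutz by auto
    have "rflow J z g"
      unfolding rflow_def
    proof (intro conjI ballI)
      fix e assume "e \<in> ed J"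
      then show "g e \<in> {1, -1}" using h fsg by (auto simp: g_def rflow_def)
    next
      fix e assume e: "e \<in> ecut J {z}"
      then have "f e = pre J e" using f by (auto simp: flow_off_def)
      moreover have "g e = f e"
      proof (cases "src J e \<in> B \<or> tgt J e \<in> B")
        case True
        then have "e \<in> ecut J B" using e B by (auto simp: ecut_iff)
        then show ?thesis using hf by (simp add: g_def)
      qed (simp add: g_def)
      ultimately show "g e = pre J e" by simp
    next
      fix v assume v: "v \<in> vt J"
      show "net J g {v} mod 3 = bd J v mod 3"
      proof (cases "v \<in> B")
        case True
        have "net J g {v} = net J h {v}"
          unfolding net_def using True by (intro sum.cong) (auto simp: g_def chi_def)
        moreover have "net ?J h {v} = net J h {v}" using uU[of "{v}"] True by (simp add: contract_net[OF zS])
        moreover have "net ?J h {v} mod 3 = bd ?J v mod 3" using h True vJ by (auto simp: rflow_def)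
        moreover have "bd ?J v = bd J v" using True B by auto
        ultimately show ?thesis by simp
      next
        case False
        have "g e * chi J e {v} = f e * chi J e {v}" if "e \<in> ed J" for e
        proof (cases "chi J e {v} = 0 \<or> \<not> (src J e \<in> B \<or> tgt J e \<in> B)")
          case True
          then show ?thesis by (auto simp: g_def)
        next
          case F: False
          then have "e \<in> ecut J B" using False that by (auto simp: ecut_iff chi_def of_bool_eq_iff)
          then show ?thesis using hf by (simp add: g_def)
        qed
        then have "net J g {v} = net J f {v}" unfolding net_def by (intro sum.cong) auto
        then show ?thesis using f v False by (auto simp: flow_off_def)
      qed
    qed
    then show False using nonext by (auto simp: ext_def)
  qed
  moreover have "splits ?J z"
  proof (rule IH)
    have fB: "finite B" using B fin_sub by blast
    have "card (vt J) = card B + card ?S"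
      using B fB fin card_Un_disjoint[of B ?S] by (metis Diff_disjoint Diff_partition finite_Diff Diff_subset subset_trans)
    then have "card (insert z B) < card (vt J)" using c fB by (simp add: card_insert_if)
    then show "card (vt ?J) + card (ed ?J) < card (vt J) + card (ed J)" unfolding vJ by simp
  qed
  ultimately obtain Q where Q: "partition_on (vt ?J - {z}) Q"
    "\<forall>U\<in>Q. (\<forall>W\<in>Q - {U}. tame_deg (dg ?J W) (bsum ?J W)) \<longrightarrow> \<not> tallp ?J z U"
    by (auto simp: splits_def)
  have eqB: "vt ?J - {z} = B" using vJ B by auto
  have sub: "U \<subseteq> B" if "U \<in> Q" for U using Q(1) that unfolding eqB by (auto simp: partition_on_def)
  have dg: "dg ?J U = dg J U" "ecut ?J U = ecut J U" if "U \<subseteq> B" for U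
    using uU[OF that] by (simp_all add: contract_dg[OF zS] contract_ecut[OF zS])
  have btU: "bsum ?J U = bsum J U" if "U \<subseteq> B" for U
    using contract_bt[OF zS, of J U] that B uU[OF that] by auto
  have dgz: "dg ?J {z} = dg J B" unfolding dg_def cutz by (simp add: dg_def)
  have tl: "tallp ?J z U" if "tall_in J f B U" "U \<subseteq> B" for U
  proof -
    have "f e * chi ?J e {z} = - (f e * chi J e B)" if "e \<in> ecut J B" for e
      using chiz[of e] that by (auto simp: ecut_def)
    then have "(\<exists>e\<in>ecut J B - ecut J U. f e * chi ?J e {z} = c) \<longleftrightarrow>
        (\<exists>e\<in>ecut J B - ecut J U. f e * chi J e B = - c)" for c
      by (auto intro!: bexI)
    then show ?thesis using that(1)
      unfolding tallp_def tall_in_def dgz cutz dg[OF that(2)] by simp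
  qed
  show ?thesis
  proof (rule that[of Q])
    show "partition_on B Q" using Q(1) eqB by simp
    fix U assume U: "U \<in> Q" "\<And>W. W \<in> Q \<Longrightarrow> W \<noteq> U \<Longrightarrow> tame_deg (dg J W) (bsum J W)"
    then have "\<not> tallp ?J z U" using Q(2) dg btU sub by auto
    then show "\<not> tall_in J f B U" using tl sub U by blast
  qed
qed

text \<open>Hence \<open>contract_complement\<close> never returns the partition whose only part is
  \<open>B\<close>.\<close>

lemma tall_in_self: "tall_in J f B B"
  by (simp add: tall_in_def)

text \<open>All parts of the partition are proper subsets, so they are tame by induction and none of
  them is tall. Thus d(B) exceeds the degree of a part, which is at least 4, by at least 2.\<close>

lemma tame_sets:
  assumes "B \<subseteq> vt J - {x, z}" "B \<noteq> {}"
  shows "tame_deg (dg J B) (bsum J B)"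
proof -
  have "finite B" using assms(1) fin_sub by blast
  then show ?thesis using assms
  proof (induction B rule: finite_psubset_induct)
    case (psubset B)
    show ?case
    proof (cases "card B = 1")
      case True
      then obtain v where "B = {v}" by (auto simp: card_1_singleton_iff)
      then show ?thesis using tame psubset.prems by auto
    next
      case False
      then have c2: "2 \<le> card B" using psubset by (metis One_nat_def Suc_1 Suc_leI card_gt_0_iff le_neq_implies_less)
      have B: "B \<subseteq> vt J - {z}" using psubset by auto
      have "card {x, z} \<le> card (vt J - B)" using x zV psubset.prems by (intro card_mono) auto
      then have cc: "2 \<le> card (vt J - B)" using x by simp
      obtain f where f: "flow_off J z B f" using crit[OF B c2] by blast
      obtain Q where Q: "partition_on B Q"
        "\<And>U. U \<in> Q \<Longrightarrow> (\<And>W. W \<in> Q \<Longrightarrow> W \<noteq> U \<Longrightarrow> tame_deg (dg J W) (bsum J W)) \<Longrightarrow> \<not> tall_in J f B U"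
        using contract_complement[OF B cc f] by metis
      have Qs: "U \<subseteq> B" "U \<noteq> {}" if "U \<in> Q" for U using Q(1) that by (auto simp: partition_on_def)
      obtain U where U: "U \<in> Q" using Q(1) psubset.prems by (auto simp: partition_on_def)
      show ?thesis
      proof (cases "B \<in> Q")
        case True
        have "W = B" if "W \<in> Q" for W
          using that True Qs[OF that] partition_onD2[OF Q(1)] by (auto simp: disjoint_def)
        then show ?thesis using Q(2)[OF True] tall_in_self by blast
      next
        case False
        then have t: "tame_deg (dg J W) (bsum J W)" if "W \<in> Q" for W
          using Qs[OF that] that psubset by (metis psubsetI subset_trans)
        then have "\<not> tall_in J f B U" using Q(2) U by blast
        moreover have "4 \<le> dg J U" using t[OF U] by (auto simp: tame_deg_def)
        ultimately have "6 \<le> dg J B" by (auto simp: tall_in_def)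
        then show ?thesis by (simp add: tame_deg_def)
      qed
    qed
  qed
qed


lemma parts_tm:
  assumes B: "B \<subseteq> vt J - {x, z}" and f: "flow_off J z B f" and c: "B \<noteq> {}"
  obtains Q where "partition_on B Q" "finite Q" "B \<notin> Q"
    "\<And>U. U \<in> Q \<Longrightarrow> U \<noteq> {} \<and> U \<subseteq> B \<and> tame_deg (dg J U) (bsum J U) \<and> \<not> tall_in J f B U"
proof -
  have B': "B \<subseteq> vt J - {z}" using B by auto
  have "card {x, z} \<le> card (vt J - B)" using x zV B by (intro card_mono) auto
  then have cc: "2 \<le> card (vt J - B)" using x by simp
  obtain Q where Q: "partition_on B Q"
    "\<And>U. U \<in> Q \<Longrightarrow> (\<And>W. W \<in> Q \<Longrightarrow> W \<noteq> U \<Longrightarrow> tame_deg (dg J W) (bsum J W)) \<Longrightarrow> \<not> tall_in J f B U"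
    using contract_complement[OF B' cc f] by metis
  have Qs: "U \<noteq> {} \<and> U \<subseteq> B" if "U \<in> Q" for U using Q(1) that by (auto simp: partition_on_def)
  have t: "tame_deg (dg J W) (bsum J W)" if "W \<in> Q" for W
    using tame_sets[of W] Qs[OF that] B by auto
  have "finite Q" using finite_elements[OF _ Q(1)] B fin_sub by blast
  moreover have "B \<notin> Q" using Q(2)[of B] t tall_in_self by blast
  ultimately show ?thesis using that[of Q] Q Qs t by blast
qed

text \<open>Every part has degree at most d(B) - 2. At degree 6 all parts have degree 4 and boundary
  zero, which adds up to zero. At degree 7 with boundary zero, there are at least three parts of
  degree 5, and the net flow 0 forces both directions on the cut; \<open>three_parts\<close>
  excludes this.\<close>

lemma strongly_tame_sets:
  assumes B: "B \<subseteq> vt J - {x, z}" and c2: "2 \<le> card B"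
  shows "8 \<le> dg J B \<or> (dg J B = 6 \<and> bsum J B mod 3 = 0) \<or> (dg J B = 7 \<and> bsum J B mod 3 \<noteq> 0)"
proof -
  have fB: "finite B" using B fin_sub by blast
  have ne: "B \<noteq> {}" using c2 by auto
  have B': "B \<subseteq> vt J - {z}" using B by auto
  obtain f where f: "flow_off J z B f" using crit[OF B' c2] by blast
  obtain Q where Q: "partition_on B Q" "finite Q" "B \<notin> Q"
    "\<And>U. U \<in> Q \<Longrightarrow> U \<noteq> {} \<and> U \<subseteq> B \<and> tame_deg (dg J U) (bsum J U) \<and> \<not> tall_in J f B U"
    using parts_tm[OF B f ne] by metis
  have le: "dg J U + 2 \<le> dg J B" "4 \<le> dg J U" "dg J U = 4 \<longrightarrow> bsum J U mod 3 = 0"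
    "dg J U = 5 \<longrightarrow> bsum J U mod 3 \<noteq> 0" if "U \<in> Q" for U
    using Q(4)[OF that] by (auto simp: tall_in_def tame_deg_def)
  obtain U0 where U0: "U0 \<in> Q" using Q(1) ne by (auto simp: partition_on_def)
  have ge6: "6 \<le> dg J B" using le[OF U0] by simp
  have bts: "bsum J B = (\<Sum>U\<in>Q. bsum J U)" by (rule bsum_partition[OF fB Q(1)])
  show ?thesis
  proof (rule ccontr)
    assume n: "\<not> ?thesis"
    then consider "dg J B = 6" "bsum J B mod 3 \<noteq> 0" | "dg J B = 7" "bsum J B mod 3 = 0" using ge6 by linarith
    then show False
    proof cases
      case 1
      have "bsum J U mod 3 = 0" if "U \<in> Q" for U using le[OF that] 1 by auto
      then have "(\<Sum>U\<in>Q. bsum J U) mod 3 = (\<Sum>U\<in>Q. 0) mod 3" by (intro sum_mod_cong) auto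
      then show False using 1 bts by simp
    next
      case 2
      let ?Q5 = "{U \<in> Q. dg J U = 5}"
      have d45: "dg J U = 4 \<or> dg J U = 5" if "U \<in> Q" for U using le[OF that] 2 by auto
      have "odd (card ?Q5)"
      proof -
        have "(\<Sum>U\<in>Q. dg J U) = (\<Sum>U\<in>Q. 4 + of_bool (dg J U = 5))"
          using d45 by (intro sum.cong) auto
        also have "\<dots> = 4 * card Q + card ?Q5"
          using Q(2) by (simp add: sum.distrib of_bool_def sum.If_cases Int_def)
        finally have "even (4 * card Q + card ?Q5 + 7)"
          using even_sum_dg[OF fin(2) Q(2) partition_onD2[OF Q(1)]] 2 partition_onD1[OF Q(1)] by simp
        then show ?thesis by simp
      qed
      \<comment> \<open>The parts of degree 4 have boundary zero, so a single part of degree 5 would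
        give \<open>B\<close> a nonzero boundary.\<close>
      moreover have "card ?Q5 \<noteq> 1"
      proof
        assume "card ?Q5 = 1"
        then obtain A where A: "?Q5 = {A}" by (auto simp: card_1_singleton_iff)
        then have AQ: "A \<in> Q" "dg J A = 5" by auto
        have "bsum J U mod 3 = 0" if "U \<in> Q - {A}" for U using le[of U] that d45[of U] A by auto
        then have "(\<Sum>U\<in>Q - {A}. bsum J U) mod 3 = (\<Sum>U\<in>Q - {A}. 0) mod 3" by (intro sum_mod_cong) auto
        then have "(\<Sum>U\<in>Q - {A}. bsum J U) mod 3 = 0" by simp
        moreover have "bsum J B = bsum J A + (\<Sum>U\<in>Q - {A}. bsum J U)" using bts Q(2) AQ by (simp add: sum.remove)
        ultimately have "bsum J B mod 3 = bsum J A mod 3" using mod_add_right_eq[of "bsum J A" _ 3] by (metis add.right_neutral)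
        then show False using le[OF AQ(1)] AQ 2 by simp
      qed
      ultimately have c3: "3 \<le> card ?Q5" by presburger
      have "net J f B mod 3 = 0" using f 2 by (auto simp: flow_off_def)
      then have nonuni: "\<exists>e\<in>ecut J B. f e * chi J e B = c" if "c = 1 \<or> c = -1" for c
        using net_nonuniform[of J f B c] f 2 that by (auto simp: flow_off_def)
      obtain e e' where "e \<in> ecut J B" "f e * chi J e B = 1" "e' \<in> ecut J B" "f e' * chi J e' B = -1"
        using nonuni[of 1] nonuni[of "-1"] by auto
      then show False
        using three_parts[OF Q(1), of e J f e' ?Q5] c3 2 Q(4) by auto
    qed
  qed
qed

text \<open>Let \<open>U\<close> be the part that contains \<open>x\<close>. All other parts avoid
  \<open>x\<close> and are tame, so \<open>U\<close> is not tall; this gives d(X) \<ge> d(U) + 2,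
  and d(U) \<ge> d(x) follows by induction. The vertex outside \<open>X\<close> besides
  \<open>z\<close> makes the contracted graph smaller.\<close>

lemma x_cut_ge:
  assumes "X \<subseteq> vt J - {z}" "x \<in> X" "2 \<le> card X" "X \<noteq> vt J - {z}"
  shows "dg J {x} + 2 \<le> dg J X"
proof -
  have "finite X" using assms(1) fin_sub by blast
  then show ?thesis using assms
  proof (induction X rule: finite_psubset_induct)
    case (psubset X)
    note p = psubset.prems
    obtain f where f: "flow_off J z X f" using crit[OF p(1,3)] by blast
    obtain w where w: "w \<in> vt J" "w \<noteq> z" "w \<notin> X" using p by auto
    have "card {w, z} \<le> card (vt J - X)" using w zV p by (intro card_mono) auto
    then have cc: "2 \<le> card (vt J - X)" using w by simp
    obtain Q where Q: "partition_on X Q"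
      "\<And>U. U \<in> Q \<Longrightarrow> (\<And>W. W \<in> Q \<Longrightarrow> W \<noteq> U \<Longrightarrow> tame_deg (dg J W) (bsum J W)) \<Longrightarrow> \<not> tall_in J f X U"
      using contract_complement[OF p(1) cc f] by metis
    obtain U where U: "U \<in> Q" "x \<in> U" using Q(1) p by (auto simp: partition_on_def)
    have UX: "U \<subseteq> X" using Q(1) U by (auto simp: partition_on_def)
    have "tame_deg (dg J W) (bsum J W)" if W: "W \<in> Q" "W \<noteq> U" for W
    proof (rule tame_sets)
      have "x \<notin> W" using partition_onD2[OF Q(1)] U W by (auto simp: disjoint_def)
      then show "W \<subseteq> vt J - {x, z}" "W \<noteq> {}" using Q(1) W p by (auto simp: partition_on_def)
    qed
    then have nt: "\<not> tall_in J f X U" using Q(2) U by blast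
    then have "U \<noteq> X" using tall_in_self by auto
    have "dg J {x} \<le> dg J U"
    proof (cases "U = {x}")
      case False
      have fU: "finite U" using UX psubset(1) finite_subset by blast
      have "card {x} < card U" using False U fU by (intro psubset_card_mono) auto
      then have "2 \<le> card U" by simp
      moreover have "U \<noteq> vt J - {z}" using UX p(1) \<open>U \<noteq> X\<close> by auto
      ultimately have "dg J {x} + 2 \<le> dg J U"
        using psubset.IH[of U] UX \<open>U \<noteq> X\<close> U p(1) by auto
      then show ?thesis by simp
    qed simp
    moreover have "dg J U + 2 \<le> dg J X" using nt by (auto simp: tall_in_def)
    ultimately show ?case by simp
  qed
qed

lemma x_cut_cases: 
  assumes "X \<subseteq> vt J - {z}" "x \<in> X"
  shows "dg J {x} + 2 \<le> dg J X \<or> X = {x} \<or> X = vt J - {z}"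
proof -
  have fX: "finite X" using assms fin_sub by blast
  have "2 \<le> card X" if "X \<noteq> {x}"
  proof -
    have "card {x} < card X" using that assms fX by (intro psubset_card_mono) auto
    then show ?thesis by simp
  qed
  then show ?thesis using x_cut_ge assms by blast
qed

lemma dg_vz: "dg J (vt J - {z}) = dg J {z}"
  using dg_compl[OF val, of "{z}"] zV by simp

text \<open>In a flow of the graph with \<open>u\<close> and \<open>v\<close> identified, the two
  edges can be reoriented without affecting any other vertex. They contribute -2, 0 or 2 at
  \<open>u\<close>, which covers all residues mod 3. Once \<open>u\<close> is balanced, so is
  \<open>v\<close>, because the pair is.\<close>

lemma no_parallel:
  assumes "u \<in> vt J - {z}" "v \<in> vt J - {z}" "u \<noteq> v" "e1 \<noteq> e2"
    "e1 \<in> ecut J {u} \<inter> ecut J {v}" "e2 \<in> ecut J {u} \<inter> ecut J {v}"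
  shows False
proof -
  obtain f where f: "flow_off J z {u, v} f" using crit[of "{u, v}"] assms by auto
  have ed: "e1 \<in> ed J" "e2 \<in> ed J" using assms by (auto simp: ecut_def)
  define t where "t = f e1 * chi J e1 {u} + f e2 * chi J e2 {u}"
  define r where "r = (bd J u - net J f {u} + t) mod 3"
  have c: "chi J e1 {u} \<in> {1, -1}" "chi J e2 {u} \<in> {1, -1}"
    using assms chi_cases[of J e1 "{u}"] chi_cases[of J e2 "{u}"] by (auto simp: ecut_def)
  have "0 \<le> r" "r < 3" by (simp_all add: r_def)
  then have "r = 0 \<or> r = 1 \<or> r = 2" by linarith
  then obtain s1 s2 :: int where s: "s1 \<in> {1, -1}" "s2 \<in> {1, -1}" "(s1 + s2) mod 3 = r"
  proof (elim disjE)
    assume "r = 0" then show ?thesis using that[of 1 "-1"] by simp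
  next
    assume "r = 1" then show ?thesis using that[of "-1" "-1"] by simp
  next
    assume "r = 2" then show ?thesis using that[of 1 1] by simp
  qed
  define g where "g = f(e1 := s1 * chi J e1 {u}, e2 := s2 * chi J e2 {u})"
  have sp: "net J h S = h e1 * chi J e1 S + h e2 * chi J e2 S + (\<Sum>e\<in>ed J - {e1, e2}. h e * chi J e S)" for h S
  proof -
    have "net J h S = (\<Sum>e\<in>ed J - {e1, e2}. h e * chi J e S) + (\<Sum>e\<in>{e1, e2}. h e * chi J e S)"
      unfolding net_def using ed by (intro sum.subset_diff) auto
    then show ?thesis using assms(4) by simp
  qed
  have rest: "(\<Sum>e\<in>ed J - {e1, e2}. g e * chi J e S) = (\<Sum>e\<in>ed J - {e1, e2}. f e * chi J e S)" for S
    by (rule sum.cong) (auto simp: g_def)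
  have ends: "{src J e1, tgt J e1} = {u, v}" "{src J e2, tgt J e2} = {u, v}"
    using assms by (auto simp: ecut_iff)
  have zero: "chi J e1 S = 0" "chi J e2 S = 0" if "S \<inter> {u, v} = {} \<or> {u, v} \<subseteq> S" for S
    using ends that by (auto simp: chi_def)
  have same: "net J g S = net J f S" if "S \<inter> {u, v} = {} \<or> {u, v} \<subseteq> S" for S
    using sp[of g S] sp[of f S] rest[of S] zero[OF that] by simp
  have "net J g {u} mod 3 = bd J u mod 3"
  proof -
    have "net J g {u} = s1 + s2 + (net J f {u} - t)"
      using sp[of g "{u}"] sp[of f "{u}"] rest[of "{u}"] assms(4) c by (auto simp: g_def t_def)
    then show ?thesis using mod3_shift[OF s(3)[unfolded r_def]] by simp
  qed
  moreover have "net J g {v} mod 3 = bd J v mod 3"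
  proof -
    have "net J g {u, v} mod 3 = bsum J {u, v} mod 3" using same[of "{u, v}"] f by (simp add: flow_off_def)
    moreover have "bsum J {u, v} = bd J u + bd J v" using assms(3) by (simp add: bsum_def)
    moreover have "net J g {u, v} = net J g {u} + net J g {v}"
      using net_Un[of "{u}" "{v}" J g] assms(3) by (simp add: insert_commute)
    ultimately have "(net J g {u} + net J g {v}) mod 3 = (bd J u + bd J v) mod 3" by simp
    then show ?thesis using \<open>net J g {u} mod 3 = bd J u mod 3\<close> by (rule mod3_cancel)
  qed
  moreover have "net J g {w} mod 3 = bd J w mod 3" if "w \<in> vt J" "w \<noteq> u" "w \<noteq> v" for w
    using same[of "{w}"] that f by (auto simp: flow_off_def)
  moreover have "g e \<in> {1, -1}" if "e \<in> ed J" for e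
    using that f s c by (auto simp: g_def flow_off_def)
  moreover have "g e = pre J e" if "e \<in> ecut J {z}" for e
  proof -
    have "e \<noteq> e1" "e \<noteq> e2" using that ends assms(1,2) by (auto simp: ecut_iff)
    then show ?thesis using that f by (auto simp: g_def flow_off_def)
  qed
  ultimately have "rflow J z g" unfolding rflow_def by blast
  then show False using nonext by (auto simp: ext_def)
qed

text \<open>The form in which minimality is applied to modified graphs. The partition supplied by
  \<open>IH\<close> is unknown, so the bounds are asked for every set that could be a part. The set
  of all vertices but \<open>z\<close> is always tall, since its degree is that of the tip.\<close>

lemma smaller_extends:
  fixes J' :: "('v, 'e) rgraph"
  assumes J': "valid J' z" and m: "card (vt J') + card (ed J') < card (vt J) + card (ed J)"
    and x': "x \<in> vt J'"
    and t: "\<And>B. B \<noteq> {} \<Longrightarrow> B \<subseteq> vt J' - {x, z} \<Longrightarrow> tame_deg (dg J' B) (bsum J' B)"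
    and tl: "\<And>X. x \<in> X \<Longrightarrow> X \<subseteq> vt J' - {z} \<Longrightarrow> X \<noteq> vt J' - {z} \<Longrightarrow> tallp J' z X"
  shows "ext J' z"
proof (rule ccontr)
  assume "\<not> ext J' z"
  then obtain Q where Q: "partition_on (vt J' - {z}) Q"
    "\<forall>U\<in>Q. (\<forall>W\<in>Q - {U}. tame_deg (dg J' W) (bsum J' W)) \<longrightarrow> \<not> tallp J' z U"
    using IH[OF m, of z] J' by (auto simp: splits_def)
  obtain U where U: "U \<in> Q" "x \<in> U" using Q(1) x' x by (auto simp: partition_on_def)
  have "tame_deg (dg J' W) (bsum J' W)" if W: "W \<in> Q" "W \<noteq> U" for W
  proof (rule t)
    have "x \<notin> W" using partition_onD2[OF Q(1)] U W by (auto simp: disjoint_def)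
    then show "W \<subseteq> vt J' - {x, z}" "W \<noteq> {}" using Q(1) W by (auto simp: partition_on_def)
  qed
  then have "\<not> tallp J' z U" using Q(2) U by blast
  moreover have "tallp J' z U"
  proof (cases "U = vt J' - {z}")
    case True
    have "dg J' U = dg J' {z}" using dg_compl[OF J', of "{z}"] J' True by (simp add: valid_def)
    then show ?thesis by (simp add: tallp_def)
  next
    case False
    then show ?thesis using tl U Q(1) by (auto simp: partition_on_def)
  qed
  ultimately show False by simp
qed

end

subsection \<open>Deletable edges\<close>

lemma del_dg:
  assumes "finite (ed J)" "e \<in> ed J"
  shows "dg (del_edges J {e} p) S + of_bool (e \<in> ecut J S) = dg J S"
proof -
  have "card ({e} \<inter> ecut J S) = of_bool (e \<in> ecut J S)" by (cases "e \<in> ecut J S") auto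
  then show ?thesis using del_edges_dg[of J "{e}" p S] assms by simp
qed

lemma del_bt: "finite S \<Longrightarrow> bsum (del_edges J {e} p) S = bsum J S - p e * chi J e S"
  by (simp add: del_edges_bt)

lemma card_del: "finite (ed J) \<Longrightarrow> e \<in> ed J \<Longrightarrow> card (ed J - {e}) < card (ed J)"
  by (rule psubset_card_mono) auto

lemma chi_opp:
  assumes "e \<in> ecut J {u}" "e \<in> ecut J {v}" "u \<noteq> v"
  shows "chi J e {v} = - chi J e {u}"
  using assms by (auto simp: ecut_iff chi_def)

text \<open>One deletion changes the parity and shifts the boundary by 1 or -1: degree 6 with
  boundary zero becomes degree 5 with nonzero boundary, and degree 7 becomes 6. So sets of at least
  two vertices tolerate a deletion in either direction.\<close>

lemma tame_deg_pred:
  assumes "8 \<le> d \<or> (d = 6 \<and> b mod 3 = 0) \<or> (d = 7 \<and> b mod 3 \<noteq> 0)" "c = 1 \<or> c = (-1 :: int)" "d' + 1 = d"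
  shows "tame_deg d' (b - c)"
proof -
  have "(b - c) mod 3 \<noteq> 0" if "b mod 3 = 0" using that assms(2) by presburger
  then show ?thesis using assms by (auto simp: tame_deg_def)
qed

lemma tame_deg_cong: "tame_deg d b \<Longrightarrow> b mod 3 = b' mod 3 \<Longrightarrow> tame_deg d b'"
  by (simp add: tame_deg_def)

context critical
begin

lemma card_ge2: "finite B \<Longrightarrow> B \<noteq> {} \<Longrightarrow> (\<And>v. B \<noteq> {v}) \<Longrightarrow> 2 \<le> card B"
proof -
  assume a: "finite B" "B \<noteq> {}" "\<And>v. B \<noteq> {v}"
  have "card B \<noteq> 0" using a by simp
  moreover have "card B \<noteq> 1" using a(3) by (auto simp: card_1_singleton_iff)
  ultimately show ?thesis by simp
qed

lemma tall_le: "dg J {z} \<le> dg J {x} + 2"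
  using tall by (simp add: tallp_def)

lemma tallp_strict: "dg J' {z} \<le> dg J' X + 1 \<Longrightarrow> tallp J' z X"
  by (simp add: tallp_def)

text \<open>Deleting such an edge lowers d(z) and d(x) alike and keeps the edges at \<open>z\<close>
  that avoid \<open>x\<close>, so tallness survives. Sets without \<open>x\<close> and
  \<open>z\<close> keep their cuts.\<close>

lemma no_zx: "ecut J {z} \<inter> ecut J {x} = {}"
proof (rule ccontr)
  assume "\<not> ?thesis"
  then obtain e where e: "e \<in> ecut J {z}" "e \<in> ecut J {x}" by auto
  have eE: "e \<in> ed J" using e by (auto simp: ecut_def)
  have inS: "e \<in> ecut J S \<longleftrightarrow> (x \<in> S) \<noteq> (z \<in> S)" for S using e x by (auto simp: ecut_iff)
  let ?J = "del_edges J {e} (pre J)"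
  have vl: "valid ?J z" using val eE by (intro del_edges_valid) auto
  have dg': "dg ?J S + of_bool (e \<in> ecut J S) = dg J S" for S by (rule del_dg) (use eE in auto)
  have "ext ?J z"
  proof (rule smaller_extends[OF vl])
    show "card (vt ?J) + card (ed ?J) < card (vt J) + card (ed J)"
      using card_del[OF fin(2) eE] by simp
    show "x \<in> vt ?J" using x by simp
    fix B assume B: "B \<noteq> {}" "B \<subseteq> vt ?J - {x, z}"
    have ne: "e \<notin> ecut J B" using inS B by auto
    then have "chi J e B = 0" using eE by (auto simp: ecut_def)
    moreover have "finite B" using B fin_sub[of B] by simp
    ultimately have "bsum ?J B = bsum J B" by (simp add: del_bt)
    then show "tame_deg (dg ?J B) (bsum ?J B)" using dg'[of B] ne tame_sets[of B] B by simp
  next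
    fix X assume X: "x \<in> X" "X \<subseteq> vt ?J - {z}" "X \<noteq> vt ?J - {z}"
    have z1: "dg ?J {z} + 1 = dg J {z}" using dg'[of "{z}"] e by simp
    have X1: "dg ?J X + 1 = dg J X" using dg'[of X] inS[of X] X by auto
    show "tallp ?J z X"
    proof (cases "X = {x}")
      case True
      have "ecut ?J {z} - ecut ?J {x} = ecut J {z} - ecut J {x}" using e by auto
      then show ?thesis using tall z1 X1 unfolding True tallp_def by auto
    next
      case False
      then have "dg J {x} + 2 \<le> dg J X" using x_cut_cases[of X] X by auto
      then show ?thesis using tall_le z1 X1 by (intro tallp_strict) simp
    qed
  qed
  then have "ext J z" using val eE by (intro del_edges_ext[of J z "{e}" "pre J"]) (auto simp: valid_def)
  then show False using nonext by simp
qed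

text \<open>Larger sets tolerate the deletion by the strong bound, which leaves only the
  end-vertices to check. For an edge at \<open>x\<close> the assumption d(z) \<le> d(x) keeps the
  new degrees out of the border case in which tallness depends on directions.\<close>

lemma no_delete:
  assumes e: "e \<in> ed J" "e \<in> ecut J {x} \<Longrightarrow> dg J {z} \<le> dg J {x}" and p: "p = 1 \<or> p = -1"
    and ez: "e \<in> ecut J {z} \<Longrightarrow> p = pre J e"
    and t: "\<And>v. v \<in> vt J - {x, z} \<Longrightarrow> e \<in> ecut J {v} \<Longrightarrow> tame_deg (dg J {v} - 1) (bd J v - p * chi J e {v})"
  shows False
proof -
  let ?J = "del_edges J {e} (\<lambda>_. p)"
  have vl: "valid ?J z" using val e ez by (intro del_edges_valid) auto
  have dg': "dg ?J S + of_bool (e \<in> ecut J S) = dg J S" for S by (rule del_dg) (use e in auto)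
  have "ext ?J z"
  proof (rule smaller_extends[OF vl])
    show "card (vt ?J) + card (ed ?J) < card (vt J) + card (ed J)"
      using card_del[OF fin(2) e(1)] by simp
    show "x \<in> vt ?J" using x by simp
    fix B assume B: "B \<noteq> {}" "B \<subseteq> vt ?J - {x, z}"
    have fB: "finite B" using B fin_sub[of B] by simp
    have bt': "bsum ?J B = bsum J B - p * chi J e B" using del_bt[OF fB, of J e "\<lambda>_. p"] by simp
    show "tame_deg (dg ?J B) (bsum ?J B)"
    proof (cases "e \<in> ecut J B")
      case False
      then have "chi J e B = 0" using e by (auto simp: ecut_def)
      then show ?thesis using False dg'[of B] bt' tame_sets[of B] B by simp
    next
      case True
      then have d: "dg ?J B + 1 = dg J B" using dg'[of B] by simp
      show ?thesis
      proof (cases "\<exists>v. B = {v}")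
        case T: True
        then obtain v where v: "B = {v}" by blast
        have "tame_deg (dg J {v} - 1) (bd J v - p * chi J e {v})" using t[of v] True B v by simp
        moreover have "dg J {v} - 1 = dg ?J B" using d v by simp
        ultimately show ?thesis using bt' v by (simp del: del_edges_simps)
      next
        case False
        then have "2 \<le> card B" using card_ge2[OF fB B(1)] by blast
        then have s: "8 \<le> dg J B \<or> (dg J B = 6 \<and> bsum J B mod 3 = 0) \<or> (dg J B = 7 \<and> bsum J B mod 3 \<noteq> 0)"
          using strongly_tame_sets[of B] B by simp
        have "p * chi J e B = 1 \<or> p * chi J e B = -1"
          using p True chi_cases[of J e B] by (auto simp: ecut_def)
        then show ?thesis using tame_deg_pred[OF s _ d] bt' by simp
      qed
    qed
  next
    fix X assume X: "x \<in> X" "X \<subseteq> vt ?J - {z}" "X \<noteq> vt ?J - {z}"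
    show "tallp ?J z X"
    proof (cases "X = {x}")
      case True
      show ?thesis
      proof (cases "e \<in> ecut J {z} \<or> e \<in> ecut J {x}")
        case T: True
        then have "dg ?J {z} \<le> dg ?J {x} + 1"
          using dg'[of "{z}"] dg'[of "{x}"] tall_le e(2) by (auto simp: of_bool_def split: if_splits)
        then show ?thesis using True by (intro tallp_strict) simp
      next
        case False
        then have dx: "dg ?J {x} = dg J {x}" using dg'[of "{x}"] by simp
        from False
        have "dg ?J {z} = dg J {z}" "ecut ?J {z} - ecut ?J {x} = ecut J {z} - ecut J {x}"
          using dg'[of "{z}"] e by auto
        then show ?thesis using tall dx unfolding True tallp_def by simp
      qed
    next
      case False
      then have "dg J {x} + 2 \<le> dg J X" using x_cut_cases[of X] X by auto
      moreover have "dg J X \<le> dg ?J X + 1" using dg'[of X] by (simp add: of_bool_def split: if_splits)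
      moreover have "dg ?J {z} \<le> dg J {z}" using dg'[of "{z}"] by simp
      ultimately show ?thesis using tall_le by (intro tallp_strict) simp
    qed
  qed
  then have "ext J z" using val e ez p by (intro del_edges_ext[of J z "{e}" "\<lambda>_. p"]) auto
  then show False using nonext by simp
qed

text \<open>
  The vertex stays tame when an incident edge is deleted that leaves it (\<open>c = 1\<close>) or enters it
  (\<open>c = -1\<close>).
\<close>

definition deletable :: "int \<Rightarrow> 'v \<Rightarrow> bool" where
  "deletable c v \<longleftrightarrow> tame_deg (dg J {v} - 1) (bd J v - c)"

text \<open>The preflow fixes the direction of a tip edge, so this is the one direction that its
  other end cannot tolerate.\<close>

lemma z_edge_not_ok:
  assumes "v \<in> vt J - {x, z}" "e \<in> ecut J {z}" "e \<in> ecut J {v}"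
  shows "\<not> deletable (pre J e * chi J e {v}) v"
proof
  assume o: "deletable (pre J e * chi J e {v}) v"
  have "pre J e = 1 \<or> pre J e = -1" using val assms(2) by (auto simp: valid_def ecut_def)
  moreover have "u = v" if "e \<in> ecut J {u}" "u \<noteq> z" for u using that assms by (auto simp: ecut_iff)
  moreover have "e \<notin> ecut J {x}" using assms(2) no_zx by auto
  moreover have "e \<in> ed J" using assms(2) by (simp add: ecut_def)
  ultimately show False using no_delete[of e "pre J e"] o unfolding deletable_def by blast
qed

text \<open>An edge that leaves \<open>u\<close> enters \<open>v\<close>, so tolerating opposite
  signs would make the edge deletable.\<close>

lemma edge_not_ok:
  assumes "u \<in> vt J - {x, z}" "v \<in> vt J - {x, z}" "u \<noteq> v" "e \<in> ecut J {u}" "e \<in> ecut J {v}"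
  shows "\<not> (deletable c u \<and> deletable (- c) v \<and> (c = 1 \<or> c = -1))"
proof
  assume o: "deletable c u \<and> deletable (- c) v \<and> (c = 1 \<or> c = -1)"
  have cu: "chi J e {u} = 1 \<or> chi J e {u} = -1" using assms chi_cases[of J e "{u}"] by (auto simp: ecut_def)
  have e: "e \<in> ed J" "e \<notin> ecut J {x}" "e \<notin> ecut J {z}" using assms by (auto simp: ecut_iff)
  have w: "w = u \<or> w = v" if "e \<in> ecut J {w}" for w using that assms by (auto simp: ecut_iff)
  show False
  proof (rule no_delete[of e "c * chi J e {u}"])
    show "c * chi J e {u} = 1 \<or> c * chi J e {u} = -1" using o cu by auto
    fix w assume "w \<in> vt J - {x, z}" "e \<in> ecut J {w}"
    then consider "w = u" | "w = v" using w by blast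
    then show "tame_deg (dg J {w} - 1) (bd J w - c * chi J e {u} * chi J e {w})"
    proof cases
      case 1
      then have "c * chi J e {u} * chi J e {w} = c" using cu by auto
      then show ?thesis using o 1 unfolding deletable_def by (simp only:)
    next
      case 2
      then have "c * chi J e {u} * chi J e {w} = - c" using cu chi_opp[OF assms(4,5,3)] by auto
      then show ?thesis using o 2 unfolding deletable_def by (simp only:)
    qed
  qed (use e in auto)
qed

end

subsection \<open>Vertices of degree four\<close>

lemma tame_deg_pred2:
  assumes "8 \<le> d \<or> (d = 6 \<and> b mod 3 = 0) \<or> (d = 7 \<and> b mod 3 \<noteq> 0)" "d' + 2 = d"
  shows "tame_deg d' b"
proof -
  have "d' \<ge> 6 \<or> (d' = 4 \<and> b mod 3 = 0) \<or> (d' = 5 \<and> b mod 3 \<noteq> 0)" using assms by linarith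
  then show ?thesis by (simp add: tame_deg_def)
qed

lemma ecut_Un_at: "y \<notin> A \<Longrightarrow> y \<notin> B \<Longrightarrow> ecut J (A \<union> B) \<inter> ecut J {y} = (ecut J A \<union> ecut J B) \<inter> ecut J {y}"
  by (auto simp: ecut_iff)

lemma ecut_two_ends:
  assumes "e \<in> ecut J {y}" "e \<in> ecut J {z}" "y \<noteq> z" "y \<notin> S" "z \<notin> S"
  shows "e \<notin> ecut J S"
  using assms by (auto simp: ecut_iff)

definition lift_pairs :: "('v, 'e) rgraph \<Rightarrow> 'v \<Rightarrow> 'e \<Rightarrow> 'e \<Rightarrow> 'e \<Rightarrow> 'e \<Rightarrow> ('v, 'e) rgraph" where
  "lift_pairs J y e1 e2 e3 e4 = del_vert (lift (lift J y e1 e2) y e3 e4) y"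

definition both_dirs :: "('v, 'e) rgraph \<Rightarrow> 'v \<Rightarrow> 'v set \<Rightarrow> bool" where
  "both_dirs J z X \<longleftrightarrow> (\<exists>e\<in>ecut J {z} - ecut J X. pre J e * chi J e {z} = 1) \<and>
     (\<exists>e\<in>ecut J {z} - ecut J X. pre J e * chi J e {z} = - 1)"

lemma tallp_both_dirs: "tallp J z X \<longleftrightarrow> dg J {z} \<le> dg J X + 2 \<and> (dg J {z} = dg J X + 2 \<longrightarrow> both_dirs J z X)"
  by (simp add: tallp_def both_dirs_def)

context
  fixes J :: "('v, 'e) rgraph" and z y :: 'v and e1 e2 e3 e4 :: 'e
  assumes val: "valid J z" and y: "y \<in> vt J" "bd J y mod 3 = 0"
    and ey: "ecut J {y} = {e1, e2, e3, e4}" and dist: "distinct [e1, e2, e3, e4]"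
    and l12: "liftable J z y e1 e2" and l34: "liftable J z y e3 e4"
begin

lemma e4_lift: "liftable (lift J y e1 e2) z y e3 e4"
proof -
  have "e \<in> ecut (lift J y e1 e2) S \<longleftrightarrow> e \<in> ecut J S" if "e \<noteq> e1" "e \<noteq> e2" for e S
    using that by (auto simp: lift_ecut[OF l12])
  moreover have "chi (lift J y e1 e2) e S = chi J e S" if "e \<noteq> e1" for e S
    using that by (rule lift_chi_other)
  ultimately show ?thesis using l34 dist unfolding liftable_def by (metis distinct_length_2_or_more lift_simps(3))
qed

lemma lift_pairs_ecut:
  "ecut (lift_pairs J y e1 e2 e3 e4) S = {e. e \<in> ecut J S \<and> e \<notin> {e1, e2, e3, e4}} \<union>
     {e. e = e1 \<and> (e1 \<in> ecut J S) \<noteq> (e2 \<in> ecut J S)} \<union>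
     {e. e = e3 \<and> (e3 \<in> ecut J S) \<noteq> (e4 \<in> ecut J S)}"
  unfolding lift_pairs_def del_vert_simps lift_ecut[OF e4_lift] lift_ecut[OF l12]
  using dist by auto

lemma lift_pairs_dg:
  "dg (lift_pairs J y e1 e2 e3 e4) S + 2 * of_bool (e1 \<in> ecut J S \<and> e2 \<in> ecut J S) +
     2 * of_bool (e3 \<in> ecut J S \<and> e4 \<in> ecut J S) = dg J S"
proof -
  have f: "finite (ed J)" using val by (simp add: valid_def)
  have "e3 \<in> ecut (lift J y e1 e2) S \<longleftrightarrow> e3 \<in> ecut J S" "e4 \<in> ecut (lift J y e1 e2) S \<longleftrightarrow> e4 \<in> ecut J S"
    using dist by (auto simp: lift_ecut[OF l12])
  then show ?thesis
    using lift_dg[OF l12 f, of S] lift_dg[OF e4_lift, of S] f by (simp add: lift_pairs_def)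
qed

lemma lift_pairs_simps:
  "vt (lift_pairs J y e1 e2 e3 e4) = vt J - {y}" "ed (lift_pairs J y e1 e2 e3 e4) = ed J - {e2} - {e4}"
  "pre (lift_pairs J y e1 e2 e3 e4) = pre J" "bsum (lift_pairs J y e1 e2 e3 e4) = bsum J"
  by (simp_all add: lift_pairs_def)

lemma lift_pairs_chi:
  assumes "e \<noteq> e1 \<or> e2 \<notin> ecut J S" "e \<noteq> e3 \<or> e4 \<notin> ecut J S"
  shows "chi (lift_pairs J y e1 e2 e3 e4) e S = chi J e S"
proof -
  have c: "e1 \<in> ecut J {y}" "e2 \<in> ecut J {y}" "e3 \<in> ecut J {y}" "e4 \<in> ecut J {y}" using ey by auto
  have c1: "e3 \<in> ecut (lift J y e1 e2) {y}" "e4 \<in> ecut (lift J y e1 e2) {y}"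
    using e4_lift by (simp_all add: liftable_def)
  have 1: "chi (lift J y e1 e2) e S = chi J e S"
  proof (cases "e = e1")
    case True
    then have "chi J e2 S = 0" using assms(1) c by (auto simp: ecut_def)
    then show ?thesis using True by (simp add: lift_chi[OF c(1,2)])
  qed (simp add: lift_chi_other)
  have "chi (lift (lift J y e1 e2) y e3 e4) e S = chi (lift J y e1 e2) e S"
  proof (cases "e = e3")
    case True
    then have "chi J e4 S = 0" using assms(2) c by (auto simp: ecut_def)
    then have "chi (lift J y e1 e2) e4 S = 0" using dist lift_chi_other[of e4 e1 J y e2 S] by auto
    then show ?thesis using True by (simp add: lift_chi[OF c1])
  qed (simp add: lift_chi_other)
  then show ?thesis using 1 by (simp add: lift_pairs_def)
qed

lemma lift_pairs_cut_y: "ecut (lift (lift J y e1 e2) y e3 e4) {y} = {}"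
  using dist ey by (auto simp: lift_ecut[OF e4_lift] lift_ecut[OF l12])

lemma lift_pairs_valid: "valid (lift_pairs J y e1 e2 e3 e4) z"
  unfolding lift_pairs_def
proof (rule del_vert_valid[OF lift_valid[OF e4_lift lift_valid[OF l12 val]] _ _ lift_pairs_cut_y])
  show "y \<noteq> z" using l12 by (simp add: liftable_def)
qed (use y in simp_all)

lemma lift_pairs_ext: "ext (lift_pairs J y e1 e2 e3 e4) z \<Longrightarrow> ext J z"
  unfolding lift_pairs_def
  using del_vert_ext[OF lift_pairs_cut_y, of z] y lift_ext[OF l12 val] lift_ext[OF e4_lift lift_valid[OF l12 val]]
  by simp

end

context critical
begin

lemma dg_insert:
  assumes "y \<notin> S"
  shows "dg J (insert y S) + 2 * card (ecut J S \<inter> ecut J {y}) = dg J S + dg J {y}"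
  using dg_Un[of J S "{y}"] assms by simp

lemma parallel_eq:
  assumes "u \<in> vt J - {z}" "v \<in> vt J - {z}" "u \<noteq> v" "e1 \<noteq> e2" "e1 \<in> ecut J {u}" "e2 \<in> ecut J {u}"
    "e1 \<in> ecut J {v}" "e2 \<in> ecut J {v}"
  shows False
  using no_parallel[OF assms(1-4)] assms by blast

text \<open>Tameness survives the lifting of both pairs, so some set \<open>X\<close> around
  \<open>x\<close> fails to be tall. The bounds on d(X) and d(insert y X), compared through the
  number of edges between \<open>X\<close> and \<open>y\<close>, then leave only the border
  case.\<close>

lemma zero_pairing:
  assumes y: "y \<in> vt J - {x, z}" "dg J {y} = 4" "bd J y mod 3 = 0"
    and ey: "ecut J {y} = {e1, e2, e3, e4}" and dist: "distinct [e1, e2, e3, e4]"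
    and l12: "liftable J z y e1 e2" and l34: "liftable J z y e3 e4"
  obtains X where "dg J {z} = dg J {x} + 2" "dg (lift_pairs J y e1 e2 e3 e4) {z} = dg J {x} + 2"
    "x \<in> X" "X \<subseteq> vt J - {y, z}" "\<not> both_dirs (lift_pairs J y e1 e2 e3 e4) z X"
    "X = {x} \<or> (dg J X = dg J {x} + 2 \<and>
        (ecut J X \<inter> ecut J {y} = {e1, e2} \<or> ecut J X \<inter> ecut J {y} = {e3, e4}))"
proof -
  let ?J = "lift_pairs J y e1 e2 e3 e4"
  have yV: "y \<in> vt J" using y by simp
  note dg' = lift_pairs_dg[OF val yV y(3) ey dist l12 l34]
  note sm' = lift_pairs_simps[OF val yV y(3) ey dist l12 l34]
  note vl = lift_pairs_valid[OF val yV y(3) ey dist l12 l34]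
  have e2E: "e2 \<in> ed J" "e4 \<in> ed J" using ey by (auto simp: ecut_def)
  have "\<not> ext ?J z" using lift_pairs_ext[OF val yV y(3) ey dist l12 l34] nonext by blast
  have meas: "card (vt ?J) + card (ed ?J) < card (vt J) + card (ed J)"
  proof -
    have "card (vt ?J) < card (vt J)" unfolding sm' using yV by (intro psubset_card_mono) auto
    moreover have "card (ed ?J) \<le> card (ed J)" unfolding sm' by (intro card_mono) auto
    ultimately show ?thesis by simp
  qed
  have nodup: "\<not> (a \<in> ecut J {u} \<and> b \<in> ecut J {u})"
    if "u \<in> vt J - {y, z}" "a \<in> ecut J {y}" "b \<in> ecut J {y}" "a \<noteq> b" for u a b
    using parallel_eq[of u y a b] that y by auto
  have tmB: "tame_deg (dg ?J B) (bsum ?J B)" if B: "B \<noteq> {}" "B \<subseteq> vt ?J - {x, z}" for B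
  proof -
    have B': "B \<subseteq> vt J - {x, z}" "y \<notin> B" using B sm' by auto
    have fB: "finite B" using B' fin_sub by blast
    let ?l1 = "e1 \<in> ecut J B \<and> e2 \<in> ecut J B" and ?l2 = "e3 \<in> ecut J B \<and> e4 \<in> ecut J B"
    have t: "tame_deg (dg J B) (bsum J B)" using tame_sets B' B by blast
    show ?thesis
    proof (cases "\<exists>v. B = {v}")
      case True
      then obtain v where "B = {v}" by blast
      then have "\<not> ?l1" "\<not> ?l2" using nodup[of v e1 e2] nodup[of v e3 e4] B' ey dist by auto
      then have "dg ?J B = dg J B" using dg'[of B] by (auto simp: of_bool_def split: if_splits)
      then show ?thesis using t sm' by simp
    next
      case False
      then have c2: "2 \<le> card B" using card_ge2[OF fB B(1)] by blast
      note s = strongly_tame_sets[OF B'(1) c2]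
      consider "\<not> ?l1" "\<not> ?l2" | "?l1" "\<not> ?l2" | "\<not> ?l1" "?l2" | "?l1" "?l2" by blast
      then show ?thesis
      proof cases
        case 1
        then have "dg ?J B = dg J B" using dg'[of B] by (auto simp: of_bool_def split: if_splits)
        then show ?thesis using t sm' by simp
      next
        case 2
        then have "dg ?J B + 2 = dg J B" using dg'[of B] by (auto simp: of_bool_def split: if_splits)
        then show ?thesis using tame_deg_pred2[OF s] sm'(4) by simp
      next
        case 3
        then have "dg ?J B + 2 = dg J B" using dg'[of B] by (auto simp: of_bool_def split: if_splits)
        then show ?thesis using tame_deg_pred2[OF s] sm'(4) by simp
      next
        case 4
        then have d: "dg ?J B + 4 = dg J B" using dg'[of B] by (auto simp: of_bool_def split: if_splits)
        \<comment> \<open>All edges at \<open>y\<close> end in \<open>B\<close>, so after lifting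
          \<open>B\<close> has the degree that \<open>insert y B\<close> has in \<open>J\<close>,
          and both have the same boundary mod 3.\<close>
        have "ecut J B \<inter> ecut J {y} = {e1, e2, e3, e4}" using 4 ey by auto
        then have "card (ecut J B \<inter> ecut J {y}) = 4" using dist by simp
        then have "dg J (insert y B) = dg ?J B" using dg_insert[OF B'(2)] d y(2) by simp
        moreover have "tame_deg (dg J (insert y B)) (bsum J (insert y B))" using tame_sets[of "insert y B"] B' y by auto
        moreover have "bsum J (insert y B) mod 3 = bsum J B mod 3"
        proof -
          have "bsum J (insert y B) = bd J y + bsum J B" using fB B'(2) by (simp add: bsum_def)
          then show ?thesis using y(3) by (metis add_0 mod_add_left_eq)
        qed
        ultimately show ?thesis using tame_deg_cong sm' by metis
      qed
    qed
  qed
  obtain X where X: "x \<in> X" "X \<subseteq> vt ?J - {z}" "X \<noteq> vt ?J - {z}" "\<not> tallp ?J z X"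
    using smaller_extends[OF vl meas _ tmB] \<open>\<not> ext ?J z\<close> x y sm'(1) by blast
  have X': "X \<subseteq> vt J - {y, z}" "X \<noteq> vt J - {y, z}" "y \<notin> X" using X sm' by auto
  have dz: "dg ?J {z} \<le> dg J {z}" using dg'[of "{z}"] by simp
  show ?thesis
  proof (cases "X = {x}")
    case True
    have "\<not> (e1 \<in> ecut J {x} \<and> e2 \<in> ecut J {x})" "\<not> (e3 \<in> ecut J {x} \<and> e4 \<in> ecut J {x})"
      using nodup[of x e1 e2] nodup[of x e3 e4] x y ey dist by auto
    \<comment> \<open>There are no parallel edges between \<open>x\<close> and \<open>y\<close>, so
      no pair costs \<open>x\<close> any degree.\<close>
    then have dx: "dg ?J {x} = dg J {x}" using dg'[of "{x}"] by (auto simp: of_bool_def split: if_splits)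
    then have "dg ?J {z} = dg J {x} + 2" "dg J {z} = dg J {x} + 2" "\<not> both_dirs ?J z {x}"
      using X(4) True dz tall_le by (auto simp: tallp_both_dirs)
    then show ?thesis using that[of X] True X' X by blast
  next
    case False
    have geX: "dg J {x} + 2 \<le> dg J X" using x_cut_cases[of X] X' X False y by auto
    have "insert y X \<noteq> {x}" using X' y by auto
    moreover have "insert y X \<noteq> vt J - {z}" using X' by auto
    ultimately have geXy: "dg J {x} + 2 \<le> dg J (insert y X)" using x_cut_cases[of "insert y X"] X X' y by auto
    let ?T = "ecut J X \<inter> ecut J {y}"
    have ct: "dg J (insert y X) + 2 * card ?T = dg J X + 4" using dg_insert[OF X'(3)] y by simp
    have nt: "dg ?J X + 2 \<le> dg ?J {z}" "dg ?J {z} = dg ?J X + 2 \<Longrightarrow> \<not> both_dirs ?J z X"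
      using X(4) by (auto simp: tallp_both_dirs)
    have up: "dg ?J X \<le> dg J {x}" using nt(1) dz tall_le by simp
    let ?l1 = "e1 \<in> ecut J X \<and> e2 \<in> ecut J X" and ?l2 = "e3 \<in> ecut J X \<and> e4 \<in> ecut J X"
    have "?l1 \<or> ?l2" using dg'[of X] geX up by (auto simp: of_bool_def split: if_splits)
    \<comment> \<open>With three or four edges between \<open>y\<close> and \<open>X\<close>, the
      degree of \<open>insert y X\<close> would be at most d(x), against
      \<open>geXy\<close>.\<close>
    have sub: "card ?T \<le> 2"
    proof (rule ccontr)
      assume n: "\<not> card ?T \<le> 2"
      have "card ?T \<le> card {e1, e2, e3, e4}" using ey by (intro card_mono) auto
      moreover have "card {e1, e2, e3, e4} = 4" using dist by simp
      ultimately have c34: "card ?T = 3 \<or> card ?T = 4" using n by linarith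
      then show False
      proof
        assume c3: "card ?T = 3"
        have "\<not> (?l1 \<and> ?l2)"
        proof
          assume "?l1 \<and> ?l2"
          then have "?T = {e1, e2, e3, e4}" using ey by auto
          then show False using c3 dist by simp
        qed
        then have "dg J X \<le> dg ?J X + 2" using dg'[of X] by (auto simp: of_bool_def split: if_splits)
        then show False using c3 ct geXy up by simp
      next
        assume c4: "card ?T = 4"
        have "dg J X \<le> dg ?J X + 4" using dg'[of X] by (auto simp: of_bool_def split: if_splits)
        then show False using c4 ct geXy up by simp
      qed
    qed
    have T: "?T = {e1, e2} \<or> ?T = {e3, e4}"
    proof -
      have fT: "finite ?T" by simp
      from \<open>?l1 \<or> ?l2\<close> show ?thesis
      proof
        assume l: "?l1"
        then have "{e1, e2} \<subseteq> ?T" using ey by auto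
        moreover have "card {e1, e2} = 2" using dist by simp
        ultimately have "{e1, e2} = ?T" using sub fT by (metis card_seteq)
        then show ?thesis by simp
      next
        assume l: "?l2"
        then have "{e3, e4} \<subseteq> ?T" using ey by auto
        moreover have "card {e3, e4} = 2" using dist by simp
        ultimately have "{e3, e4} = ?T" using sub fT by (metis card_seteq)
        then show ?thesis by simp
      qed
    qed
    have "\<not> (?l1 \<and> ?l2)"
    proof
      assume "?l1 \<and> ?l2"
      then have "{e1, e2, e3, e4} \<subseteq> ?T" using ey by auto
      then show False using T dist by auto
    qed
    then have "dg J X \<le> dg ?J X + 2" using dg'[of X] by (auto simp: of_bool_def split: if_splits)
    then have "dg ?J {z} = dg J {x} + 2" "dg J {z} = dg J {x} + 2" "dg J X = dg J {x} + 2" "\<not> both_dirs ?J z X"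
      using geX up nt dz tall_le by auto
    then show ?thesis using that[of X] T X' X by blast
  qed
qed

text \<open>The end of \<open>e\<close> other than \<open>z\<close> lies in
  \<open>X \<inter> Y\<close> and is not \<open>x\<close>, so d(X \<inter> Y) \<ge> d(x) + 2. Adding
  \<open>y\<close> to \<open>X \<union> Y\<close> lowers the degree by 2, so d(X \<union> Y) \<ge>
  d(x) + 4. By submodularity the sum is at most 2d(x) + 4, a contradiction.\<close>

lemma tight_clash:
  assumes y: "y \<in> vt J - {x, z}" "dg J {y} = 4" and dz: "dg J {z} = dg J {x} + 2"
    and X: "x \<in> X" "X \<subseteq> vt J - {y, z}" "dg J X = dg J {x} + 2"
    and Y: "x \<in> Y" "Y \<subseteq> vt J - {y, z}" "dg J Y = dg J {x} + 2"
    and e: "e \<in> ecut J {z}" "e \<notin> ecut J {x}" "e \<in> ecut J X" "e \<in> ecut J Y"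
    and T: "card ((ecut J X \<inter> ecut J {y}) \<union> (ecut J Y \<inter> ecut J {y})) = 3"
  shows False
proof -
  have yn: "y \<notin> X" "y \<notin> Y" using X Y by auto
  have "X \<inter> Y \<noteq> {x}"
  proof
    assume "X \<inter> Y = {x}"
    then show False using e X Y x by (auto simp: ecut_iff)
  qed
  then have 1: "dg J {x} + 2 \<le> dg J (X \<inter> Y)"
    using x_cut_cases[of "X \<inter> Y"] X Y y by auto
  let ?U = "X \<union> Y"
  have "ecut J ?U \<inter> ecut J {y} = (ecut J X \<inter> ecut J {y}) \<union> (ecut J Y \<inter> ecut J {y})"
    using ecut_Un_at[OF yn, of J] by (simp add: Int_Un_distrib2)
  then have "dg J (insert y ?U) + 6 = dg J ?U + 4" using dg_insert[of y ?U] yn y T by simp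
  moreover have "dg J {x} + 2 \<le> dg J (insert y ?U)"
  proof -
    have "insert y ?U \<subseteq> vt J - {z}" "insert y ?U \<noteq> {x}" using X Y y by auto
    then show ?thesis using x_cut_cases[of "insert y ?U"] X dg_vz dz by auto
  qed
  moreover have "dg J (X \<inter> Y) + dg J ?U \<le> dg J X + dg J Y" by (rule dg_submodular) simp
  ultimately show False using 1 X Y by simp
qed

end

lemma card_union_pairs:
  assumes "distinct [a, b, c, d]" "S = {a, b} \<or> S = {c, d}" "T = {a, c} \<or> T = {b, d}"
  shows "card (S \<union> T) = 3"
  using assms by (auto simp: card_insert_if)

lemma card4_split:
  assumes "card S = 4" "a \<in> S" "b \<in> S" "a \<noteq> b"
  obtains c d where "S = {a, b, c, d}" "distinct [a, b, c, d]"
proof -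
  have "finite S" using assms(1) card.infinite by fastforce
  then have "card (S - {a, b}) = 2" using assms by (simp add: card_Diff_subset)
  then obtain c d where cd: "S - {a, b} = {c, d}" "c \<noteq> d" by (auto simp: card_2_iff)
  then have "S = {a, b, c, d}" "distinct [a, b, c, d]" using assms by auto
  then show ?thesis using that by blast
qed

context critical
begin

lemma pre_sign: "e \<in> ed J \<Longrightarrow> pre J e = 1 \<or> pre J e = -1"
  using val by (auto simp: valid_def)

lemma zdir_cases:
  assumes "e \<in> ecut J {v}"
  shows "pre J e * chi J e {v} = 1 \<or> pre J e * chi J e {v} = -1"
  using assms pre_sign[of e] chi_cases[of J e "{v}"] by (auto simp: ecut_def)

lemma other_end:
  assumes "e \<in> ecut J {v}"
  obtains w where "w \<in> vt J" "w \<noteq> v" "e \<in> ecut J {w}"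
proof -
  have "e \<in> ed J" "src J e \<noteq> tgt J e" using ecut_ends[OF assms] by auto
  then have "src J e \<in> vt J" "tgt J e \<in> vt J" using val by (auto simp: valid_def)
  then show ?thesis using assms that[of "src J e"] that[of "tgt J e"] by (auto simp: ecut_iff)
qed

text \<open>If neither \<open>ep\<close> nor \<open>en\<close> crossed \<open>X\<close>, both would
  remain tip edges that avoid \<open>X\<close>, with their directions kept. As both avoid
  \<open>x\<close>, this also rules out \<open>X = {x}\<close>. The assumption \<open>ax\<close>
  prevents the lifted edge \<open>a\<close> from joining \<open>z\<close> to
  \<open>x\<close>.\<close>

lemma zero_pair_bad:
  assumes y: "y \<in> vt J - {x, z}" "dg J {y} = 4" "bd J y mod 3 = 0"
    and ey: "ecut J {y} = {a, b, c, d}" and dist: "distinct [a, b, c, d]"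
    and nz: "b \<notin> ecut J {z}" "c \<notin> ecut J {z}" "d \<notin> ecut J {z}"
    and ax: "a \<in> ecut J {z} \<Longrightarrow> b \<notin> ecut J {x}"
    and ep: "ep \<in> ecut J {z} - ecut J {x}" "pre J ep * chi J ep {z} = 1"
    and en: "en \<in> ecut J {z} - ecut J {x}" "pre J en * chi J en {z} = -1"
  shows "\<exists>X. x \<in> X \<and> X \<subseteq> vt J - {y, z} \<and> dg J X = dg J {x} + 2 \<and>
    (ecut J X \<inter> ecut J {y} = {a, b} \<or> ecut J X \<inter> ecut J {y} = {c, d}) \<and>
    (ep \<in> ecut J X \<or> en \<in> ecut J X)"
proof -
  have yV: "y \<in> vt J" "y \<noteq> z" using y by auto
  have l: "liftable J z y a b" "liftable J z y c d"
    using ey dist nz yV by (auto simp: liftable_def)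
  let ?J = "lift_pairs J y a b c d"
  obtain X where X: "x \<in> X" "X \<subseteq> vt J - {y, z}" "\<not> both_dirs ?J z X"
    "X = {x} \<or> (dg J X = dg J {x} + 2 \<and>
        (ecut J X \<inter> ecut J {y} = {a, b} \<or> ecut J X \<inter> ecut J {y} = {c, d}))"
    by (rule zero_pairing[OF y ey dist l])
  note ec = lift_pairs_ecut[OF val yV(1) y(3) ey dist l]
  have aX: "a \<notin> ecut J X" if "a \<in> ecut J {z}"
    using ecut_two_ends[of a J y z X] that ey yV X(2) by auto
  have bX: "b \<notin> ecut J X" if "a \<in> ecut J {z}"
  proof (cases "X = {x}")
    case True
    then show ?thesis using ax that by simp
  next
    case False
    then have "ecut J X \<inter> ecut J {y} = {c, d}" using X(4) aX[OF that] by auto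
    then show ?thesis using ey dist by auto
  qed
  have keep: "e \<in> ecut ?J {z} - ecut ?J X \<and> pre ?J e * chi ?J e {z} = pre J e * chi J e {z}"
    if e: "e \<in> ecut J {z}" "e \<notin> ecut J X" for e
  proof -
    have "chi ?J e {z} = chi J e {z}"
      using nz by (intro lift_pairs_chi[OF val yV(1) y(3) ey dist l]) auto
    moreover have "e \<in> ecut ?J {z} - ecut ?J X"
    proof (cases "e \<in> {a, b, c, d}")
      case True
      then have "e = a" using e nz by auto
      then show ?thesis using e nz aX bX dist unfolding ec by auto
    next
      case False
      then show ?thesis using e unfolding ec by auto
    qed
    ultimately show ?thesis using lift_pairs_simps[OF val yV(1) y(3) ey dist l] by simp
  qed
  have "ep \<in> ecut J X \<or> en \<in> ecut J X"
  proof (rule ccontr)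
    assume "\<not> ?thesis"
    then have n: "ep \<notin> ecut J X" "en \<notin> ecut J X" by simp_all
    have "ep \<in> ecut J {z}" "en \<in> ecut J {z}" using ep en by blast+
    note k = keep[OF this(1) n(1)] keep[OF this(2) n(2)]
    have "pre ?J ep * chi ?J ep {z} = 1" using k(1) ep(2) by (simp only:)
    moreover have "pre ?J en * chi ?J en {z} = -1" using k(2) en(2) by (simp only:)
    ultimately have "both_dirs ?J z X" using k unfolding both_dirs_def by blast
    then show False using X(3) by simp
  qed
  then show ?thesis using X ep en by auto
qed

lemma zero_clash:
  assumes y: "y \<in> vt J - {x, z}" "dg J {y} = 4"
    and dz: "dg J {z} = dg J {x} + 2" and dist: "distinct [a, b, c, d]"
    and e: "e \<in> ecut J {z} - ecut J {x}"
    and X: "x \<in> X \<and> X \<subseteq> vt J - {y, z} \<and> dg J X = dg J {x} + 2 \<and>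
      (ecut J X \<inter> ecut J {y} = {a, b} \<or> ecut J X \<inter> ecut J {y} = {c, d})" "e \<in> ecut J X"
    and Y: "x \<in> Y \<and> Y \<subseteq> vt J - {y, z} \<and> dg J Y = dg J {x} + 2 \<and>
      (ecut J Y \<inter> ecut J {y} = {a, c} \<or> ecut J Y \<inter> ecut J {y} = {b, d})" "e \<in> ecut J Y"
  shows False
proof (rule tight_clash[OF y dz, of X Y e])
  show "card ((ecut J X \<inter> ecut J {y}) \<union> (ecut J Y \<inter> ecut J {y})) = 3"
    using X(1) Y(1) by (intro card_union_pairs[OF dist]) simp_all
qed (use X Y e in simp_all)

text \<open>Two tip edges of opposite directions at \<open>y\<close> could be lifted to a loop at
  \<open>z\<close>. This lowers the degree of the tip by 2, whereas \<open>zero_pairing\<close>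
  shows that the degree stays d(x) + 2.\<close>

lemma zero_same_dir:
  assumes y: "y \<in> vt J - {x, z}" "dg J {y} = 4" "bd J y mod 3 = 0"
    and a: "a \<in> ecut J {z}" "a \<in> ecut J {y}" and b: "b \<in> ecut J {z}" "b \<in> ecut J {y}"
  shows "pre J a * chi J a {z} = pre J b * chi J b {z}" and "card (ecut J {z} \<inter> ecut J {y}) \<le> 2"
proof -
  let ?K = "ecut J {z} \<inter> ecut J {y}"
  have yV: "y \<in> vt J" "y \<noteq> z" using y by auto
  have c4: "card (ecut J {y}) = 4" using y by (simp add: dg_def)
  have kf: "dg J {y, z} + 2 * card ?K = dg J {z} + 4" using dg_insert[of y "{z}"] yV y by simp
  have yz: "dg J {y, z} = dg J (vt J - {y, z})" using dg_compl[OF val, of "{y, z}"] yV zV by simp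
  have K: "dg J {x} + 2 \<le> dg J {y, z} \<or> vt J - {y, z} = {x}"
    using x_cut_cases[of "vt J - {y, z}"] x y unfolding yz by auto
  have K1: "dg J {x} \<le> dg J {y, z}"
    using K
  proof
    assume "vt J - {y, z} = {x}"
    then show ?thesis unfolding yz by simp
  qed simp
  have k3: "card ?K \<le> 3" using K1 kf tall_le by simp
  have same: "pre J a * chi J a {z} = pre J b * chi J b {z}" if a: "a \<in> ?K" and b: "b \<in> ?K" for a b
  proof (rule ccontr)
    assume ne: "pre J a * chi J a {z} \<noteq> pre J b * chi J b {z}"
    then have "a \<noteq> b" by auto
    then obtain c d where cd: "ecut J {y} = {a, b, c, d}" "distinct [a, b, c, d]"
      using card4_split[OF c4, of a b] a b by blast
    have "\<not> (c \<in> ?K \<and> d \<in> ?K)"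
    proof
      assume "c \<in> ?K \<and> d \<in> ?K"
      then have "{a, b, c, d} \<subseteq> ?K" using a b by auto
      then have "card {a, b, c, d} \<le> card ?K" by (intro card_mono) auto
      then show False using k3 cd(2) by simp
    qed
    \<comment> \<open>The second edge of a pair gives up its name, so \<open>d'\<close> must not be
      a tip edge.\<close>
    then have "\<exists>c' d'. ecut J {y} = {a, b, c', d'} \<and> distinct [a, b, c', d'] \<and> d' \<notin> ?K"
    proof (cases "d \<in> ?K")
      case True
      then have "c \<notin> ?K" "ecut J {y} = {a, b, d, c}" "distinct [a, b, d, c]"
        using cd \<open>\<not> (c \<in> ?K \<and> d \<in> ?K)\<close> by auto
      then show ?thesis by blast
    next
      case False
      then show ?thesis using cd by blast
    qed
    then obtain c' d' where cd': "ecut J {y} = {a, b, c', d'}" "distinct [a, b, c', d']" "d' \<notin> ?K"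
      by blast
    have "pre J b * chi J b {z} = - (pre J a * chi J a {z})"
      using ne zdir_cases[of a z] zdir_cases[of b z] a b by auto
    then have "pre J b * chi J b {y} = - (pre J a * chi J a {y})"
      using chi_opp[of a J z y] chi_opp[of b J z y] a b yV by auto
    then have l: "liftable J z y a b" "liftable J z y c' d'"
      using a b cd' yV by (auto simp: liftable_def)
    obtain X where "dg J {z} = dg J {x} + 2" "dg (lift_pairs J y a b c' d') {z} = dg J {x} + 2"
      by (rule zero_pairing[OF y cd'(1,2) l])
    then show False using lift_pairs_dg[OF val yV(1) y(3) cd'(1,2) l, of "{z}"] a b by simp
  qed
  show "pre J a * chi J a {z} = pre J b * chi J b {z}" by (rule same) (use a b in simp_all)
  \<comment> \<open>Three such edges leave no vertices but \<open>x\<close>, \<open>y\<close> and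
    \<open>z\<close>. Then every tip edge ends at \<open>y\<close>, and the two directions required
    in the border case contradict \<open>same\<close>.\<close>
  have "card ?K \<noteq> 3"
  proof
    assume k: "card ?K = 3"
    then have dz: "dg J {z} = dg J {x} + 2" "\<not> dg J {x} + 2 \<le> dg J {y, z}"
      using K1 kf tall_le by linarith+
    then have V: "vt J - {y, z} = {x}" using K by blast
    have "both_dirs J z {x}" using tall dz by (simp add: tallp_both_dirs)
    then obtain ep en where e: "ep \<in> ecut J {z} - ecut J {x}" "pre J ep * chi J ep {z} = 1"
       "en \<in> ecut J {z} - ecut J {x}" "pre J en * chi J en {z} = -1" by (auto simp: both_dirs_def)
    have "e \<in> ecut J {y}" if e': "e \<in> ecut J {z}" "e \<notin> ecut J {x}" for e
    proof -
      obtain w where w: "w \<in> vt J" "w \<noteq> z" "e \<in> ecut J {w}" by (rule other_end[OF e'(1)])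
      then have "w \<noteq> x" using e' by blast
      then have "w = y" using w V by blast
      then show ?thesis using w by simp
    qed
    then have "ep \<in> ?K" "en \<in> ?K" using e(1,3) by blast+
    from same[OF this] show False using e(2,4) by simp
  qed
  then show "card ?K \<le> 2" using k3 by simp
qed

text \<open>With at most one tip edge at \<open>y\<close>, pigeonhole decides: each pairing yields a
  tight set crossed by \<open>ep\<close> or \<open>en\<close>, and there are more pairings than
  edges available to cross them. Two tight sets crossed by the same edge are excluded by
  \<open>zero_clash\<close>.\<close>

lemma no_degree_four:
  assumes y: "y \<in> vt J - {x, z}" "dg J {y} = 4" "bd J y mod 3 = 0"
  shows False
proof -
  let ?K = "ecut J {z} \<inter> ecut J {y}"
  have yV: "y \<in> vt J" "y \<noteq> z" using y by auto
  have c4: "card (ecut J {y}) = 4" using y by (simp add: dg_def)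
  have nodup: "\<not> (a \<in> ecut J {x} \<and> b \<in> ecut J {x})" if "a \<in> ecut J {y}" "b \<in> ecut J {y}" "a \<noteq> b" for a b
    using parallel_eq[of x y a b] that x y by auto
  have both_dirs: "both_dirs J z {x}" if "dg J {z} = dg J {x} + 2" using tall that by (simp add: tallp_both_dirs)
  have k2: "card ?K \<le> 2"
  proof (cases "?K = {}")
    case False
    then show ?thesis using zero_same_dir(2)[OF y] by blast
  qed simp
  show False
  proof (cases "card ?K = 2")
    case True
    then obtain a b where ab: "?K = {a, b}" "a \<noteq> b" by (auto simp: card_2_iff)
    then have abK: "a \<in> ?K" "b \<in> ?K" by auto
    obtain c d where ey': "ecut J {y} = {a, b, c, d}" and dist': "distinct [a, b, c, d]"
      using card4_split[OF c4, of a b] abK ab by blast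
    have ey: "ecut J {y} = {a, c, b, d}" and dist: "distinct [a, c, b, d]" using ey' dist' by auto
    have nz: "c \<notin> ecut J {z}" "d \<notin> ecut J {z}" using ab ey dist by auto
    have l: "liftable J z y a c" "liftable J z y b d"
      using ey dist nz yV by (auto simp: liftable_def)
    let ?J = "lift_pairs J y a c b d"
    obtain X where X: "dg J {z} = dg J {x} + 2" "X \<subseteq> vt J - {y, z}" "\<not> both_dirs ?J z X"
      "X = {x} \<or> (dg J X = dg J {x} + 2 \<and>
        (ecut J X \<inter> ecut J {y} = {a, c} \<or> ecut J X \<inter> ecut J {y} = {b, d}))"
      by (rule zero_pairing[OF y ey dist l])
    \<comment> \<open>The two tip edges are in different pairs, and each has both ends outside
      \<open>X\<close>. So neither pair can be the trace of \<open>X\<close> at \<open>y\<close>,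
      which leaves \<open>X = {x}\<close>.\<close>
    have "a \<notin> ecut J X" "b \<notin> ecut J X" using ecut_two_ends[of _ J y z X] abK X(2) yV by auto
    then have Xx: "X = {x}" using X(4) by auto
    note ec = lift_pairs_ecut[OF val yV(1) y(3) ey dist l]
    note pr = lift_pairs_simps(3)[OF val yV(1) y(3) ey dist l]
    have chi': "chi ?J e {z} = chi J e {z}" for e
      using nz by (intro lift_pairs_chi[OF val yV(1) y(3) ey dist l]) auto
    obtain ep en where e: "ep \<in> ecut J {z} - ecut J {x}" "pre J ep * chi J ep {z} = 1"
       "en \<in> ecut J {z} - ecut J {x}" "pre J en * chi J en {z} = -1" using both_dirs X(1) by (auto simp: both_dirs_def)
    have same: "pre J a * chi J a {z} = pre J b * chi J b {z}"
      by (rule zero_same_dir(1)[OF y]) (use abK in simp_all)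
    have ax: "a \<notin> ecut J {x}" "b \<notin> ecut J {x}" using no_zx abK by auto
    \<comment> \<open>At most one of \<open>c\<close> and \<open>d\<close> ends at \<open>x\<close>,
      so one of the lifted tip edges avoids \<open>x\<close>. It replaces \<open>a\<close> as well
      as \<open>b\<close>, because both have the same direction.\<close>
    have abJ: "\<exists>e\<in>{a, b}. e \<in> ecut ?J {z} - ecut ?J {x}"
    proof (cases "c \<in> ecut J {x}")
      case False
      then show ?thesis using abK nz ax dist unfolding ec by auto
    next
      case True
      then have "d \<notin> ecut J {x}" using nodup[of c d] ey dist by auto
      then show ?thesis using abK nz ax dist unfolding ec by auto
    qed
    have found: "\<exists>e\<in>ecut ?J {z} - ecut ?J {x}. pre ?J e * chi ?J e {z} = s"
      if f: "f \<in> ecut J {z} - ecut J {x}" "pre J f * chi J f {z} = s" for f s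
    proof (cases "f \<in> {a, b, c, d}")
      case True
      then have "f = a \<or> f = b" using f nz by auto
      then have "\<forall>e\<in>{a, b}. pre J e * chi J e {z} = s" using same f(2) by (elim disjE) (simp_all only: ball_simps simp_thms)
      then show ?thesis using abJ unfolding pr chi' by blast
    next
      case False
      then have "f \<in> ecut ?J {z} - ecut ?J {x}" using f unfolding ec by auto
      then show ?thesis using f(2) unfolding pr chi' by blast
    qed
    have "both_dirs ?J z {x}" unfolding both_dirs_def using found e by blast
    then show False using X(3) Xx by simp
  next
    case False
    then have k1: "card ?K \<le> 1" using k2 by simp
    have "\<exists>a\<in>ecut J {y}. ?K \<subseteq> {a}"
    proof (cases "?K = {}")
      case True
      moreover have "ecut J {y} \<noteq> {}" using c4 by auto
      ultimately show ?thesis by auto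
    next
      case False
      then have "card ?K = 1" using k1 by (metis card_0_eq fin(2) finite_Int finite_ecut le_antisym less_one linorder_not_less)
      then obtain a where "?K = {a}" by (auto simp: card_1_singleton_iff)
      then show ?thesis by blast
    qed
    then obtain a where a: "a \<in> ecut J {y}" "?K \<subseteq> {a}" by blast
    have "ecut J {y} \<noteq> {a}" using c4 by auto
    then obtain b where b: "b \<in> ecut J {y}" "b \<noteq> a" using a by blast
    obtain c d where ey: "ecut J {y} = {a, b, c, d}" and dist: "distinct [a, b, c, d]"
      using card4_split[OF c4 a(1) b(1)] b by blast
    have nz: "b \<notin> ecut J {z}" "c \<notin> ecut J {z}" "d \<notin> ecut J {z}" using a ey dist by auto
    have "liftable J z y a b" "liftable J z y c d"
      using ey dist nz yV by (auto simp: liftable_def)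
    then have dz: "dg J {z} = dg J {x} + 2" using zero_pairing[OF y ey dist] by blast
    obtain ep0 en0 where e0: "ep0 \<in> ecut J {z} - ecut J {x}" "pre J ep0 * chi J ep0 {z} = 1"
       "en0 \<in> ecut J {z} - ecut J {x}" "pre J en0 * chi J en0 {z} = -1" using both_dirs dz by (auto simp: both_dirs_def)
    \<comment> \<open>A tip edge \<open>a\<close> is made one of the two witnesses: it crosses none
      of the sets \<open>X\<close>, so every tight set is then crossed by the other witness.\<close>
    have ex: "\<exists>ep en. ep \<in> ecut J {z} - ecut J {x} \<and> pre J ep * chi J ep {z} = 1 \<and>
       en \<in> ecut J {z} - ecut J {x} \<and> pre J en * chi J en {z} = -1 \<and> (a \<in> ecut J {z} \<longrightarrow> a = ep \<or> a = en)"
    proof (cases "a \<in> ecut J {z}")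
      case True
      then have "a \<in> ecut J {z} - ecut J {x}" using no_zx by auto
      then show ?thesis using e0 zdir_cases[OF True] by blast
    next
      case False
      then show ?thesis using e0 by blast
    qed
    then obtain ep en where ep: "ep \<in> ecut J {z} - ecut J {x}" "pre J ep * chi J ep {z} = 1"
      and en: "en \<in> ecut J {z} - ecut J {x}" "pre J en * chi J en {z} = -1"
      and ae: "a \<in> ecut J {z} \<Longrightarrow> a = ep \<or> a = en" by blast
    have aX: "a \<notin> ecut J X" if "a \<in> ecut J {z}" "X \<subseteq> vt J - {y, z}" for X
      using ecut_two_ends[of a J y z X] that a yV by auto
    define G where "G p q r X \<longleftrightarrow> x \<in> X \<and> X \<subseteq> vt J - {y, z} \<and> dg J X = dg J {x} + 2 \<and>
      (ecut J X \<inter> ecut J {y} = {a, p} \<or> ecut J X \<inter> ecut J {y} = {q, r})" for p q r X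
    have Gc: "G p q r X \<longleftrightarrow> G p r q X" for p q r X by (auto simp: G_def insert_commute)
    have clash: False if "G p q r X" "G q p r Y" "distinct [a, p, q, r]" "e = ep \<or> e = en" "e \<in> ecut J X" "e \<in> ecut J Y"
      for p q r X Y e
    proof -
      have "e \<in> ecut J {z} - ecut J {x}" using that(4) ep(1) en(1) by blast
      then show False using zero_clash[OF y(1,2) dz that(3) _ that(1)[unfolded G_def] that(5) that(2)[unfolded G_def] that(6)]
        by blast
    qed
    have bad: "\<exists>X. G p q r X \<and> (ep \<in> ecut J X \<or> en \<in> ecut J X)"
      if "ecut J {y} = {a, p, q, r}" "distinct [a, p, q, r]" "a \<in> ecut J {z} \<Longrightarrow> p \<notin> ecut J {x}" for p q r
    proof -
      have "p \<notin> ecut J {z}" "q \<notin> ecut J {z}" "r \<notin> ecut J {z}" using that a by auto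
      from zero_pair_bad[OF y that(1,2) this that(3) ep en] show ?thesis unfolding G_def by simp
    qed
    \<comment> \<open>Only one witness is left to cross the tight sets, so two pairings suffice. In
      both of them the partner of \<open>a\<close> must not end at \<open>x\<close>.\<close>
    have bad2: False if P: "ecut J {y} = {a, p, q, r}" "distinct [a, p, q, r]" and a: "a \<in> ecut J {z}"
      and px: "p \<notin> ecut J {x}" "q \<notin> ecut J {x}" for p q r
    proof -
      obtain X where X: "G p q r X" "ep \<in> ecut J X \<or> en \<in> ecut J X" using bad[OF P] px by blast
      have P': "ecut J {y} = {a, q, p, r}" "distinct [a, q, p, r]" using P by auto
      obtain Y where Y: "G q p r Y" "ep \<in> ecut J Y \<or> en \<in> ecut J Y" using bad[OF P'] px by blast
      have "a \<notin> ecut J X" "a \<notin> ecut J Y" using aX[OF a] X(1) Y(1) by (auto simp: G_def)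
      then show False using ae[OF a] X Y clash[OF X(1) Y(1) P(2), of ep] clash[OF X(1) Y(1) P(2), of en] by auto
    qed
    have ey2: "ecut J {y} = {a, b, d, c}" "ecut J {y} = {a, c, d, b}" "ecut J {y} = {a, c, b, d}" "ecut J {y} = {a, d, b, c}"
      and dist2: "distinct [a, b, d, c]" "distinct [a, c, d, b]" "distinct [a, c, b, d]" "distinct [a, d, b, c]"
      using ey dist by auto
    show False
    proof (cases "a \<in> ecut J {z}")
      case True
      consider "b \<notin> ecut J {x}" "c \<notin> ecut J {x}" | "b \<notin> ecut J {x}" "d \<notin> ecut J {x}" | "c \<notin> ecut J {x}" "d \<notin> ecut J {x}"
        using nodup[of b c] nodup[of b d] nodup[of c d] ey dist by auto
      then show False
        using bad2[OF ey dist True] bad2[OF ey2(1) dist2(1) True] bad2[OF ey2(2) dist2(2) True] by cases blast+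
    next
      case False
      obtain X where X: "G b c d X" "ep \<in> ecut J X \<or> en \<in> ecut J X" using bad[OF ey dist] False by blast
      obtain Y where Y: "G c b d Y" "ep \<in> ecut J Y \<or> en \<in> ecut J Y" using bad[OF ey2(3) dist2(3)] False by blast
      obtain W where W: "G d b c W" "ep \<in> ecut J W \<or> en \<in> ecut J W" using bad[OF ey2(4) dist2(4)] False by blast
      have W': "G d c b W" using W Gc by blast
      have X': "G b d c X" using X Gc by blast
      have Y': "G c d b Y" using Y Gc by blast
      show False using X(2) Y(2) W(2)
        clash[OF X(1) Y(1) dist] clash[OF X' W(1) dist2(1)] clash[OF Y' W' dist2(2)] by blast
    qed
  qed
qed

end

subsection \<open>The signs of the vertices\<close>

text \<open>At degree 6 at most one of the two shifts makes the boundary zero; at degree 5 the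
  boundary is nonzero and exactly one shift makes it zero.\<close>

lemma tame_deg_ok:
  assumes "tame_deg d b" "\<not> (d = 4 \<and> b mod 3 = 0)"
  shows "tame_deg (d - 1) (b - 1) \<or> tame_deg (d - 1) (b - - 1)"
proof -
  consider "7 \<le> d" | "d = 6" | "d = 5" "b mod 3 \<noteq> 0" using assms unfolding tame_deg_def by linarith
  then show ?thesis
  proof cases
    case 1
    then have "6 \<le> d - 1" by linarith
    then show ?thesis unfolding tame_deg_def by blast
  next
    case 2
    have "(b - 1) mod 3 \<noteq> 0 \<or> (b - - 1) mod 3 \<noteq> 0" by presburger
    then show ?thesis using 2 by (auto simp: tame_deg_def)
  next
    case 3
    then have "(b - 1) mod 3 = 0 \<or> (b - - 1) mod 3 = 0" by presburger
    then show ?thesis using 3 by (auto simp: tame_deg_def)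
  qed
qed

text \<open>From degree 7 on both signs are tolerated, so a single sign pins the vertex down to two
  types.\<close>

lemma tame_deg_one_sign:
  assumes "tame_deg (d - 1) (b - c)" "\<not> tame_deg (d - 1) (b - - c)"
  shows "(d = 5 \<and> (b - c) mod 3 = 0) \<or> (d = 6 \<and> (b + c) mod 3 = 0)"
proof -
  have "(b - - c) mod 3 = (b + c) mod 3" by simp
  then show ?thesis using assms unfolding tame_deg_def by linarith
qed

text \<open>For \<open>c = 1\<close> all edges at \<open>v\<close> are directed into
  \<open>v\<close>, for \<open>c = -1\<close> out of it; one formula covers sinks and
  sources.\<close>

definition sink :: "('v, 'e) rgraph \<Rightarrow> 'v \<Rightarrow> int \<Rightarrow> ('v, 'e) rgraph" where
  "sink J v c = del_vert (del_edges J (ecut J {v}) (\<lambda>e. - c * chi J e {v})) v"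

context
  fixes J :: "('v, 'e) rgraph" and z v :: 'v and c :: int
  assumes val: "valid J z" and v: "v \<in> vt J" "v \<noteq> z" and c: "c = 1 \<or> c = -1"
    and dir: "\<forall>e\<in>ecut J {v} \<inter> ecut J {z}. pre J e * chi J e {v} = - c"
    and bal: "(bd J v + c * int (dg J {v})) mod 3 = 0"
begin

lemma sink_fin: "finite (ed J)" using val by (simp add: valid_def)

lemma sink_chi: "e \<in> ecut J {v} \<Longrightarrow> chi J e {v} * chi J e {v} = 1"
  using chi_cases[of J e "{v}"] by (auto simp: ecut_def)

lemma sink_pre: "e \<in> ecut J {v} \<inter> ecut J {z} \<Longrightarrow> - c * chi J e {v} = pre J e"
proof -
  assume e: "e \<in> ecut J {v} \<inter> ecut J {z}"
  then have "pre J e * chi J e {v} = - c" "chi J e {v} \<noteq> 0" using dir by (simp_all add: ecut_def)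
  then show ?thesis using chi_cases[of J e "{v}"] by auto
qed

lemma sink_bal: "bd (del_edges J (ecut J {v}) (\<lambda>e. - c * chi J e {v})) v mod 3 = 0"
proof -
  have "(\<Sum>e\<in>ecut J {v}. - c * chi J e {v} * chi J e {v}) = (\<Sum>e\<in>ecut J {v}. - c)"
    using sink_chi by (intro sum.cong) (auto simp: mult.assoc)
  then show ?thesis using bal by (simp add: dg_def mult.commute)
qed

lemma sink_valid: "valid (sink J v c) z"
  unfolding sink_def
proof (rule del_vert_valid)
  show "valid (del_edges J (ecut J {v}) (\<lambda>e. - c * chi J e {v})) z"
    using sink_pre by (intro del_edges_valid[OF val ecut_sub]) blast
  show "bd (del_edges J (ecut J {v}) (\<lambda>e. - c * chi J e {v})) v mod 3 = 0" by (rule sink_bal)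
qed (use v in simp_all)

lemma sink_ext:
  assumes "ext (sink J v c) z"
  shows "ext J z"
proof -
  have "ext (del_edges J (ecut J {v}) (\<lambda>e. - c * chi J e {v})) z"
    by (rule del_vert_ext[OF _ sink_bal]) (use assms in \<open>simp_all add: sink_def\<close>)
  moreover have "- c * chi J e {v} \<in> {1, -1}" if "e \<in> ecut J {v}" for e
    using that c chi_cases[of J e "{v}"] by (auto simp: ecut_def)
  ultimately show ?thesis using del_edges_ext[OF val ecut_sub sink_pre] by blast
qed

lemma sink_vt: "vt (sink J v c) = vt J - {v}" "card (ed (sink J v c)) \<le> card (ed J)"
  using sink_fin by (auto simp: sink_def intro: card_mono)

lemma sink_dg: "dg (sink J v c) S + card (ecut J {v} \<inter> ecut J S) = dg J S"
  unfolding sink_def del_vert_simps by (rule del_edges_dg[OF sink_fin ecut_sub])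

text \<open>Each edge between \<open>v\<close> and \<open>S\<close> costs \<open>S\<close> the
  amount \<open>c\<close>. This is exactly the sign tolerated by the other vertices once the sign is
  uniform.\<close>

lemma sink_bt:
  assumes "finite S" "v \<notin> S"
  shows "bsum (sink J v c) S = bsum J S - c * int (card (ecut J {v} \<inter> ecut J S))"
proof -
  have "(\<Sum>e\<in>ecut J {v}. - c * chi J e {v} * chi J e S) = (\<Sum>e\<in>ecut J {v} \<inter> ecut J S. - c * chi J e {v} * chi J e S)"
    using sink_fin by (intro sum.mono_neutral_right) (auto simp: ecut_def)
  also have "\<dots> = (\<Sum>e\<in>ecut J {v} \<inter> ecut J S. c)"
  proof (rule sum.cong)
    fix e assume e: "e \<in> ecut J {v} \<inter> ecut J S"
    then have "chi J e {v} = 1 \<and> chi J e S = -1 \<or> chi J e {v} = -1 \<and> chi J e S = 1"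
      using assms(2) by (auto simp: ecut_iff chi_def)
    then show "- c * chi J e {v} * chi J e S = c" by auto
  qed simp
  finally show ?thesis
    using del_edges_bt[OF assms(1) finite_ecut[OF sink_fin], of J "{v}"] by (simp add: sink_def mult.commute)
qed

end

context critical
begin

lemma ok_some: "v \<in> vt J - {x, z} \<Longrightarrow> deletable 1 v \<or> deletable (-1) v"
proof -
  assume v: "v \<in> vt J - {x, z}"
  have "\<not> (dg J {v} = 4 \<and> bd J v mod 3 = 0)" using no_degree_four[OF v] by auto
  then show ?thesis unfolding deletable_def by (rule tame_deg_ok[OF tame[OF v]])
qed

text \<open>Such a vertex tolerates the direction given on an edge to \<open>z\<close>, and on an
  edge to a vertex besides \<open>x\<close> and \<open>z\<close> whichever direction that neighbour
  tolerates. So all its edges, at least four, would join it to \<open>x\<close>.\<close>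

lemma ok_not_both:
  assumes v: "v \<in> vt J - {x, z}" "deletable 1 v" "deletable (-1) v"
  shows False
proof -
  have sub: "ecut J {v} \<subseteq> ecut J {x}"
  proof
    fix e assume e: "e \<in> ecut J {v}"
    obtain w where w: "w \<in> vt J" "w \<noteq> v" "e \<in> ecut J {w}" by (rule other_end[OF e])
    have "w \<noteq> z"
    proof
      assume "w = z"
      then show False using z_edge_not_ok[OF v(1) _ e] w zdir_cases[OF e] v(2,3) by auto
    qed
    moreover have "w = x"
    proof (rule ccontr)
      assume "w \<noteq> x"
      then have w': "w \<in> vt J - {x, z}" using w \<open>w \<noteq> z\<close> by simp
      show False
        using ok_some[OF w'] edge_not_ok[OF w' v(1) w(2,3) e, of 1] edge_not_ok[OF w' v(1) w(2,3) e, of "-1"] v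
        by auto
    qed
    ultimately show "e \<in> ecut J {x}" using w by simp
  qed
  have "4 \<le> card (ecut J {v})" using tame[OF v(1)] by (auto simp: tame_deg_def dg_def)
  then have "\<exists>a b. a \<in> ecut J {v} \<and> b \<in> ecut J {v} \<and> a \<noteq> b"
    by (metis One_nat_def card_le_Suc0_iff_eq fin(2) finite_ecut le_trans not_less_eq_eq numeral_le_one_iff semiring_norm(69))
  then show False using sub parallel_eq[of v x] v x by blast
qed

text \<open>Suppose both classes are nonempty. No edge joins them, so the cuts of
  \<open>insert x ?N\<close> and \<open>insert x ?P\<close> are disjoint and consist of edges at
  \<open>z\<close> or \<open>x\<close>. Their total is at most d(z) + d(x) \<le> 2d(x) + 2, whereas
  each cut has at least d(x) + 2 edges.\<close>

lemma one_sign: "\<exists>c. (c = 1 \<or> c = -1) \<and> (\<forall>v\<in>vt J - {x, z}. deletable c v \<and> \<not> deletable (- c) v)"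
proof (rule ccontr)
  assume n: "\<not> ?thesis"
  let ?P = "{v \<in> vt J - {x, z}. deletable 1 v}" and ?N = "{v \<in> vt J - {x, z}. deletable (-1) v}"
  have cover: "v \<in> ?P \<or> v \<in> ?N" if "v \<in> vt J" "v \<noteq> x" "v \<noteq> z" for v using ok_some[of v] that by auto
  have disj: "?P \<inter> ?N = {}" using ok_not_both by blast
  have "\<exists>v\<in>vt J - {x, z}. \<not> (deletable 1 v \<and> \<not> deletable (- 1) v)" "\<exists>v\<in>vt J - {x, z}. \<not> (deletable (-1) v \<and> \<not> deletable (- (-1)) v)"
    using n by blast+
  then obtain u w where uw: "u \<in> ?N" "w \<in> ?P"
    using ok_some ok_not_both by auto
  let ?A = "ecut J (insert x ?N)" and ?B = "ecut J (insert x ?P)"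
  have NP: False if "e \<in> ecut J {a}" "e \<in> ecut J {b}" "a \<in> ?P" "b \<in> ?N" for e a b
  proof -
    have "a \<noteq> b" using that disj by blast
    then show False using edge_not_ok[of a b e 1] that by auto
  qed
  have ends: "(\<exists>a b. a \<noteq> b \<and> {src J e, tgt J e} = {a, b} \<and> a \<in> vt J \<and> b \<in> vt J \<and> e \<in> ecut J {a} \<and> e \<in> ecut J {b})"
    if "e \<in> ecut J S" for e S
  proof -
    have "e \<in> ed J" "src J e \<noteq> tgt J e" using ecut_ends[OF that] by auto
    then show ?thesis using val by (intro exI[of _ "src J e"] exI[of _ "tgt J e"]) (auto simp: valid_def ecut_iff)
  qed
  have key: "e \<notin> ?B \<and> e \<in> ecut J {z} \<union> ecut J {x}" if e: "e \<in> ?A" for e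
  proof -
    have "\<exists>a b. a \<in> insert x ?N \<and> b \<notin> insert x ?N \<and> b \<in> vt J \<and> e \<in> ecut J {a} \<and> e \<in> ecut J {b}"
      using ends[OF e] e by (auto simp: ecut_iff doubleton_eq_iff)
    then obtain a b where ab: "a \<in> insert x ?N" "b \<notin> insert x ?N" "b \<in> vt J" "e \<in> ecut J {a}" "e \<in> ecut J {b}"
      by blast
    then have "a \<noteq> b" by blast
    then have iS: "e \<in> ecut J S \<longleftrightarrow> (a \<in> S) \<noteq> (b \<in> S)" for S using ab(4,5) by (auto simp: ecut_iff)
    have bx: "b \<noteq> x" using ab by blast
    show ?thesis
    proof (cases "a = x")
      case True
      then have "b \<noteq> z" using no_zx ab by auto
      then have "b \<in> ?P" using cover[of b] ab bx by blast
      then show ?thesis using iS True ab by simp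
    next
      case False
      then have aN: "a \<in> ?N" using ab by blast
      then have "b \<notin> ?P" using NP[of e b a] ab by blast
      then have "b = z" using cover[of b] ab bx by blast
      moreover have "a \<notin> ?P" using aN disj by blast
      ultimately show ?thesis using iS[of "insert x ?P"] False x ab by simp
    qed
  qed
  have keyB: "e \<in> ecut J {z} \<union> ecut J {x}" if e: "e \<in> ?B" for e
  proof -
    have "\<exists>a b. a \<in> insert x ?P \<and> b \<notin> insert x ?P \<and> b \<in> vt J \<and> e \<in> ecut J {a} \<and> e \<in> ecut J {b}"
      using ends[OF e] e by (auto simp: ecut_iff doubleton_eq_iff)
    then obtain a b where ab: "a \<in> insert x ?P" "b \<notin> insert x ?P" "b \<in> vt J" "e \<in> ecut J {a}" "e \<in> ecut J {b}"
      by blast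
    show ?thesis
    proof (cases "a = x")
      case True
      then show ?thesis using ab by simp
    next
      case False
      then have "a \<in> ?P" using ab by blast
      then have "b \<notin> ?N" using NP[of e a b] ab by blast
      then have "b = z" using cover[of b] ab by blast
      then show ?thesis using ab by simp
    qed
  qed
  have "card ?A + card ?B = card (?A \<union> ?B) + card (?A \<inter> ?B)" by (intro card_Un_Int) simp_all
  moreover have "?A \<inter> ?B = {}" using key by blast
  moreover have "card (?A \<union> ?B) \<le> card (ecut J {z} \<union> ecut J {x})"
    using key keyB by (intro card_mono) auto
  moreover have "card (ecut J {z} \<union> ecut J {x}) \<le> dg J {z} + dg J {x}" unfolding dg_def by (rule card_Un_le)
  moreover have "dg J {x} + 2 \<le> card ?A"
  proof -
    have "insert x ?N \<noteq> {x}" "insert x ?N \<noteq> vt J - {z}" "insert x ?N \<subseteq> vt J - {z}" using uw disj x by auto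
    then show ?thesis using x_cut_cases[of "insert x ?N"] by (simp add: dg_def)
  qed
  moreover have "dg J {x} + 2 \<le> card ?B"
  proof -
    have "insert x ?P \<noteq> {x}" "insert x ?P \<noteq> vt J - {z}" "insert x ?P \<subseteq> vt J - {z}" using uw disj x by auto
    then show ?thesis using x_cut_cases[of "insert x ?P"] by (simp add: dg_def)
  qed
  ultimately show False using tall_le by simp
qed

text \<open>With \<open>x\<close> and \<open>z\<close> alone the preflow is already a flow: net flow
  and boundary at \<open>x\<close> are the negatives mod 3 of those at \<open>z\<close>.\<close>

lemma third_vertex: "vt J - {x, z} \<noteq> {}"
proof
  assume "vt J - {x, z} = {}"
  then have V: "vt J = {x, z}" using x zV by auto
  have "rflow J z (pre J)"
    unfolding rflow_def
  proof (intro conjI ballI)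
    fix v assume "v \<in> vt J"
    then have "v = z \<or> v = x" using V by auto
    then show "net J (pre J) {v} mod 3 = bd J v mod 3"
    proof
      assume "v = z"
      then show ?thesis using val by (simp add: valid_def)
    next
      assume vx: "v = x"
      have "vt J - {z} = {x}" using V x by auto
      then have "net J (pre J) {x} = - net J (pre J) {z}" "bd J x mod 3 = (- bd J z) mod 3"
        using net_compl[OF val, of "{z}" "pre J"] bsum_compl[OF val, of "{z}"] zV by auto
      moreover have "net J (pre J) {z} mod 3 = bd J z mod 3" using val by (simp add: valid_def)
      ultimately show ?thesis using vx by (metis mod_minus_cong)
    qed
  qed (use val in \<open>auto simp: valid_def\<close>)
  then show False using nonext by (auto simp: ext_def)
qed

end

section \<open>Consequences of a single sign\<close>

locale uniform = critical +
  fixes c :: int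
  assumes c: "c = 1 \<or> c = -1" and okc: "\<And>v. v \<in> vt J - {x, z} \<Longrightarrow> deletable c v \<and> \<not> deletable (- c) v"
begin

lemma types:
  assumes "v \<in> vt J - {x, z}"
  shows "(dg J {v} = 5 \<and> (bd J v - c) mod 3 = 0) \<or> (dg J {v} = 6 \<and> (bd J v + c) mod 3 = 0)"
  using okc[OF assms] unfolding deletable_def by (intro tame_deg_one_sign) simp_all

lemma z_dir:
  assumes "v \<in> vt J - {x, z}" "e \<in> ecut J {v}" "e \<in> ecut J {z}"
  shows "pre J e * chi J e {v} = - c"
  using z_edge_not_ok[OF assms(1,3,2)] okc[OF assms(1)] zdir_cases[OF assms(2)] c by auto

lemma z_end:
  assumes "e \<in> ecut J {z}"
  obtains v where "v \<in> vt J - {x, z}" "e \<in> ecut J {v}"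
proof -
  obtain w where w: "w \<in> vt J" "w \<noteq> z" "e \<in> ecut J {w}" by (rule other_end[OF assms])
  moreover have "w \<noteq> x" using no_zx assms w by auto
  ultimately show ?thesis using that by blast
qed

lemma dg_tip_le: "dg J {z} \<le> dg J {x} + 1"
proof (rule ccontr)
  assume "\<not> ?thesis"
  then have "both_dirs J z {x}" using tall by (auto simp: tallp_both_dirs)
  then obtain ep en where e: "ep \<in> ecut J {z}" "pre J ep * chi J ep {z} = 1"
       "en \<in> ecut J {z}" "pre J en * chi J en {z} = -1" by (auto simp: both_dirs_def)
  have d: "pre J e * chi J e {z} = c" if e: "e \<in> ecut J {z}" for e
  proof -
    obtain v where v: "v \<in> vt J - {x, z}" "e \<in> ecut J {v}" by (rule z_end[OF e])
    have "chi J e {z} = - chi J e {v}" using chi_opp[OF v(2) e] v by auto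
    then show ?thesis using z_dir[OF v e] by simp
  qed
  show False using d[OF e(1)] d[OF e(3)] e(2,4) by simp
qed

text \<open>If d(z) \<le> d(x), an edge at \<open>x\<close> could be deleted in the direction that
  its other end tolerates. If there is no edge at \<open>x\<close>, then \<open>z\<close> has none
  either, and the other vertices would form a nonempty set with an empty cut.\<close>

lemma dz: "dg J {z} = dg J {x} + 1"
proof (rule ccontr)
  assume "\<not> ?thesis"
  then have le: "dg J {z} \<le> dg J {x}" using dg_tip_le by simp
  show False
  proof (cases "ecut J {x} = {}")
    case True
    then have d0: "dg J {x} = 0" "dg J {z} = 0" using le by (simp_all add: dg_def)
    have "dg J {x, z} + 2 * card (ecut J {z} \<inter> ecut J {x}) = dg J {z} + dg J {x}"
      using dg_insert[of x "{z}"] x by simp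
    then have "dg J {x, z} = 0" using d0 by simp
    then have "dg J (vt J - {x, z}) = 0" using dg_compl[OF val, of "{x, z}"] x zV by simp
    moreover have "tame_deg (dg J (vt J - {x, z})) (bsum J (vt J - {x, z}))" by (rule tame_sets) (use third_vertex in auto)
    ultimately show False by (simp add: tame_deg_def)
  next
    case False
    then obtain e where e: "e \<in> ecut J {x}" by blast
    obtain v where v: "v \<in> vt J" "v \<noteq> x" "e \<in> ecut J {v}" by (rule other_end[OF e])
    have ez: "e \<notin> ecut J {z}" using no_zx e by blast
    have v': "v \<in> vt J - {x, z}" using v ez by auto
    have cv: "chi J e {v} = 1 \<or> chi J e {v} = -1" using v chi_cases[of J e "{v}"] by (auto simp: ecut_def)
    show False
    proof (rule no_delete[of e "c * chi J e {v}"])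
      show "e \<in> ed J" using e by (simp add: ecut_def)
      show "c * chi J e {v} = 1 \<or> c * chi J e {v} = -1" using c cv by auto
      fix w assume w: "w \<in> vt J - {x, z}" "e \<in> ecut J {w}"
      then have "w = v" using v e by (auto simp: ecut_iff)
      moreover have "c * chi J e {v} * chi J e {v} = c" using cv by auto
      ultimately show "tame_deg (dg J {w} - 1) (bd J w - c * chi J e {v} * chi J e {w})"
        using okc[OF v'] unfolding deletable_def by (simp only:)
    qed (use le ez in auto)
  qed
qed

end

subsection \<open>All vertices of one sign\<close>

lemma (in critical) x_cut_min:
  assumes "X \<subseteq> vt J - {z}" "x \<in> X" "X \<noteq> vt J - {z}"
  shows "dg J {x} \<le> dg J X"
proof (cases "X = {x}")
  case False
  then have "dg J {x} + 2 \<le> dg J X" using x_cut_cases[OF assms(1,2)] assms(3) by blast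
  then show ?thesis by simp
qed simp

context uniform
begin

lemma dg_ge5:
  assumes "U \<subseteq> vt J - {x, z}" "U \<noteq> {}"
  shows "5 \<le> dg J U"
proof (cases "\<exists>v. U = {v}")
  case True
  then show ?thesis using types assms by fastforce
next
  case False
  have "finite U" using assms fin_sub by blast
  then have "2 \<le> card U" using card_ge2[OF _ assms(2)] False by blast
  then show ?thesis using strongly_tame_sets[OF assms(1)] by linarith
qed

text \<open>The edges will be lifted at the contracted set: different far ends spare every single
  vertex a loss of 2, and \<open>e2\<close> must not be a tip edge to be liftable. At most four of
  the seven edges go to \<open>z\<close>. They cannot all go to one vertex either, since degrees are
  at most 6 and for \<open>x\<close> the degree of \<open>insert x B\<close> would be too
  small.\<close>

lemma seven_edges:
  assumes B: "B \<subseteq> vt J - {x, z}" "2 \<le> card B" and d7: "dg J B = 7"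
  obtains e1 e2 where "e1 \<in> ecut J B" "e2 \<in> ecut J B" "e1 \<noteq> e2" "e2 \<notin> ecut J {z}"
    "\<And>w. w \<in> vt J - B \<Longrightarrow> \<not> (e1 \<in> ecut J {w} \<and> e2 \<in> ecut J {w})"
proof -
  have Bz: "z \<notin> B" "x \<notin> B" "B \<subseteq> vt J" using B by auto
  have ne: "B \<noteq> {}" using B by auto
  let ?R = "vt J - insert z B"
  have "dg J (insert z B) + 2 * card (ecut J B \<inter> ecut J {z}) = dg J B + dg J {z}"
    by (rule dg_insert[OF Bz(1)])
  moreover have "dg J (insert z B) = dg J ?R" using dg_compl[OF val, of "insert z B"] Bz zV by simp
  moreover have "dg J {x} \<le> dg J ?R"
  proof -
    have "?R \<subseteq> vt J - {z}" "x \<in> ?R" "?R \<noteq> vt J - {z}" using Bz x ne by auto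
    then show ?thesis by (rule x_cut_min)
  qed
  ultimately have k: "card (ecut J B \<inter> ecut J {z}) \<le> 4" using dz d7 by simp
  have "\<not> ecut J B \<subseteq> ecut J {z}"
  proof
    assume "ecut J B \<subseteq> ecut J {z}"
    then have "ecut J B \<inter> ecut J {z} = ecut J B" by blast
    then show False using k d7 by (simp add: dg_def)
  qed
  then obtain e2 where e2: "e2 \<in> ecut J B" "e2 \<notin> ecut J {z}" by blast
  have "e2 \<in> ed J" "src J e2 \<noteq> tgt J e2" using ecut_ends[OF e2(1)] by auto
  then have "\<exists>w. w \<in> vt J - B \<and> e2 \<in> ecut J {w} \<and> (\<forall>w'. w' \<notin> B \<and> e2 \<in> ecut J {w'} \<longrightarrow> w' = w)"
    using e2(1) val by (cases "src J e2 \<in> B") (auto simp: ecut_iff valid_def)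
  then obtain w where w: "w \<in> vt J - B" "e2 \<in> ecut J {w}" "\<And>w'. w' \<notin> B \<Longrightarrow> e2 \<in> ecut J {w'} \<Longrightarrow> w' = w"
    by blast
  have "\<not> ecut J B \<subseteq> ecut J {w}"
  proof
    assume sub: "ecut J B \<subseteq> ecut J {w}"
    have "card (ecut J B) \<le> card (ecut J {w})" using sub by (intro card_mono) auto
    then have w7: "7 \<le> dg J {w}" using d7 by (simp add: dg_def)
    show False
    proof (cases "w = x")
      case True
      have "ecut J B \<inter> ecut J {x} = ecut J B" using sub True by blast
      then have "dg J (insert x B) + 14 = 7 + dg J {x}"
        using dg_insert[of x B] Bz d7 by (simp add: dg_def)
      moreover have "insert x B \<subseteq> vt J - {z}" "insert x B \<noteq> {x}" using Bz B x ne by auto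
      ultimately show False using x_cut_cases[of "insert x B"] dg_vz dz by auto
    next
      case False
      have "w \<noteq> z" using w e2 by blast
      then show False using types[of w] w False w7 by auto
    qed
  qed
  then obtain e1 where e1: "e1 \<in> ecut J B" "e1 \<notin> ecut J {w}" by blast
  show ?thesis
  proof (rule that[OF e1(1) e2(1)])
    show "e1 \<noteq> e2" using e1 w by blast
    show "e2 \<notin> ecut J {z}" by (rule e2)
    fix w' assume "w' \<in> vt J - B"
    then show "\<not> (e1 \<in> ecut J {w'} \<and> e2 \<in> ecut J {w'})" using w(3)[of w'] e1(2) by blast
  qed
qed

text \<open>Lifting two edges at the contracted set \<open>B\<close> forces the flow to use both directions on its cut.\<close>

lemma seven_flow:
  assumes B: "B \<subseteq> vt J - {x, z}" "2 \<le> card B" and d7: "dg J B = 7"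
  obtains f e1 e2 where "flow_off J z B f" "e1 \<in> ecut J B" "e2 \<in> ecut J B"
    "f e1 * chi J e1 B = 1" "f e2 * chi J e2 B = -1"
proof -
  have Bz: "z \<notin> B" "x \<notin> B" "B \<subseteq> vt J" using B by auto
  obtain r where r: "r \<in> B" using B by fastforce
  obtain e1 e2 where e: "e1 \<in> ecut J B" "e2 \<in> ecut J B" "e1 \<noteq> e2" "e2 \<notin> ecut J {z}"
    "\<And>w. w \<in> vt J - B \<Longrightarrow> \<not> (e1 \<in> ecut J {w} \<and> e2 \<in> ecut J {w})"
    using seven_edges[OF B d7] by metis
  let ?C = "contract J B r"
  let ?J = "lift ?C r e1 e2"
  have ur: "uncontract B r {r} = B" and uz: "uncontract B r {z} = {z}" using r Bz by (auto simp: uncontract_def)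
  have vC: "valid ?C z" by (rule contract_valid[OF val r Bz(3,1)])
  have rz: "r \<noteq> z" using r Bz by auto
  have l: "liftable ?C z r e1 e2"
    unfolding liftable_def contract_ecut[OF r] ur uz using e rz by simp
  have fC: "finite (ed ?C)" by simp
  have dg': "dg ?J S + 2 * of_bool (e1 \<in> ecut J (uncontract B r S) \<and> e2 \<in> ecut J (uncontract B r S)) = dg J (uncontract B r S)" for S
    using lift_dg[OF l fC, of S] unfolding contract_ecut[OF r] contract_dg[OF r] by simp
  have "ext ?J z"
  proof (rule smaller_extends)
    show "valid ?J z" by (rule lift_valid[OF l vC])
    have "card (insert r (vt J - B)) \<le> card (vt J)" using r Bz by (intro card_mono) auto
    moreover have "card (ed J - {e2}) < card (ed J)" using e(2) ecut_sub by (intro card_del) (auto simp: ecut_def)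
    ultimately show "card (vt ?J) + card (ed ?J) < card (vt J) + card (ed J)" by simp
    show "x \<in> vt ?J" using x Bz by simp
  next
    fix S assume S: "S \<noteq> {}" "S \<subseteq> vt ?J - {x, z}"
    let ?S = "uncontract B r S"
    have S': "S \<subseteq> vt J - {x, z}" using S r Bz by auto
    have sub: "?S \<subseteq> vt J - {x, z}" using S' B(1) by (auto simp: uncontract_def split: if_splits)
    have ne: "?S \<noteq> {}" using S r by (auto simp: uncontract_def)
    have fS: "finite ?S" using sub fin_sub by blast
    have bt': "bsum ?J S = bsum J ?S" using contract_bt[OF r fin(1) Bz(3), of S] S by auto
    have t: "tame_deg (dg J ?S) (bsum J ?S)" by (rule tame_sets[OF sub ne])
    show "tame_deg (dg ?J S) (bsum ?J S)"
    proof (cases "e1 \<in> ecut J ?S \<and> e2 \<in> ecut J ?S")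
      case False
      then have "dg ?J S = dg J ?S" using dg'[of S] by (auto simp: of_bool_def split: if_splits)
      then show ?thesis using t bt' by simp
    next
      case True
      then have d2: "dg ?J S + 2 = dg J ?S" using dg'[of S] by simp
      \<comment> \<open>A vertex outside \<open>B\<close> is an end of at most one of the two edges,
        and a set that contains the contracted vertex stands for all of \<open>B\<close>. So the
        strong bound applies whenever the cut loses 2.\<close>
      have "?S \<noteq> {w}" for w
      proof
        assume w: "?S = {w}"
        have "w \<notin> B"
        proof
          assume "w \<in> B"
          then have "r \<in> S" using w by (auto simp: uncontract_def split: if_splits)
          then have "B \<subseteq> {w}" using w by (auto simp: uncontract_def)
          then have "card B \<le> card {w}" by (intro card_mono) auto
          then show False using B by simp
        qed
        then show False using e(5)[of w] True w sub by auto
      qed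
      then have "2 \<le> card ?S" using card_ge2[OF fS ne] by blast
      from tame_deg_pred2[OF strongly_tame_sets[OF sub this] d2] show ?thesis using bt' by simp
    qed
  next
    fix X assume X: "x \<in> X" "X \<subseteq> vt ?J - {z}" "X \<noteq> vt ?J - {z}"
    let ?X = "uncontract B r X"
    have X': "X \<subseteq> vt J - {z}" using X r Bz by auto
    have sub: "?X \<subseteq> vt J - {z}" using X' B(1) by (auto simp: uncontract_def split: if_splits)
    have xX: "x \<in> ?X" using X Bz by (auto simp: uncontract_def)
    have neV: "?X \<noteq> vt J - {z}"
    proof
      assume a: "?X = vt J - {z}"
      then have "r \<in> X" using r Bz by (auto simp: uncontract_def split: if_splits)
      then have "X = vt ?J - {z}" using a X(2) r Bz by (auto simp: uncontract_def)
      then show False using X by blast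
    qed
    have "dg J {x} \<le> dg ?J X"
    proof (cases "?X = {x}")
      case True
      have "\<not> (e1 \<in> ecut J {x} \<and> e2 \<in> ecut J {x})" using e(5)[of x] x Bz by simp
      then have "dg ?J X = dg J {x}" using dg'[of X] unfolding True by (auto simp: of_bool_def split: if_splits)
      then show ?thesis by simp
    next
      case False
      then have "dg J {x} + 2 \<le> dg J ?X" using x_cut_cases[OF sub xX] neV by blast
      then show ?thesis using dg'[of X] by (auto simp: of_bool_def split: if_splits)
    qed
    moreover have "dg ?J {z} \<le> dg J {z}" using dg'[of "{z}"] uz by simp
    ultimately show "tallp ?J z X" using dz by (intro tallp_strict) simp
  qed
  then obtain h where h: "rflow ?J z h" by (auto simp: ext_def)
  obtain g where g: "rflow ?C z g" "g e2 * chi ?C e2 {r} = - (g e1 * chi ?C e1 {r})"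
    using lift_rflow[OF l vC h] by blast
  have g': "flow_off J z B g" using g(1) contract_rflow[OF r Bz(3,1)] by blast
  have opp: "g e2 * chi J e2 B = - (g e1 * chi J e1 B)" using g(2) by (simp add: contract_chi[OF r] ur)
  have "g e1 * chi J e1 B = 1 \<or> g e1 * chi J e1 B = -1"
    using g' e(1) chi_cases[of J e1 B] by (auto simp: flow_off_def ecut_def)
  then show ?thesis
  proof
    assume "g e1 * chi J e1 B = 1"
    then show ?thesis using that[OF g' e(1,2)] opp by simp
  next
    assume "g e1 * chi J e1 B = -1"
    then show ?thesis using that[OF g' e(2,1)] opp by simp
  qed
qed

text \<open>At degree 6 a part would have degree at most 4, against the minimum 5. At degree 7 all
  parts have degree 5 and by parity there are at least three of them. Here the boundary is nonzero,
  so the two directions needed for \<open>three_parts\<close> do not come from the net flow but from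
  \<open>seven_flow\<close>.\<close>

lemma dg_ge8:
  assumes B: "B \<subseteq> vt J - {x, z}" "2 \<le> card B"
  shows "8 \<le> dg J B"
proof (rule ccontr)
  assume "\<not> ?thesis"
  then consider "dg J B = 6" | "dg J B = 7" using strongly_tame_sets[OF B] by linarith
  then show False
  proof cases
    case 1
    have ne: "B \<noteq> {}" "B \<subseteq> vt J - {z}" using B by auto
    obtain f where f: "flow_off J z B f" using crit[OF ne(2) B(2)] by blast
    obtain Q where Q: "partition_on B Q"
      "\<And>U. U \<in> Q \<Longrightarrow> U \<noteq> {} \<and> U \<subseteq> B \<and> tame_deg (dg J U) (bsum J U) \<and> \<not> tall_in J f B U"
      using parts_tm[OF B(1) f ne(1)] by metis
    obtain U where U: "U \<in> Q" using Q(1) ne by (auto simp: partition_on_def)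
    have "5 \<le> dg J U" using dg_ge5[of U] Q(2)[OF U] B by blast
    then show False using Q(2)[OF U] 1 by (auto simp: tall_in_def)
  next
    case 2
    obtain f e1 e2 where f: "flow_off J z B f" and e: "e1 \<in> ecut J B" "e2 \<in> ecut J B"
      "f e1 * chi J e1 B = 1" "f e2 * chi J e2 B = -1"
      using seven_flow[OF B 2] by metis
    have ne: "B \<noteq> {}" using B by auto
    obtain Q where Q: "partition_on B Q" "finite Q" "B \<notin> Q"
      "\<And>U. U \<in> Q \<Longrightarrow> U \<noteq> {} \<and> U \<subseteq> B \<and> tame_deg (dg J U) (bsum J U) \<and> \<not> tall_in J f B U"
      using parts_tm[OF B(1) f ne] by metis
    have d5: "dg J U = 5" if "U \<in> Q" for U
    proof -
      have "5 \<le> dg J U" using dg_ge5[of U] Q(4)[OF that] B by blast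
      moreover have "dg J U + 2 \<le> 7" using Q(4)[OF that] 2 by (auto simp: tall_in_def)
      ultimately show ?thesis by simp
    qed
    have "even ((\<Sum>U\<in>Q. dg J U) + dg J (\<Union>Q))"
      by (rule even_sum_dg[OF fin(2) Q(2) partition_onD2[OF Q(1)]])
    moreover have "(\<Sum>U\<in>Q. dg J U) = 5 * card Q" using d5 by simp
    moreover have "\<Union>Q = B" using partition_onD1[OF Q(1)] by simp
    ultimately have "even (5 * card Q + 7)" using 2 by simp
    then have "odd (card Q)" by presburger
    moreover have "card Q \<noteq> 1"
    proof
      assume "card Q = 1"
      then obtain U where "Q = {U}" by (auto simp: card_1_singleton_iff)
      then show False using Q(3) partition_onD1[OF Q(1)] by simp
    qed
    ultimately have "3 \<le> card Q" by presburger
    then show False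
      using three_parts[OF Q(1) e(1,3,2,4), of Q] d5 2 Q(4) by auto
  qed
qed

section \<open>Removing a neighbour of the tip\<close>

lemma common_nbr_le1:
  assumes "u \<in> vt J - {z}" "v \<in> vt J - {z}" "u \<noteq> v"
  shows "card (ecut J {v} \<inter> ecut J {u}) \<le> 1"
proof -
  have "a = b" if "a \<in> ecut J {v} \<inter> ecut J {u}" "b \<in> ecut J {v} \<inter> ecut J {u}" for a b
    using no_parallel[OF assms, of a b] that by blast
  then show ?thesis by (simp add: card_le_Suc0_iff_eq)
qed

text \<open>The net flow -5c of a sink agrees mod 3 with the boundary c of \<open>v\<close>. All tip
  edges at \<open>v\<close> already have the required direction.\<close>

lemma no_degree_five:
  assumes v: "v \<in> vt J - {x, z}" "dg J {v} = 5" and e0: "e0 \<in> ecut J {v}" "e0 \<in> ecut J {z}"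
  shows False
proof -
  have vV: "v \<in> vt J" "v \<noteq> z" using v by auto
  have "(bd J v - c) mod 3 = 0" using types[OF v(1)] v(2) by auto
  then have bal: "(bd J v + c * int (dg J {v})) mod 3 = 0" using v(2) by simp presburger
  have dir: "\<forall>e\<in>ecut J {v} \<inter> ecut J {z}. pre J e * chi J e {v} = - c" using z_dir[OF v(1)] by simp
  let ?J = "sink J v c"
  let ?k = "\<lambda>S. card (ecut J {v} \<inter> ecut J S)"
  note dg' = sink_dg[OF val vV c dir bal]
  note bt' = sink_bt[OF val vV c dir bal]
  note vt' = sink_vt[OF val vV c dir bal]
  have ins: "dg J (insert v S) + 2 * ?k S = dg J S + 5" if "v \<notin> S" for S
    using dg_insert[OF that] v by (simp add: Int_commute)
  have "ext ?J z"
  proof (rule smaller_extends)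
    show "valid ?J z" by (rule sink_valid[OF val vV c dir bal])
    have "card (vt ?J) < card (vt J)" unfolding vt' using vV by (intro psubset_card_mono) auto
    then show "card (vt ?J) + card (ed ?J) < card (vt J) + card (ed J)" using vt'(2) by simp
    show "x \<in> vt ?J" using x v vt' by auto
  next
    fix B assume B0: "B \<noteq> {}" "B \<subseteq> vt ?J - {x, z}"
    have B: "B \<subseteq> vt J - {x, z}" "v \<notin> B" using B0 vt' by auto
    have fB: "finite B" using B fin_sub by blast
    show "tame_deg (dg ?J B) (bsum ?J B)"
    proof (cases "\<exists>u. B = {u}")
      case True
      then obtain u where u: "B = {u}" by blast
      have u': "u \<in> vt J - {x, z}" "u \<noteq> v" using B u by auto
      have "?k B \<le> 1" unfolding u using common_nbr_le1[of u v] u' v by auto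
      then consider "?k B = 0" | "?k B = 1" by linarith
      then show ?thesis
      proof cases
        case 1
        then show ?thesis using dg'[of B] bt'[OF fB B(2)] tame_sets[OF B(1) B0(1)] by simp
      next
        case 2
        then have "dg ?J B = dg J {u} - 1" "bsum ?J B = bd J u - c" using dg'[of B] bt'[OF fB B(2)] u by simp_all
        then show ?thesis using okc[OF u'(1)] unfolding deletable_def by simp
      qed
    next
      case False
      then have c2: "2 \<le> card B" using card_ge2[OF fB B0(1)] by blast
      have "2 \<le> card (insert v B)" using c2 fB B by simp
      then have "8 \<le> dg J (insert v B)" using dg_ge8[of "insert v B"] B v by auto
      \<comment> \<open>Twice the new degree is d(B) + d(insert v B) - 5, so two bounds of 8 give at
        least 11, and the new degree is at least 6.\<close>
      then have "6 \<le> dg ?J B" using ins[OF B(2)] dg'[of B] dg_ge8[OF B(1) c2] by linarith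
      then show ?thesis by (simp add: tame_deg_def)
    qed
  next
    fix X assume X0: "x \<in> X" "X \<subseteq> vt ?J - {z}" "X \<noteq> vt ?J - {z}"
    have X: "X \<subseteq> vt J - {z}" "v \<notin> X" using X0 vt' by auto
    have "e0 \<in> ecut J {v} \<inter> ecut J {z}" using e0 by simp
    then have "1 \<le> ?k {z}" by (metis One_nat_def Suc_leI card_gt_0_iff empty_iff fin(2) finite_Int finite_ecut)
    then have dz': "dg ?J {z} \<le> dg J {x}" using dg'[of "{z}"] dz by simp
    \<comment> \<open>The tip has lost an edge and now has degree at most d(x), so a loss of 1 still
      avoids the border case.\<close>
    have "dg J {x} \<le> dg ?J X + 1"
    proof (cases "X = {x}")
      case True
      have "?k X \<le> 1" unfolding True using common_nbr_le1[of x v] x v by auto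
      then show ?thesis using dg'[of X] True by simp
    next
      case False
      have "insert v X \<noteq> {x}" "insert v X \<noteq> vt J - {z}" "insert v X \<subseteq> vt J - {z}"
        using X v X0 vt' by auto
      then have "dg J {x} + 2 \<le> dg J (insert v X)" using x_cut_cases[of "insert v X"] X0 by blast
      moreover have "X \<noteq> vt J - {z}" using X v by auto
      then have "dg J {x} + 2 \<le> dg J X" using x_cut_cases[OF X(1) X0(1)] False by blast
      ultimately show ?thesis using ins[OF X(2)] dg'[of X] by linarith
    qed
    then show "tallp ?J z X" using dz' by (intro tallp_strict) simp
  qed
  then show False using sink_ext[OF val vV c dir bal] nonext by blast
qed

text \<open>Different triples within at most five edges share i = 1 or i = 2 edges. From d(insert v
  (B \<union> C)) \<ge> 8 it follows that d(B \<union> C) \<ge> 14 - 2i. For i = 1 the intersection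
  has degree at least 5; for i = 2 it has two vertices, as there are no parallel edges, and degree
  at least 8. Both sums exceed d(B) + d(C) = 16.\<close>

lemma six_bad_unique:
  assumes v: "v \<in> vt J - {x, z}" "dg J {v} = 6" and k: "card (ecut J {v} - ecut J {z}) \<le> 5"
    and B: "B \<subseteq> vt J - {x, z}" "v \<notin> B" "dg J B = 8" "card (ecut J {v} \<inter> ecut J B) = 3"
    and C: "C \<subseteq> vt J - {x, z}" "v \<notin> C" "dg J C = 8" "card (ecut J {v} \<inter> ecut J C) = 3"
  shows "ecut J {v} \<inter> ecut J B = ecut J {v} \<inter> ecut J C"
proof (rule ccontr)
  let ?S = "ecut J {v} \<inter> ecut J B" and ?T = "ecut J {v} \<inter> ecut J C"
  assume ne: "?S \<noteq> ?T"
  have fn: "finite ?S" "finite ?T" by simp_all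
  have sum: "card (?S \<union> ?T) + card (?S \<inter> ?T) = 6" using card_Un_Int[OF fn] B C by simp
  have "?S \<union> ?T \<subseteq> ecut J {v} - ecut J {z}"
  proof
    fix e assume e: "e \<in> ?S \<union> ?T"
    then have "e \<notin> ecut J {z}" using ecut_two_ends[of e J v z B] ecut_two_ends[of e J v z C] B C v by auto
    then show "e \<in> ecut J {v} - ecut J {z}" using e by blast
  qed
  then have "card (?S \<union> ?T) \<le> 5" using k card_mono[of "ecut J {v} - ecut J {z}" "?S \<union> ?T"] by simp
  then have g1: "1 \<le> card (?S \<inter> ?T)" using sum by simp
  have g2: "card (?S \<inter> ?T) \<le> 2"
  proof (rule ccontr)
    assume "\<not> ?thesis"
    then have "card ?S \<le> card (?S \<inter> ?T)" "card ?T \<le> card (?S \<inter> ?T)" using B C by simp_all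
    then have "?S \<inter> ?T = ?S" "?S \<inter> ?T = ?T" using fn card_seteq[of ?S "?S \<inter> ?T"] card_seteq[of ?T "?S \<inter> ?T"] by blast+
    then show False using ne by blast
  qed
  have common: "\<exists>w. w \<in> B \<inter> C \<and> e \<in> ecut J {w}" if "e \<in> ?S \<inter> ?T" for e
    using that B(2) C(2) by (cases "src J e = v") (auto simp: ecut_iff)
  have sub: "B \<inter> C \<subseteq> vt J - {x, z}" using B by auto
  have BC: "B \<inter> C \<noteq> {}"
  proof -
    have "?S \<inter> ?T \<noteq> {}" using g1 by (metis One_nat_def card.empty not_less_eq_eq order_refl)
    then show ?thesis using common by blast
  qed
  have fBC: "finite (B \<inter> C)" using sub fin_sub by blast
  have dI: "5 \<le> dg J (B \<inter> C)" "card (?S \<inter> ?T) = 2 \<Longrightarrow> 8 \<le> dg J (B \<inter> C)"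
  proof -
    show "5 \<le> dg J (B \<inter> C)" by (rule dg_ge5[OF sub BC])
    assume "card (?S \<inter> ?T) = 2"
    then obtain a b where ab: "?S \<inter> ?T = {a, b}" "a \<noteq> b" by (auto simp: card_2_iff)
    have "B \<inter> C \<noteq> {w}" for w
    proof
      assume w: "B \<inter> C = {w}"
      have "a \<in> ?S \<inter> ?T" "b \<in> ?S \<inter> ?T" using ab by simp_all
      then have "a \<in> ecut J {w}" "b \<in> ecut J {w}" "a \<in> ecut J {v}" "b \<in> ecut J {v}"
        using common[of a] common[of b] unfolding w by auto
      moreover have "w \<in> vt J - {z}" "w \<noteq> v" "v \<in> vt J - {z}" using w sub B v by auto
      ultimately show False using parallel_eq[of w v a b] ab(2) by blast
    qed
    then show "8 \<le> dg J (B \<inter> C)" using dg_ge8[OF sub] card_ge2[OF fBC BC] by blast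
  qed
  have "ecut J (B \<union> C) \<inter> ecut J {v} = ?S \<union> ?T" using ecut_Un_at[OF B(2) C(2), of J] by blast
  then have "dg J (insert v (B \<union> C)) + 2 * card (?S \<union> ?T) = dg J (B \<union> C) + 6"
    using dg_insert[of v "B \<union> C"] B C v by simp
  moreover have "8 \<le> dg J (insert v (B \<union> C))"
  proof (rule dg_ge8)
    show "insert v (B \<union> C) \<subseteq> vt J - {x, z}" using B C v by auto
    have "B \<noteq> {}" using BC by auto
    then obtain b where "b \<in> B" by blast
    moreover from this have "b \<noteq> v" using B(2) by blast
    ultimately have "{v, b} \<subseteq> insert v (B \<union> C)" "card {v, b} = 2" by simp_all
    moreover have "finite (insert v (B \<union> C))" using B C fin_sub by auto
    ultimately show "2 \<le> card (insert v (B \<union> C))" by (metis card_mono)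
  qed
  moreover have "dg J (B \<inter> C) + dg J (B \<union> C) \<le> dg J B + dg J C" by (rule dg_submodular) simp
  moreover have "card (?S \<inter> ?T) = 1 \<or> card (?S \<inter> ?T) = 2" using g1 g2 by linarith
  ultimately show False using dI sum B(3) C(3) by linarith
qed

text \<open>
  If \<open>p\<close> and \<open>q\<close> are lifted at \<open>v\<close> and the other edges of \<open>v\<close> are deleted, a set loses tameness only if
  it has degree 8, contains three neighbours of \<open>v\<close>, and contains both or none of the other ends of
  \<open>p\<close> and \<open>q\<close>.
\<close>

lemma six_pair:
  assumes v: "v \<in> vt J - {x, z}" "dg J {v} = 6"
    and k: "4 \<le> card (ecut J {v} - ecut J {z})" "card (ecut J {v} - ecut J {z}) \<le> 5"
  obtains p q where "p \<in> ecut J {v} - ecut J {z}" "q \<in> ecut J {v} - ecut J {z}" "p \<noteq> q"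
    "\<And>e. e \<in> ecut J {v} \<Longrightarrow> e \<in> ecut J {x} \<Longrightarrow> e = q"
    "\<And>B. B \<subseteq> vt J - {x, z} \<Longrightarrow> v \<notin> B \<Longrightarrow> dg J B = 8 \<Longrightarrow> card (ecut J {v} \<inter> ecut J B) = 3 \<Longrightarrow>
      (p \<in> ecut J B) \<noteq> (q \<in> ecut J B)"
proof -
  let ?N = "ecut J {v} - ecut J {z}"
  let ?bad = "\<lambda>B. B \<subseteq> vt J - {x, z} \<and> v \<notin> B \<and> dg J B = 8 \<and> card (ecut J {v} \<inter> ecut J B) = 3"
  have fN: "finite ?N" by simp
  have xq: "e = e'" if "e \<in> ecut J {v}" "e \<in> ecut J {x}" "e' \<in> ecut J {v}" "e' \<in> ecut J {x}" for e e'
    using parallel_eq[of v x e e'] that v x by blast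
  \<comment> \<open>All bad sets share one triple of edges at \<open>v\<close>, with no edge to
    \<open>x\<close> because bad sets avoid \<open>x\<close>. If there is no bad set, any triple of
    edges away from \<open>z\<close> and \<open>x\<close> will do. Taking \<open>p\<close> inside
    and \<open>q\<close> outside the triple separates them on every bad set.\<close>
  have "\<exists>T. T \<subseteq> ?N \<and> T \<inter> ecut J {x} = {} \<and> card T = 3 \<and> (\<forall>B. ?bad B \<longrightarrow> ecut J {v} \<inter> ecut J B = T)"
  proof (cases "\<exists>B. ?bad B")
    case True
    then obtain B where B: "?bad B" by blast
    let ?T = "ecut J {v} \<inter> ecut J B"
    have "v \<noteq> z" "v \<noteq> x" "z \<notin> B" "x \<notin> B" using B v by blast+
    then have "e \<notin> ecut J {z} \<and> e \<notin> ecut J {x}" if "e \<in> ?T" for e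
      using ecut_two_ends[of e J v z B] ecut_two_ends[of e J v x B] that B by blast
    then have "?T \<subseteq> ?N" "?T \<inter> ecut J {x} = {}" by blast+
    moreover have "\<forall>C. ?bad C \<longrightarrow> ecut J {v} \<inter> ecut J C = ?T"
    proof (intro allI impI)
      fix C assume C: "?bad C"
      show "ecut J {v} \<inter> ecut J C = ?T"
        by (rule six_bad_unique[OF v k(2)]) (use B C in simp_all)
    qed
    moreover have "card ?T = 3" using B by simp
    ultimately show ?thesis by blast
  next
    case False
    have "card (?N \<inter> ecut J {x}) \<le> Suc 0"
      using xq card_le_Suc0_iff_eq[of "?N \<inter> ecut J {x}"] fN by blast
    moreover have "card ?N = card (?N - ecut J {x}) + card (?N \<inter> ecut J {x})"
      using fN by (metis card_Diff_subset_Int card_mono finite_Int inf_le1 le_add_diff_inverse2)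
    ultimately have "3 \<le> card (?N - ecut J {x})" using k by linarith
    then obtain T where T: "T \<subseteq> ?N - ecut J {x}" "card T = 3" by (rule obtain_subset_with_card_n)
    have "T \<subseteq> ?N" "T \<inter> ecut J {x} = {}" using T(1) by blast+
    moreover have "\<forall>B. ?bad B \<longrightarrow> ecut J {v} \<inter> ecut J B = T" using False by blast
    ultimately show ?thesis using T(2) by blast
  qed
  then obtain T where T: "T \<subseteq> ?N" "T \<inter> ecut J {x} = {}" "card T = 3"
    "\<forall>B. ?bad B \<longrightarrow> ecut J {v} \<inter> ecut J B = T" by (elim exE conjE)
  have "T \<noteq> {}" using T(3) by auto
  then obtain p where p: "p \<in> T" by blast
  have "?N \<noteq> T" using T(3) k by auto
  then obtain q0 where q0: "q0 \<in> ?N" "q0 \<notin> T" using T(1) by blast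
  \<comment> \<open>An edge from \<open>v\<close> to \<open>x\<close> is chosen as \<open>q\<close>:
    being lifted instead of deleted, it costs \<open>x\<close> no degree.\<close>
  have "\<exists>q\<in>?N. q \<notin> T \<and> (\<forall>e. e \<in> ecut J {v} \<and> e \<in> ecut J {x} \<longrightarrow> e = q)"
  proof (cases "ecut J {v} \<inter> ecut J {x} = {}")
    case True
    then show ?thesis using q0 by blast
  next
    case False
    then obtain q where q: "q \<in> ecut J {v}" "q \<in> ecut J {x}" by blast
    then have "q \<in> ?N" using no_zx by blast
    moreover have "q \<notin> T" using q T(2) by blast
    ultimately show ?thesis using xq q by blast
  qed
  then obtain q where q: "q \<in> ?N" "q \<notin> T" "\<And>e. e \<in> ecut J {v} \<Longrightarrow> e \<in> ecut J {x} \<Longrightarrow> e = q" by blast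
  show ?thesis
  proof (rule that[of p q])
    show "p \<in> ?N" "p \<noteq> q" using p q T(1) by blast+
    fix B assume "B \<subseteq> vt J - {x, z}" "v \<notin> B" "dg J B = 8" "card (ecut J {v} \<inter> ecut J B) = 3"
    then have TB: "ecut J {v} \<inter> ecut J B = T" using T(4) by blast
    have "p \<in> ecut J B" using TB p by blast
    moreover have "q \<notin> ecut J B" using TB q by blast
    ultimately show "(p \<in> ecut J B) \<noteq> (q \<in> ecut J B)" by blast
  qed (use q in auto)
qed

text \<open>A sink with six edges has net flow 0 mod 3, but the boundary of \<open>v\<close> is -c.
  Lifting one pair leaves four edges, and -4c agrees with -c.\<close>

lemma no_degree_six:
  assumes v: "v \<in> vt J - {x, z}" "dg J {v} = 6" and e0: "e0 \<in> ecut J {v}" "e0 \<in> ecut J {z}"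
  shows False
proof -
  have vV: "v \<in> vt J" "v \<noteq> z" using v by auto
  let ?kz = "card (ecut J {v} \<inter> ecut J {z})"
  have kz1: "1 \<le> ?kz"
  proof -
    have "ecut J {v} \<inter> ecut J {z} \<noteq> {}" using e0 by blast
    then show ?thesis by (simp add: card_gt_0_iff Suc_le_eq)
  qed
  \<comment> \<open>The degree of \<open>{v, z}\<close> is d(x) + 7 - 2 * \<open>?kz\<close>, and it
    equals the degree of the complement. If the complement is \<open>{x}\<close>, parity fails;
    otherwise it is at least d(x) + 2. Hence at least four edges at \<open>v\<close> avoid the
    tip.\<close>
  have kz2: "?kz \<le> 2"
  proof -
    have i: "dg J (insert v {z}) + 2 * ?kz = dg J {z} + 6"
      using dg_insert[of v "{z}"] vV v by (simp add: Int_commute)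
    have R: "dg J (insert v {z}) = dg J (vt J - {v, z})" using dg_compl[OF val, of "{v, z}"] vV zV by simp
    have s: "vt J - {v, z} \<subseteq> vt J - {z}" "x \<in> vt J - {v, z}" "vt J - {v, z} \<noteq> vt J - {z}" using x v by auto
    show ?thesis
    proof (cases "vt J - {v, z} = {x}")
      case True
      then have "dg J {x} + 2 * ?kz = dg J {x} + 7" using i R dz by simp
      then show ?thesis by presburger
    next
      case False
      then have "dg J {x} + 2 \<le> dg J (vt J - {v, z})" using x_cut_cases[OF s(1,2)] s(3) by blast
      then show ?thesis using i R dz by simp
    qed
  qed
  have "card (ecut J {v} - ecut J {z}) = 6 - ?kz"
    using v by (simp add: dg_def card_Diff_subset_Int)
  then have k: "4 \<le> card (ecut J {v} - ecut J {z})" "card (ecut J {v} - ecut J {z}) \<le> 5"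
    using kz1 kz2 by simp_all
  obtain p q where pq: "p \<in> ecut J {v} - ecut J {z}" "q \<in> ecut J {v} - ecut J {z}" "p \<noteq> q"
    and qx: "\<And>e. e \<in> ecut J {v} \<Longrightarrow> e \<in> ecut J {x} \<Longrightarrow> e = q"
    and nb: "\<And>B. B \<subseteq> vt J - {x, z} \<Longrightarrow> v \<notin> B \<Longrightarrow> dg J B = 8 \<Longrightarrow> card (ecut J {v} \<inter> ecut J B) = 3 \<Longrightarrow>
      (p \<in> ecut J B) \<noteq> (q \<in> ecut J B)"
    using six_pair[OF v k] by blast
  let ?L = "lift J v p q"
  have l: "liftable J z v p q" using pq vV by (simp add: liftable_def)
  have vL: "valid ?L z" by (rule lift_valid[OF l val])
  have cv: "ecut ?L {v} = ecut J {v} - {p, q}" using pq by (simp add: lift_ecut[OF l])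
  have cS: "e \<in> ecut ?L S \<longleftrightarrow> e \<in> ecut J S" if "e \<in> ecut J {v} - {p, q}" for e S
    using that by (auto simp: lift_ecut[OF l])
  define D where "D = ecut J {v} - {p, q}"
  have int: "ecut ?L {v} \<inter> ecut ?L S = D \<inter> ecut J S" for S unfolding cv D_def using cS by blast
  have dL: "dg ?L {v} = 4"
  proof -
    have "card (ecut J {v} - {p, q}) = 6 - 2" using pq v by (simp add: dg_def card_Diff_subset)
    then show ?thesis using cv by (simp add: dg_def)
  qed
  have dir: "\<forall>e\<in>ecut ?L {v} \<inter> ecut ?L {z}. pre ?L e * chi ?L e {v} = - c"
  proof
    fix e assume "e \<in> ecut ?L {v} \<inter> ecut ?L {z}"
    then have "e \<in> D" "e \<in> ecut J {z}" unfolding int by blast+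
    then have "e \<in> ecut J {v}" "e \<noteq> p" by (auto simp: D_def)
    then show "pre ?L e * chi ?L e {v} = - c" using z_dir[OF v(1) _ \<open>e \<in> ecut J {z}\<close>] by (simp add: lift_chi_other)
  qed
  have "(bd J v + c) mod 3 = 0" using types[OF v(1)] v(2) by auto
  then have bal: "(bd ?L v + c * int (dg ?L {v})) mod 3 = 0" unfolding dL by simp presburger
  have vVL: "v \<in> vt ?L" using vV by simp
  let ?J = "sink ?L v c"
  note vt' = sink_vt[OF vL vVL vV(2) c dir bal]
  let ?k = "\<lambda>S. card (ecut J {v} \<inter> ecut J S)" and ?e = "\<lambda>S. card (D \<inter> ecut J S)"
  have dg': "dg ?J S + 2 * of_bool (p \<in> ecut J S \<and> q \<in> ecut J S) + ?e S = dg J S" for S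
    using sink_dg[OF vL vVL vV(2) c dir bal, of S] lift_dg[OF l fin(2), of S] unfolding int by simp
  have bt': "bsum ?J S = bsum J S - c * int (?e S)" if "finite S" "v \<notin> S" for S
    using sink_bt[OF vL vVL vV(2) c dir bal that] unfolding int by simp
  have fD: "finite D" by (simp add: D_def)
  have kk: "?k S = ?e S + of_bool (p \<in> ecut J S) + of_bool (q \<in> ecut J S)" for S
  proof -
    have "ecut J {v} \<inter> ecut J S = (D \<inter> ecut J S) \<union> ({p, q} \<inter> ecut J S)" using pq by (auto simp: D_def)
    moreover have "card ((D \<inter> ecut J S) \<union> ({p, q} \<inter> ecut J S)) = ?e S + card ({p, q} \<inter> ecut J S)"
      using fD by (intro card_Un_disjoint) (auto simp: D_def)
    moreover have "card ({p, q} \<inter> ecut J S) = of_bool (p \<in> ecut J S) + of_bool (q \<in> ecut J S)"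
      using pq(3) by (auto simp: of_bool_def Int_insert_left)
    ultimately show ?thesis by simp
  qed
  have e3: "?e S \<le> 3" if "z \<notin> S" "v \<notin> S" for S
  proof -
    have "D \<inter> ecut J S \<subseteq> (ecut J {v} - ecut J {z}) - {p, q}"
      using ecut_two_ends[of _ J v z S] that vV by (auto simp: D_def)
    then have "?e S \<le> card ((ecut J {v} - ecut J {z}) - {p, q})" by (intro card_mono) auto
    also have "\<dots> = card (ecut J {v} - ecut J {z}) - card {p, q}" using pq by (intro card_Diff_subset) auto
    finally show ?thesis using k pq(3) by simp
  qed
  have ins: "dg J (insert v S) + 2 * ?k S = dg J S + 6" if "v \<notin> S" for S
    using dg_insert[OF that] v by (simp add: Int_commute)
  have "ext ?J z"
  proof (rule smaller_extends)
    show "valid ?J z" by (rule sink_valid[OF vL vVL vV(2) c dir bal])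
    have "card (vt J - {v}) < card (vt J)" using vV by (intro psubset_card_mono) auto
    moreover have "card (ed J - {q}) \<le> card (ed J)" by (intro card_mono) auto
    ultimately show "card (vt ?J) + card (ed ?J) < card (vt J) + card (ed J)" using vt' by simp
    show "x \<in> vt ?J" using x v vt' by auto
  next
    fix B assume B0: "B \<noteq> {}" "B \<subseteq> vt ?J - {x, z}"
    have B: "B \<subseteq> vt J - {x, z}" "v \<notin> B" "z \<notin> B" using B0 vt' by auto
    have fB: "finite B" using B fin_sub by blast
    show "tame_deg (dg ?J B) (bsum ?J B)"
    proof (cases "\<exists>u. B = {u}")
      case True
      then obtain u where u: "B = {u}" by blast
      have u': "u \<in> vt J - {x, z}" "u \<noteq> v" using B u by auto
      have "?k B \<le> 1" unfolding u using common_nbr_le1[of u v] u' v by auto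
      then have e1: "?e B \<le> 1" and np: "\<not> (p \<in> ecut J B \<and> q \<in> ecut J B)"
        using kk[of B] by (auto simp: of_bool_def split: if_splits)
      from e1 consider "?e B = 0" | "?e B = 1" by linarith
      then show ?thesis
      proof cases
        case 1
        then have "dg ?J B = dg J B" using dg'[of B] np by (auto simp: of_bool_def split: if_splits)
        then show ?thesis using 1(1) bt'[OF fB B(2)] tame_sets[OF B(1) B0(1)] by simp
      next
        case 2
        then have "dg ?J B + 1 = dg J B" using dg'[of B] np by (auto simp: of_bool_def split: if_splits)
        then have "dg ?J B = dg J {u} - 1" using u by simp
        moreover have "bsum ?J B = bd J u - c" using 2(1) bt'[OF fB B(2)] u by simp
        ultimately show ?thesis using okc[OF u'(1)] unfolding deletable_def by simp
      qed
    next
      case False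
      then have c2: "2 \<le> card B" using card_ge2[OF fB B0(1)] by blast
      have "2 \<le> card (insert v B)" using c2 fB B by simp
      then have i8: "8 \<le> dg J (insert v B)" using dg_ge8[of "insert v B"] B v by auto
      have b8: "8 \<le> dg J B" by (rule dg_ge8[OF B(1) c2])
      have nb': "\<not> (dg J B = 8 \<and> ?k B = 3 \<and> ((p \<in> ecut J B) = (q \<in> ecut J B)))"
        using nb[OF B(1,2)] by blast
      \<comment> \<open>Let k edges join \<open>v\<close> to \<open>B\<close>. The new degree is
        d(B) - k, plus 1 if exactly one of \<open>p\<close> and \<open>q\<close> crosses
        \<open>B\<close>. Since 2(d(B) - k) = d(B) + d(insert v B) - 6 \<ge> 10, only d(B) = 8 with
        k = 3 can fall short, and then the choice of the pair supplies the additional 1.\<close>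
      have "6 \<le> dg ?J B"
      proof (cases "p \<in> ecut J B"; cases "q \<in> ecut J B")
        assume a: "p \<in> ecut J B" "q \<in> ecut J B"
        then have h: "dg ?J B + 2 + ?e B = dg J B" "?k B = ?e B + 2" using dg'[of B] kk[of B] by simp_all
        have "\<not> (dg J B = 8 \<and> ?e B = 1)" using nb' a h(2) by simp
        then show ?thesis using h ins[OF B(2)] i8 b8 by linarith
      next
        assume a: "p \<notin> ecut J B" "q \<notin> ecut J B"
        then have h: "dg ?J B + ?e B = dg J B" "?k B = ?e B" using dg'[of B] kk[of B] by simp_all
        have "\<not> (dg J B = 8 \<and> ?e B = 3)" using nb' a h(2) by simp
        then show ?thesis using h ins[OF B(2)] i8 b8 e3[OF B(3,2)] by linarith
      next
        assume a: "p \<in> ecut J B" "q \<notin> ecut J B"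
        then have h: "dg ?J B + ?e B = dg J B" "?k B = ?e B + 1" using dg'[of B] kk[of B] by simp_all
        then show ?thesis using ins[OF B(2)] i8 b8 e3[OF B(3,2)] by linarith
      next
        assume a: "p \<notin> ecut J B" "q \<in> ecut J B"
        then have h: "dg ?J B + ?e B = dg J B" "?k B = ?e B + 1" using dg'[of B] kk[of B] by simp_all
        then show ?thesis using ins[OF B(2)] i8 b8 e3[OF B(3,2)] by linarith
      qed
      then show ?thesis by (simp add: tame_deg_def)
    qed
  next
    fix X assume X0: "x \<in> X" "X \<subseteq> vt ?J - {z}" "X \<noteq> vt ?J - {z}"
    have X: "X \<subseteq> vt J - {z}" "v \<notin> X" "z \<notin> X" using X0 vt' by auto
    have "D \<inter> ecut J {z} = ecut J {v} \<inter> ecut J {z}" using pq by (auto simp: D_def)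
    then have dz': "dg ?J {z} \<le> dg J {x}" using dg'[of "{z}"] dz kz1 pq by simp
    have "dg J {x} \<le> dg ?J X + 1"
    proof (cases "X = {x}")
      case True
      have "D \<inter> ecut J {x} = {}" using qx by (auto simp: D_def)
      moreover have "p \<notin> ecut J {x}" using qx[of p] pq by blast
      ultimately show ?thesis using dg'[of X] True by simp
    next
      case False
      have "insert v X \<noteq> {x}" "insert v X \<noteq> vt J - {z}" "insert v X \<subseteq> vt J - {z}"
        using X v X0 vt' by auto
      then have i: "dg J {x} + 2 \<le> dg J (insert v X)" using x_cut_cases[of "insert v X"] X0 by blast
      have "X \<noteq> vt J - {z}" using X v by auto
      then have j: "dg J {x} + 2 \<le> dg J X" using x_cut_cases[OF X(1) X0(1)] False by blast
      show ?thesis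
      proof (cases "p \<in> ecut J X \<and> q \<in> ecut J X")
        case True
        then have h: "dg ?J X + 2 + ?e X = dg J X" "?k X = ?e X + 2" using dg'[of X] kk[of X] by simp_all
        then show ?thesis using ins[OF X(2)] i j by linarith
      next
        case False
        then have "dg ?J X + ?e X = dg J X" using dg'[of X] by (auto simp: of_bool_def split: if_splits)
        then show ?thesis using j e3[OF X(3,2)] by linarith
      qed
    qed
    then show "tallp ?J z X" using dz' by (intro tallp_strict) simp
  qed
  then have "ext ?L z" by (rule sink_ext[OF vL vVL vV(2) c dir bal])
  then show False using lift_ext[OF l val] nonext by blast
qed

lemma uniform_False: False
proof -
  have "ecut J {z} \<noteq> {}" using dz by (auto simp: dg_def)
  then obtain e where e: "e \<in> ecut J {z}" by blast
  obtain v where v: "v \<in> vt J - {x, z}" "e \<in> ecut J {v}" by (rule z_end[OF e])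
  show False using types[OF v(1)] no_degree_five[OF v(1) _ v(2) e] no_degree_six[OF v(1) _ v(2) e] by blast
qed

end

lemma (in critical) critical_False: False
proof -
  obtain c where c: "c = 1 \<or> c = -1" "\<forall>v\<in>vt J - {x, z}. deletable c v \<and> \<not> deletable (- c) v"
    using one_sign by blast
  interpret uniform J z x c using c by unfold_locales auto
  show False by (rule uniform_False)
qed

subsection \<open>Transfer to canvases\<close>

lemma partition_uncon:
  assumes r: "r \<in> B" and B: "B \<subseteq> V" and Q: "partition_on (insert r (V - B)) Q"
  shows "partition_on V (uncontract B r ` Q)"
proof (rule partition_onI)
  have sub: "U \<subseteq> insert r (V - B)" if "U \<in> Q" for U using Q that by (auto simp: partition_on_def)
  show "\<Union> (uncontract B r ` Q) = V"
  proof
    show "\<Union> (uncontract B r ` Q) \<subseteq> V" using sub r B by (fastforce simp: uncontract_def split: if_splits)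
    show "V \<subseteq> \<Union> (uncontract B r ` Q)"
    proof
      fix v assume v: "v \<in> V"
      define w where "w = (if v \<in> B then r else v)"
      have "w \<in> \<Union>Q" using partition_onD1[OF Q] v by (auto simp: w_def)
      then obtain U where U: "U \<in> Q" "w \<in> U" by blast
      then have "v \<in> uncontract B r U" by (auto simp: uncontract_def w_def split: if_splits)
      then show "v \<in> \<Union> (uncontract B r ` Q)" using U by blast
    qed
  qed
next
  show "{} \<notin> uncontract B r ` Q"
  proof
    assume "{} \<in> uncontract B r ` Q"
    then obtain U where U: "U \<in> Q" "uncontract B r U = {}" by (metis imageE)
    then have "U \<noteq> {}" "U \<subseteq> insert r (V - B)" using Q by (auto simp: partition_on_def)
    then show False using U r by (auto simp: uncontract_def split: if_splits)
  qed
next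
  fix X Y assume XY: "X \<in> uncontract B r ` Q" "Y \<in> uncontract B r ` Q" "X \<noteq> Y"
  then obtain U W where U: "U \<in> Q" "X = uncontract B r U" and W: "W \<in> Q" "Y = uncontract B r W" by blast
  have "U \<noteq> W" using XY U W by blast
  then have dj: "U \<inter> W = {}" using partition_onD2[OF Q] U W by (auto simp: disjoint_def)
  have "U \<subseteq> insert r (V - B)" "W \<subseteq> insert r (V - B)" using Q U W by (auto simp: partition_on_def)
  then show "disjnt X Y" using dj U W r by (auto simp: uncontract_def disjnt_def split: if_splits)
qed

text \<open>If the contraction of some set has no flow, the partition of the smaller graph pulls
  back along the contraction. Otherwise the singletons serve: a vertex for which they are tall and
  tame would yield an instance of \<open>critical\<close>.\<close>

lemma splits_all:
  fixes J :: "('v, 'e) rgraph" and z :: 'v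
  shows "splits J z"
proof (induction "card (vt J) + card (ed J)" arbitrary: J z rule: less_induct)
  case (less J z)
  have main: "\<exists>Q. partition_on (vt J - {z}) Q \<and>
      (\<forall>U\<in>Q. (\<forall>W\<in>Q - {U}. tame_deg (dg J W) (bsum J W)) \<longrightarrow> \<not> tallp J z U)"
    if val: "valid J z" and ne: "\<not> ext J z"
  proof -
    have fV: "finite (vt J)" and zV: "z \<in> vt J" using val by (auto simp: valid_def)
    show ?thesis
    proof (cases "\<exists>B. B \<subseteq> vt J - {z} \<and> 2 \<le> card B \<and> (\<forall>f. \<not> flow_off J z B f)")
      case True
      then obtain B where B: "B \<subseteq> vt J - {z}" "2 \<le> card B" "\<And>f. \<not> flow_off J z B f" by blast
      have "B \<noteq> {}" using B by auto
      then obtain r where r: "r \<in> B" by blast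
      have BV: "B \<subseteq> vt J" "z \<notin> B" "r \<noteq> z" using B r by auto
      let ?C = "contract J B r"
      have vC: "valid ?C z" by (rule contract_valid[OF val r BV(1,2)])
      have nC: "\<not> ext ?C z" using B(3) contract_rflow[OF r BV(1,2)] unfolding ext_def by blast
      have "card (vt ?C) < card (vt J)"
      proof -
        have fB: "finite B" using BV fV finite_subset by blast
        have "card (insert r (vt J - B)) \<le> Suc (card (vt J - B))" by (rule card_insert_le_m1) auto
        also have "\<dots> < card (vt J - B) + card B" using B by simp
        also have "\<dots> = card (vt J)" using BV fB fV by (metis add.commute card_Diff_subset card_mono le_add_diff_inverse)
        finally show ?thesis by simp
      qed
      then have "splits ?C z" by (intro less) simp
      then obtain Q where Q: "partition_on (vt ?C - {z}) Q"
        "\<forall>U\<in>Q. (\<forall>W\<in>Q - {U}. tame_deg (dg ?C W) (bsum ?C W)) \<longrightarrow> \<not> tallp ?C z U"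
        using vC nC unfolding splits_def by blast
      have VC: "vt ?C - {z} = insert r ((vt J - {z}) - B)" using BV by auto
      have P: "partition_on (vt J - {z}) (uncontract B r ` Q)"
        by (rule partition_uncon[OF r B(1)]) (use Q(1) VC in simp)
      have uz: "uncontract B r {z} = {z}" using BV r by (auto simp: uncontract_def)
      have tl: "tallp ?C z U \<longleftrightarrow> tallp J z (uncontract B r U)" for U
        by (simp add: tallp_def contract_dg[OF r] contract_ecut[OF r] contract_chi[OF r] uz)
      have sub: "U \<subseteq> insert r (vt J - B)" if "U \<in> Q" for U using Q(1) that by (auto simp: partition_on_def)
      have t: "tame_deg (dg ?C W) (bsum ?C W) \<longleftrightarrow> tame_deg (dg J (uncontract B r W)) (bsum J (uncontract B r W))" if "W \<in> Q" for W
        using contract_bt[OF r fV BV(1) sub[OF that]] by (simp add: contract_dg[OF r])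
      have "\<not> tallp J z (uncontract B r U)" if U: "U \<in> Q" and o: "\<forall>W\<in>uncontract B r ` Q - {uncontract B r U}. tame_deg (dg J W) (bsum J W)" for U
      proof -
        have "tame_deg (dg ?C W) (bsum ?C W)" if W: "W \<in> Q - {U}" for W
        proof -
          have "uncontract B r W \<noteq> uncontract B r U"
          proof
            assume eq: "uncontract B r W = uncontract B r U"
            have "W = U"
            proof (cases "r \<in> W \<longleftrightarrow> r \<in> U")
              case True
              then show ?thesis using eq sub[of W] sub[OF U] W r by (auto simp: uncontract_def split: if_splits)
            next
              case False
              then show ?thesis using eq r by (auto simp: uncontract_def split: if_splits)
            qed
            then show False using W by blast
          qed
          then show ?thesis using o W t by auto
        qed
        then show ?thesis using Q(2) U tl by blast
      qed
      then show ?thesis using P by (intro exI[of _ "uncontract B r ` Q"]) blast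
    next
      case False
      let ?Q = "(\<lambda>v. {v}) ` (vt J - {z})"
      have "partition_on (vt J - {z}) ?Q" by (rule partition_onI) auto
      moreover have "\<not> tallp J z {x}"
        if x: "x \<in> vt J" "x \<noteq> z" and o: "\<forall>W\<in>?Q - {{x}}. tame_deg (dg J W) (bsum J W)" for x
      proof
        assume tl: "tallp J z {x}"
        have "tame_deg (dg J {v}) (bd J v)" if "v \<in> vt J - {x, z}" for v
        proof -
          have "{v} \<in> ?Q - {{x}}" using that by auto
          then have "tame_deg (dg J {v}) (bsum J {v})" using o by blast
          then show ?thesis by simp
        qed
        moreover have "\<exists>f. flow_off J z B f" if "B \<subseteq> vt J - {z}" "2 \<le> card B" for B
          using that False by blast
        ultimately have "critical J z x"
          using val ne x tl less by (intro critical.intro)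
        then show False by (rule critical.critical_False)
      qed
      ultimately show ?thesis by (intro exI[of _ ?Q]) auto
    qed
  qed
  show ?case unfolding splits_def by (intro impI) (rule main)
qed

section \<open>Arithmetic in the ring of integers modulo 3\<close>

lemma Rep_3_of_int: "Rep_bit1 (of_int i :: 3) = i mod 3"
  using bit1.Rep_Abs_mod[where 'a = num1] by (simp add: bit1.of_int_eq)

lemma of_int_Rep_3: "of_int (Rep_bit1 (b :: 3)) = b"
  by (metis bit1.Rep_inverse bit1.Rep_mod bit1.of_int_eq)

lemma of_int_eq_3: "(of_int i :: 3) = of_int j \<longleftrightarrow> i mod 3 = j mod 3"
  by (metis Rep_3_of_int Rep_bit1_inject)

lemma of_int_eq_Rep_3: "(of_int i :: 3) = b \<longleftrightarrow> i mod 3 = Rep_bit1 b mod 3"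
  using of_int_eq_3[of i "Rep_bit1 b"] by (simp add: of_int_Rep_3)

text \<open>The end maps are abstract because the identity is applied both to \<open>G\<close> and
  to its quotient, whose vertices have a different type.\<close>

lemma out_in_sum:
  fixes D s t :: "'e \<Rightarrow> 'a"
  assumes "finite E" "I = {e \<in> E. s e = X \<or> t e = X}" "\<And>e. e \<in> I \<Longrightarrow> s e \<noteq> t e"
    "\<And>e. e \<in> I \<Longrightarrow> D e = s e \<or> D e = t e"
  shows "int (card {e \<in> I. D e \<noteq> X}) - int (card {e \<in> I. D e = X}) =
    (\<Sum>e\<in>E. (if D e = t e then 1 else -1) * (of_bool (s e = X) - of_bool (t e = X)))"
proof -
  have fI: "finite I" using assms(1,2) by simp
  have "(\<Sum>e\<in>E. (if D e = t e then 1 else -1) * (of_bool (s e = X) - of_bool (t e = X))) =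
    (\<Sum>e\<in>I. (if D e = t e then 1 else -1) * (of_bool (s e = X) - of_bool (t e = X) :: int))"
    using assms(1,2) by (intro sum.mono_neutral_right) auto
  also have "\<dots> = (\<Sum>e\<in>I. if D e \<noteq> X then 1 else -1)"
    using assms(2-4) by (intro sum.cong) (auto split: if_splits)
  also have "\<dots> = int (card {e \<in> I. D e \<noteq> X}) - int (card {e \<in> I. D e = X})"
    using fI by (simp add: sum.If_cases Int_def Collect_neg_eq[symmetric])
  finally show ?thesis by simp
qed

section \<open>Canvases as graphs with a reference direction\<close>

definition esrc :: "('v, 'e, 'm) mgraph_scheme \<Rightarrow> 'e \<Rightarrow> 'v" where
  "esrc G e = (SOME a. a \<in> ends G e)"

definition etgt :: "('v, 'e, 'm) mgraph_scheme \<Rightarrow> 'e \<Rightarrow> 'v" where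
  "etgt G e = (SOME a. a \<in> ends G e - {esrc G e})"

definition rgraph_of :: "('v, 'e) bgraph \<Rightarrow> ('e \<Rightarrow> 'v) \<Rightarrow> ('v, 'e) rgraph" where
  "rgraph_of G \<psi> = \<lparr>vt = verts G, ed = edges G, src = esrc G, tgt = etgt G,
     bd = (\<lambda>v. Rep_bit1 (boundary G v)), pre = (\<lambda>e. if \<psi> e = etgt G e then 1 else -1)\<rparr>"

lemma rgraph_of_simps [simp]:
  "vt (rgraph_of G \<psi>) = verts G" "ed (rgraph_of G \<psi>) = edges G" "src (rgraph_of G \<psi>) = esrc G"
  "tgt (rgraph_of G \<psi>) = etgt G" "bd (rgraph_of G \<psi>) v = Rep_bit1 (boundary G v)"
  "pre (rgraph_of G \<psi>) e = (if \<psi> e = etgt G e then 1 else -1)"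
  by (simp_all add: rgraph_of_def)

lemma of_int_bt: "(of_int (bsum (rgraph_of G \<psi>) S) :: 3) = (\<Sum>v\<in>S. boundary G v)"
  by (simp add: bsum_def of_int_Rep_3)

lemma ends_src_tgt:
  assumes "graph G" "e \<in> edges G"
  shows "ends G e = {esrc G e, etgt G e}" "esrc G e \<noteq> etgt G e" "esrc G e \<in> verts G" "etgt G e \<in> verts G"
proof -
  have c: "card (ends G e) = 2" and s: "ends G e \<subseteq> verts G" using assms by (auto simp: graph_def)
  obtain a b where ab: "ends G e = {a, b}" "a \<noteq> b" using c by (auto simp: card_2_iff)
  have "\<exists>w. w \<in> ends G e" using ab by auto
  then have 1: "esrc G e \<in> ends G e" unfolding esrc_def by (rule someI_ex)
  have "\<exists>w. w \<in> ends G e - {esrc G e}" using ab by auto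
  then have 2: "etgt G e \<in> ends G e - {esrc G e}" unfolding etgt_def by (rule someI_ex)
  show 3: "ends G e = {esrc G e, etgt G e}" using 1 2 ab by auto
  show "esrc G e \<noteq> etgt G e" using 2 by auto
  show "esrc G e \<in> verts G" "etgt G e \<in> verts G" using 1 2 s by auto
qed

lemma incident_ecut:
  assumes "graph G"
  shows "incident G v = ecut (rgraph_of G \<psi>) {v}"
proof -
  have "v \<in> ends G e \<longleftrightarrow> (esrc G e \<in> {v}) \<noteq> (etgt G e \<in> {v})" if "e \<in> edges G" for e
    using ends_src_tgt(1,2)[OF assms that] by auto
  then show ?thesis by (auto simp: incident_def ecut_iff)
qed

lemma deg_dg: "graph G \<Longrightarrow> deg G v = dg (rgraph_of G \<psi>) {v}"
  by (simp add: deg_def dg_def incident_ecut[of G v \<psi>])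

lemma out_in_net:
  assumes G: "graph G" and D: "\<And>e. e \<in> incident G v \<Longrightarrow> D e \<in> ends G e"
  shows "int (outdeg G D v) - int (indeg G D v) = net (rgraph_of G \<psi>) (\<lambda>e. if D e = etgt G e then 1 else -1) {v}"
proof -
  have fE: "finite (edges G)" using G by (simp add: graph_def)
  have I: "incident G v = {e \<in> edges G. esrc G e = v \<or> etgt G e = v}"
    using ends_src_tgt[OF G] by (auto simp: incident_def)
  have "D e = esrc G e \<or> D e = etgt G e" "esrc G e \<noteq> etgt G e" if "e \<in> incident G v" for e
    using D[OF that] that ends_src_tgt[OF G, of e] by (auto simp: incident_def)
  then show ?thesis
    unfolding outdeg_def indeg_def net_def chi_def
    using out_in_sum[OF fE I, of D] by simp
qed

text \<open>Reachability is symmetric, so the components are disjoint and their zero sums add up to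
  the total required by \<open>valid\<close>.\<close>

lemma sum_boundary:
  assumes "bordered_graph G"
  shows "(\<Sum>v\<in>verts G. boundary G v) = 0"
proof -
  have fV: "finite (verts G)" using assms by (simp add: bordered_graph_def graph_def)
  have sy: "sym ((adj G)\<^sup>*)"
    by (rule sym_rtrancl) (auto simp: sym_def adj_def insert_commute)
  have cl: "{u \<in> verts G. (v, u) \<in> (adj G)\<^sup>*} = {u \<in> verts G. (w, u) \<in> (adj G)\<^sup>*}"
    if "(v, w) \<in> (adj G)\<^sup>*" for v w
    using that sy by (auto dest: symD intro: rtrancl_trans)
  have dj: "A \<inter> B = {}" if "A \<in> components G" "B \<in> components G" "A \<noteq> B" for A B
  proof (rule ccontr)
    assume "A \<inter> B \<noteq> {}"
    then obtain w where w: "w \<in> A" "w \<in> B" by blast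
    have "\<exists>v. A = {u \<in> verts G. (v, u) \<in> (adj G)\<^sup>*}" "\<exists>v. B = {u \<in> verts G. (v, u) \<in> (adj G)\<^sup>*}"
      using that(1,2) by (auto simp: components_def)
    then obtain v v' where v: "A = {u \<in> verts G. (v, u) \<in> (adj G)\<^sup>*}"
      and v': "B = {u \<in> verts G. (v', u) \<in> (adj G)\<^sup>*}" by blast
    have "(v, w) \<in> (adj G)\<^sup>*" "(v', w) \<in> (adj G)\<^sup>*" using w v v' by auto
    then have "A = B" using cl[of v w] cl[of v' w] unfolding v v' by simp
    then show False using that(3) by blast
  qed
  have U: "\<Union> (components G) = verts G" by (auto simp: components_def)
  have "sum (boundary G) (\<Union> (components G)) = sum (sum (boundary G)) (components G)"
    using sum.Union_disjoint[of "components G" "boundary G"] dj fV by (auto simp: components_def)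
  also have "\<dots> = 0" using assms by (intro sum.neutral) (auto simp: bordered_graph_def)
  finally show ?thesis by (simp add: U)
qed

lemma tame_deg_of_tame:
  assumes "d \<ge> 4 + (if even d then (if b = 0 then 0 else 2) else (if b = (0 :: 3) then 3 else 1))"
  shows "tame_deg d (Rep_bit1 b)"
proof -
  have z: "Rep_bit1 b mod 3 = 0 \<longleftrightarrow> b = 0" using of_int_eq_Rep_3[of 0 b] by auto
  have "6 \<le> d \<or> d = 4 \<and> b = 0 \<or> d = 5 \<and> b \<noteq> 0"
    using assms by (cases "even d"; cases "b = 0"; simp; presburger)
  then show ?thesis by (auto simp: tame_deg_def z)
qed

text \<open>Criticality is applied to the partition into \<open>B\<close> and singletons; comparing
  heads with the images of \<open>etgt\<close> turns the flow of the quotient into signs on the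
  edges of \<open>G\<close>.\<close>

lemma crit_of:
  assumes G: "graph G" and z: "z \<in> verts G" and tip: "tip_preflow G z \<psi>"
    and cr: "critical_canvas G z \<psi>" and B: "B \<subseteq> verts G - {z}" "2 \<le> card B"
  shows "\<exists>f. flow_off (rgraph_of G \<psi>) z B f"
proof -
  let ?J = "rgraph_of G \<psi>"
  let ?P = "insert B ((\<lambda>v. {v}) ` (verts G - B))"
  let ?H = "quotient_graph G ?P"
  have fE: "finite (edges G)" and fV: "finite (verts G)" using G by (auto simp: graph_def)
  have Bne: "B \<noteq> {}" using B by auto
  have P: "partition_on (verts G) ?P" using B Bne by (intro partition_onI) (auto simp: disjnt_def)
  have "tip_respecting z ?P" "nontrivial_partition ?P"
    using B z by (auto simp: tip_respecting_def nontrivial_partition_def)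
  then have "extends_to_flow ?H {z} (quotient_orientation ?P \<psi>)"
    using cr P unfolding critical_canvas_def by blast
  then obtain D where D: "nowhere_zero_flow ?H D" "\<forall>e\<in>incident ?H {z}. D e = quotient_orientation ?P \<psi> e"
    by (auto simp: extends_to_flow_def)
  have part: "part_of ?P v = (if v \<in> B then B else {v})" if "v \<in> verts G" for v
    unfolding part_of_def using that by (intro the_equality) auto
  define s where "s e = part_of ?P (esrc G e)" for e
  define t where "t e = part_of ?P (etgt G e)" for e
  have se: "s e = (if esrc G e \<in> B then B else {esrc G e})" "t e = (if etgt G e \<in> B then B else {etgt G e})"
    if "e \<in> edges G" for e using part ends_src_tgt[OF G that] by (auto simp: s_def t_def)
  have HE: "edges ?H = {e \<in> edges G. \<not> (esrc G e \<in> B \<and> etgt G e \<in> B)}"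
  proof -
    have "(\<exists>X\<in>?P. ends G e \<subseteq> X) \<longleftrightarrow> esrc G e \<in> B \<and> etgt G e \<in> B" if "e \<in> edges G" for e
      using ends_src_tgt[OF G that] by auto
    then show ?thesis by (auto simp: quotient_graph_def)
  qed
  have Hends: "ends ?H e = {s e, t e}" if "e \<in> edges G" for e
    using ends_src_tgt[OF G that] by (simp add: quotient_graph_def s_def t_def)
  have st: "s e \<noteq> t e" if "e \<in> edges ?H" for e
    using that se[of e] ends_src_tgt[OF G, of e] unfolding HE by auto
  \<comment> \<open>Edges inside \<open>B\<close> are missing from the quotient. Their value 1 is
    arbitrary, since they cross no part.\<close>
  define f where "f e = (if e \<in> edges ?H then if D e = t e then 1 else -1 else 1 :: int)" for e
  have net: "net ?J f X = int (outdeg ?H D X) - int (indeg ?H D X)" if X: "X \<in> ?P" for X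
  proof -
    have fH: "finite (edges ?H)" using fE unfolding HE by simp
    have I: "incident ?H X = {e \<in> edges ?H. s e = X \<or> t e = X}"
      using Hends unfolding incident_def HE by auto
    have DI: "D e = s e \<or> D e = t e" if "e \<in> incident ?H X" for e
      using D(1) that Hends[of e] unfolding nowhere_zero_flow_def orientation_of_def I HE by auto
    have stI: "s e \<noteq> t e" if "e \<in> incident ?H X" for e using st that unfolding I by blast
    have inX: "(s e = X) = (esrc G e \<in> X)" "(t e = X) = (etgt G e \<in> X)" if "e \<in> edges G" for e
      using se[OF that] X ends_src_tgt[OF G that] by (auto split: if_splits)
    have "net ?J f X = (\<Sum>e\<in>edges ?H. f e * chi ?J e X)"
    proof -
      have "chi ?J e X = 0" if "e \<in> edges G - edges ?H" for e
        using that X unfolding HE by (auto simp: chi_def)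
      then show ?thesis unfolding net_def rgraph_of_simps using fE HE by (intro sum.mono_neutral_right) auto
    qed
    also have "\<dots> = (\<Sum>e\<in>edges ?H. (if D e = t e then 1 else -1) * (of_bool (s e = X) - of_bool (t e = X)))"
      using inX HE by (intro sum.cong) (auto simp: f_def chi_def)
    also have "\<dots> = int (outdeg ?H D X) - int (indeg ?H D X)"
      unfolding outdeg_def indeg_def using out_in_sum[OF fH I stI DI] by simp
    finally show ?thesis .
  qed
  have netmod: "net ?J f X mod 3 = bsum ?J X mod 3" if X: "X \<in> ?P" for X
  proof -
    have "of_nat (outdeg ?H D X) - of_nat (indeg ?H D X) = boundary ?H X"
      using D(1) X by (auto simp: nowhere_zero_flow_def quotient_graph_def)
    then have "(of_int (net ?J f X) :: 3) = (\<Sum>v\<in>X. boundary G v)"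
      unfolding net[OF X] by (simp add: quotient_graph_def)
    also have "\<dots> = of_int (bsum ?J X)" by (rule of_int_bt[symmetric])
    finally show ?thesis by (simp add: of_int_eq_3)
  qed
  have "flow_off ?J z B f"
    unfolding flow_off_def
  proof (intro conjI ballI)
    fix e assume "e \<in> ed ?J" then show "f e \<in> {1, -1}" by (simp add: f_def)
  next
    fix e assume e: "e \<in> ecut ?J {z}"
    then have eG: "e \<in> edges G" "esrc G e = z \<and> etgt G e \<noteq> z \<or> esrc G e \<noteq> z \<and> etgt G e = z"
      by (auto simp: ecut_iff)
    have zB: "z \<notin> B" using B by auto
    have eH: "e \<in> edges ?H" using eG zB unfolding HE by auto
    have "s e = {z} \<or> t e = {z}" using se[OF eG(1)] eG(2) zB by auto
    then have "e \<in> incident ?H {z}" using eH Hends[OF eG(1)] by (auto simp: incident_def)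
    then have De: "D e = part_of ?P (\<psi> e)" using D(2) by (simp add: quotient_orientation_def)
    have "e \<in> incident G z" using e incident_ecut[OF G] by blast
    then have "\<psi> e \<in> ends G e" using tip by (auto simp: tip_preflow_def orientation_of_def)
    then have "\<psi> e = esrc G e \<or> \<psi> e = etgt G e" using ends_src_tgt[OF G eG(1)] by auto
    then have "D e = t e \<longleftrightarrow> \<psi> e = etgt G e"
    proof
      assume p: "\<psi> e = esrc G e"
      then have "D e = s e" using De by (simp only: s_def)
      then show ?thesis using st[OF eH] p ends_src_tgt(2)[OF G eG(1)] by simp
    next
      assume p: "\<psi> e = etgt G e"
      then have "D e = t e" using De by (simp only: t_def)
      then show ?thesis using p by simp
    qed
    then show "f e = pre ?J e" using eH by (simp add: f_def)
  next
    fix v assume "v \<in> vt ?J - B"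
    then have "{v} \<in> ?P" by auto
    then show "net ?J f {v} mod 3 = bd ?J v mod 3" using netmod[of "{v}"] by simp
  next
    show "net ?J f B mod 3 = bsum ?J B mod 3" by (rule netmod) simp
  qed
  then show ?thesis by blast
qed

theorem mainTheorem4:
  fixes G :: "('v, 'e) bgraph" and z x :: 'v and \<psi> :: "'e \<Rightarrow> 'v"
  assumes "easel G z x \<psi>"
    and "tall G z x \<psi>"
    and "tame G z x"
  shows "\<not> critical_canvas G z \<psi>"
proof
  assume cr: "critical_canvas G z \<psi>"
  let ?J = "rgraph_of G \<psi>"
  have bG: "bordered_graph G" and z: "z \<in> verts G" and x: "x \<in> verts G" "x \<noteq> z" and tip: "tip_preflow G z \<psi>"
    using assms(1) by (auto simp: easel_def canvas_def)
  have G: "graph G" using bG by (simp add: bordered_graph_def)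
  have psi: "\<psi> e \<in> ends G e" if "e \<in> incident G z" for e
    using tip that by (auto simp: tip_preflow_def orientation_of_def)
  have val: "valid ?J z"
  proof -
    have "(of_int (net ?J (pre ?J) {z}) :: 3) = boundary G z"
    proof -
      have "net ?J (pre ?J) {z} = int (outdeg G \<psi> z) - int (indeg G \<psi> z)"
        using out_in_net[OF G psi, where \<psi> = \<psi>] by (simp add: net_def)
      then show ?thesis using tip by (simp add: tip_preflow_def)
    qed
    then have "net ?J (pre ?J) {z} mod 3 = bd ?J z mod 3" by (simp add: of_int_eq_Rep_3)
    moreover have "bsum ?J (verts G) mod 3 = 0"
      using of_int_bt[of G \<psi> "verts G"] sum_boundary[OF bG] of_int_eq_3[of _ 0] by simp
    ultimately show ?thesis
      using G z ends_src_tgt[OF G] by (auto simp: valid_def graph_def)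
  qed
  have "critical ?J z x"
  proof
    show "valid ?J z" by (rule val)
    show "\<not> ext ?J z"
    proof
      assume "ext ?J z"
      then obtain f where f: "rflow ?J z f" by (auto simp: ext_def)
      define D where "D e = (if f e = 1 then etgt G e else esrc G e)" for e
      have De: "D e \<in> ends G e" if "e \<in> edges G" for e using ends_src_tgt[OF G that] by (auto simp: D_def)
      have fe: "(if D e = etgt G e then 1 else -1) = f e" if "e \<in> edges G" for e
        using f that ends_src_tgt(2)[OF G that] by (auto simp: D_def rflow_def)
      have "of_nat (outdeg G D v) - of_nat (indeg G D v) = boundary G v" if "v \<in> verts G" for v
      proof -
        have "int (outdeg G D v) - int (indeg G D v) = net ?J (\<lambda>e. if D e = etgt G e then 1 else -1) {v}"
          by (rule out_in_net[OF G]) (auto simp: incident_def intro: De)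
        also have "\<dots> = net ?J f {v}" unfolding net_def using fe by (intro sum.cong) auto
        finally have "(of_int (int (outdeg G D v) - int (indeg G D v)) :: 3) = boundary G v"
          using f that by (simp add: rflow_def of_int_eq_Rep_3)
        then show ?thesis by simp
      qed
      then have "nowhere_zero_flow G D" using De by (auto simp: nowhere_zero_flow_def orientation_of_def)
      moreover have "D e = \<psi> e" if e: "e \<in> incident G z" for e
      proof -
        have eG: "e \<in> edges G" using e by (simp add: incident_def)
        have "f e = pre ?J e" using f e incident_ecut[OF G] by (auto simp: rflow_def)
        moreover have "\<psi> e = esrc G e \<or> \<psi> e = etgt G e" using psi[OF e] ends_src_tgt[OF G eG] by auto
        ultimately show ?thesis by (auto simp: D_def)
      qed
      ultimately show False using cr by (auto simp: critical_canvas_def extends_to_flow_def)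
    qed
    show "\<And>B. B \<subseteq> vt ?J - {z} \<Longrightarrow> 2 \<le> card B \<Longrightarrow> \<exists>f. flow_off ?J z B f"
      using crit_of[OF G z tip cr] by simp
    show "x \<in> vt ?J" "x \<noteq> z" using x by simp_all
    show "tame_deg (dg ?J {v}) (bd ?J v)" if "v \<in> vt ?J - {x, z}" for v
    proof -
      have "deg G v \<ge> 4 + abs_tau G v" using assms(3) that by (simp add: tame_def)
      then show ?thesis using tame_deg_of_tame[of "deg G v" "boundary G v"]
        by (simp add: abs_tau_def deg_dg[OF G, of v \<psi>, symmetric])
    qed
    show "tallp ?J z {x}"
    proof -
      have "pre ?J e * chi ?J e {z} = (if \<psi> e = z then -1 else 1)" if e: "e \<in> incident G z" for e
      proof -
        have eG: "e \<in> edges G" using e by (simp add: incident_def)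
        have "\<psi> e = esrc G e \<or> \<psi> e = etgt G e" using psi[OF e] ends_src_tgt[OF G eG] by auto
        moreover have "esrc G e = z \<or> etgt G e = z" using e ends_src_tgt[OF G eG] by (auto simp: incident_def)
        ultimately show ?thesis using ends_src_tgt(2)[OF G eG] by (auto simp: chi_def)
      qed
      then show ?thesis
        using assms(2) unfolding tall_def tallp_def deg_dg[OF G, of _ \<psi>] incident_ecut[OF G, of _ \<psi>]
        by (smt (verit, best) DiffD1)
    qed
    show "splits J' z'" for J' :: "('v, 'e) rgraph" and z' by (rule splits_all)
  qed
  then show False by (rule critical.critical_False)
qed

end
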